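(* Fix a positive integer $k$ (a constant, not part of the input). There is a deterministic algorithm that, given a set $Z=\{z_1,\ldots,z_n\}\subseteq\mathbb{N}$ of $n$ positive integers and targets $t_1,\ldots,t_k$, decides $k$-Subset Sum on this input in time $\tilde{O}(n^{k/(k+1)}\,t^k)$, where $t=\max\{t_1,\ldots,t_k\}$.
   Context: $k$-Subset Sum: given a set $Z$ of $n$ positive integers and $k$ targets $t_1,\ldots,t_k$, determine whether there exist $k$ pairwise disjoint subsets $Z_1,\ldots,Z_k\subseteq Z$ with $\Sigma(Z_i)=t_i$ for $i=1,\ldots,k$, where $\Sigma(X)=\sum_{x\in X}x$. The notation $\tilde{O}(\cdot)$ suppresses polylogarithmic factors.
   Formalization: The stated time bound is proved for nonempty Z contained in {1,…,t}; for arbitrary Z the cost of reading Z (1 plus its total bit length) is added to n^{k/(k+1)} t^k, since for k=1, t=1 all n numbers must be read. Time is logarithmic-cost RAM time. *)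

theory Defs
  imports Complex_Main "HOL-Library.Disjoint_Sets" "HOL-Library.Log_Nat"
begin

definition k_subset_sum :: "nat set \<Rightarrow> nat list \<Rightarrow> bool" where
  "k_subset_sum Z ts \<longleftrightarrow>
     (\<exists>S :: nat \<Rightarrow> nat set. disjoint_family_on S {..<length ts} \<and>
        (\<forall>i<length ts. S i \<subseteq> Z \<and> \<Sum>(S i) = ts ! i))"


text \<open>
  Algorithms are programs of a random access machine with the logarithmic cost criterion
  (Aho, Hopcroft, Ullman): every operation, multiplication and division included, is charged
  the number of bits of its operands, and every memory access the number of bits of
  the address and of the datum. Memory is organised as finitely many arrays (those named in the
  program), which differs from a single array by constant factors only; a scalar variable is
  cell 0 of an array. Control flow is structured.
\<close>

type_synonym store = "string \<Rightarrow> nat \<Rightarrow> nat"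

datatype expr =
    Const nat
  | Elem string expr
  | Add expr expr
  | Sub expr expr
  | Mul expr expr
  | Quot expr expr

datatype com =
    Skip
  | Put string expr expr  \<comment> \<open>\<open>Put a e f\<close> is the assignment \<open>a[e] := f\<close>\<close>
  | Seq com com
  | Ite expr com com      \<comment> \<open>a condition holds iff its value is nonzero\<close>
  | While expr com

definition bits :: "nat \<Rightarrow> nat" where
  "bits x = max 1 (floorlog 2 x)"

text \<open>Subtraction is truncated at 0, and a quotient by 0 is 0.\<close>

primrec ev :: "expr \<Rightarrow> store \<Rightarrow> nat" where
  "ev (Const c) s = c"
| "ev (Elem a e) s = s a (ev e s)"
| "ev (Add e f) s = ev e s + ev f s"
| "ev (Sub e f) s = ev e s - ev f s"
| "ev (Mul e f) s = ev e s * ev f s"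
| "ev (Quot e f) s = ev e s div ev f s"

primrec ev_cost :: "expr \<Rightarrow> store \<Rightarrow> nat" where
  "ev_cost (Const c) s = bits c"
| "ev_cost (Elem a e) s = ev_cost e s + bits (ev e s) + bits (s a (ev e s))"
| "ev_cost (Add e f) s = ev_cost e s + ev_cost f s + bits (ev e s) + bits (ev f s)"
| "ev_cost (Sub e f) s = ev_cost e s + ev_cost f s + bits (ev e s) + bits (ev f s)"
| "ev_cost (Mul e f) s = ev_cost e s + ev_cost f s + bits (ev e s) + bits (ev f s)"
| "ev_cost (Quot e f) s = ev_cost e s + ev_cost f s + bits (ev e s) + bits (ev f s)"

text \<open>\<open>exec c s T s'\<close>: started in \<open>s\<close>, the program \<open>c\<close> halts in \<open>s'\<close> after time \<open>T\<close>.\<close>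

inductive exec :: "com \<Rightarrow> store \<Rightarrow> nat \<Rightarrow> store \<Rightarrow> bool" where
  Skip: "exec Skip s 1 s"
| Put: "exec (Put a e f) s
          (ev_cost e s + ev_cost f s + bits (ev e s) + bits (ev f s))
          (s(a := (s a)(ev e s := ev f s)))"
| Seq: "exec c s T s' \<Longrightarrow> exec d s' U s'' \<Longrightarrow> exec (Seq c d) s (T + U) s''"
| IteTrue: "ev e s \<noteq> 0 \<Longrightarrow> exec c s T s' \<Longrightarrow>
    exec (Ite e c d) s (ev_cost e s + bits (ev e s) + T) s'"
| IteFalse: "ev e s = 0 \<Longrightarrow> exec d s T s' \<Longrightarrow>
    exec (Ite e c d) s (ev_cost e s + bits (ev e s) + T) s'"
| WhileFalse: "ev e s = 0 \<Longrightarrow> exec (While e c) s (ev_cost e s + bits (ev e s)) s"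
| WhileTrue: "ev e s \<noteq> 0 \<Longrightarrow> exec c s T s' \<Longrightarrow> exec (While e c) s' U s'' \<Longrightarrow>
    exec (While e c) s (ev_cost e s + bits (ev e s) + T + U) s''"

inductive_cases exec_SkipE: "exec Skip s T s'"
inductive_cases exec_PutE: "exec (Put a e f) s T s'"
inductive_cases exec_SeqE: "exec (Seq c d) s T s'"
inductive_cases exec_IteE: "exec (Ite e c d) s T s'"
inductive_cases exec_WhileE: "exec (While e c) s T s'"

lemma exec_deterministic:
  "exec c s T s' \<Longrightarrow> exec c s U s'' \<Longrightarrow> U = T \<and> s'' = s'"
proof (induction arbitrary: U s'' rule: exec.induct)
  case (Skip s)
  from Skip show ?case by (rule exec_SkipE) simp
next
  case (Put a e f s)
  from Put show ?case by (rule exec_PutE) simp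
next
  case (Seq c s T s1 d U1 s2)
  from Seq.prems obtain T' U' r where
    "exec c s T' r" "exec d r U' s''" "U = T' + U'" by (rule exec_SeqE)
  with Seq.IH show ?case by metis
next
  case (IteTrue e s c T s' d)
  from IteTrue.prems obtain T' where
    "exec c s T' s''" "U = ev_cost e s + bits (ev e s) + T'"
    by (rule exec_IteE) (use IteTrue.hyps in simp_all)
  with IteTrue.IH show ?case by metis
next
  case (IteFalse e s d T s' c)
  from IteFalse.prems obtain T' where
    "exec d s T' s''" "U = ev_cost e s + bits (ev e s) + T'"
    by (rule exec_IteE) (use IteFalse.hyps in simp_all)
  with IteFalse.IH show ?case by metis
next
  case (WhileFalse e s c)
  from WhileFalse.prems show ?case
    by (rule exec_WhileE) (use WhileFalse.hyps in simp_all)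
next
  case (WhileTrue e s c T s1 U1 s2)
  from WhileTrue.prems obtain T' U' r where
    "exec c s T' r" "exec (While e c) r U' s''"
    "U = ev_cost e s + bits (ev e s) + T' + U'"
    by (rule exec_WhileE) (use WhileTrue.hyps in simp_all)
  with WhileTrue.IH show ?case by metis
qed

definition cells :: "nat list \<Rightarrow> nat \<Rightarrow> nat" where
  "cells xs i = (if i < length xs then xs ! i else 0)"

definition input_store :: "nat list \<Rightarrow> nat list \<Rightarrow> store" where
  "input_store zs ts =
     (\<lambda>a. cells [])(''n'' := cells [length zs], ''z'' := cells zs, ''t'' := cells ts)"

definition answer :: "store \<Rightarrow> nat" where
  "answer s = s ''out'' 0"

definition input_bits :: "nat list \<Rightarrow> nat" where
  "input_bits zs = sum_list (map bits zs)"

end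

theory Submission
  imports Defs
begin

text \<open>
  Let \<open>m\<close> be the number of inputs that are at most \<open>t\<close>. As in the subset sum algorithm of Koiliaris and
  Xu, these are split into residue classes modulo some \<open>b\<close>. The elements of the class of \<open>l\<close> have the form
  \<open>y b + l\<close>, so the sums of \<open>k\<close> disjoint parts of it are determined by the cardinalities of the parts and the
  sums of their \<open>y\<close>, which range over a box of size about \<open>(q t / b) ^ k\<close> for a class of \<open>q\<close> elements.
  The vectors reachable from a class are found by divide and conquer, those of the whole set by adding up
  the classes inside the box \<open>{0..t} ^ k\<close>. The costs \<open>(m t / b) ^ k\<close> and \<open>b t ^ k\<close> of the two stages balance
  for \<open>b ^ (k + 1) = m ^ k\<close>.

  Sets of vectors are added by writing their indicator functions into the digits of large integers.
  Multiplication has linear cost in this machine model, so one product of \<open>N\<close>-digit integers replaces the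
  fast Fourier transform; passing between arrays and packed integers by repeated halving costs only a
  logarithmic factor.
\<close>

section \<open>A cost calculus for programs\<close>

lemma bits_mono: "x \<le> y \<Longrightarrow> bits x \<le> bits y"
  unfolding bits_def by (intro max.mono floorlog_mono order_refl)

lemma bits_pos [simp]: "1 \<le> bits x" "0 < bits x" "Suc 0 \<le> bits x"
  by (simp_all add: bits_def less_max_iff_disj)

lemma less_two_power_bits: "x < 2 ^ bits x"
proof (cases "x = 0")
  case False
  then have "x < 2 ^ floorlog 2 x" using floorlog_bounds[of x 2] by simp
  also have "\<dots> \<le> 2 ^ bits x" by (simp add: bits_def)
  finally show ?thesis .
qed simp

lemma bits_le: "0 < c \<Longrightarrow> x < 2 ^ c \<Longrightarrow> bits x \<le> c"
  by (auto simp: bits_def floorlog_le_iff)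

lemma bits_less_power: "0 < m \<Longrightarrow> x < w ^ m \<Longrightarrow> bits x \<le> m * bits w"
proof (rule bits_le)
  assume "0 < m" "x < w ^ m"
  note \<open>x < w ^ m\<close>
  also have "w ^ m \<le> (2 ^ bits w) ^ m" by (intro power_mono less_imp_le[OF less_two_power_bits]) simp
  also have "\<dots> = 2 ^ (m * bits w)" by (metis power_mult mult.commute)
  finally show "x < 2 ^ (m * bits w)" .
qed simp

lemma bits_add: "bits (x + y) \<le> bits x + bits y"
proof (rule bits_le)
  have "x < 2 ^ bits x" "y < 2 ^ bits y" by (rule less_two_power_bits)+
  moreover have "a + b \<le> a * b + 1" if "1 \<le> a" "1 \<le> b" for a b :: nat
    using that by (cases a; cases b; simp)
  from this[of "2 ^ bits x" "2 ^ bits y"]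
  have "2 ^ bits x + 2 ^ bits y \<le> (2 ^ (bits x + bits y) + 1 :: nat)" by (simp add: power_add)
  ultimately show "x + y < 2 ^ (bits x + bits y)" by linarith
qed (simp add: add_pos_pos)

lemma bits_mult: "bits (x * y) \<le> bits x + bits y"
proof (rule bits_le)
  show "x * y < 2 ^ (bits x + bits y)"
    unfolding power_add by (rule mult_strict_mono) (use less_two_power_bits in auto)
qed (simp add: add_pos_pos)

lemma bits_power: "0 < m \<Longrightarrow> bits (w ^ m) \<le> m * bits w"
proof (induction m)
  case (Suc m)
  then show ?case using bits_mult[of w "w ^ m"] by (cases m) (auto)
qed simp

lemma bits_numeral [simp]: "bits 0 = 1" "bits 1 = 1" "bits (Suc 0) = 1" "bits 2 = 2"
  by (simp_all add: bits_def floorlog_def compute_floorlog)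

primrec wt :: "expr \<Rightarrow> nat" where
  "wt (Const c) = 1"
| "wt (Elem a e) = 1"
| "wt (Add e f) = wt e + wt f"
| "wt (Sub e f) = wt e"
| "wt (Mul e f) = wt e + wt f"
| "wt (Quot e f) = wt e"

primrec ecost :: "expr \<Rightarrow> nat" where
  "ecost (Const c) = 1"
| "ecost (Elem a e) = ecost e + wt e + 1"
| "ecost (Add e f) = ecost e + ecost f + wt e + wt f"
| "ecost (Sub e f) = ecost e + ecost f + wt e + wt f"
| "ecost (Mul e f) = ecost e + ecost f + wt e + wt f"
| "ecost (Quot e f) = ecost e + ecost f + wt e + wt f"

primrec okx :: "nat \<Rightarrow> expr \<Rightarrow> store \<Rightarrow> bool" where
  "okx \<beta> (Const c) s \<longleftrightarrow> bits c \<le> \<beta>"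
| "okx \<beta> (Elem a e) s \<longleftrightarrow> okx \<beta> e s \<and> bits (s a (ev e s)) \<le> \<beta>"
| "okx \<beta> (Add e f) s \<longleftrightarrow> okx \<beta> e s \<and> okx \<beta> f s"
| "okx \<beta> (Sub e f) s \<longleftrightarrow> okx \<beta> e s \<and> okx \<beta> f s"
| "okx \<beta> (Mul e f) s \<longleftrightarrow> okx \<beta> e s \<and> okx \<beta> f s"
| "okx \<beta> (Quot e f) s \<longleftrightarrow> okx \<beta> e s \<and> okx \<beta> f s"

lemma okx_bounds: "okx \<beta> e s \<Longrightarrow> bits (ev e s) \<le> wt e * \<beta> \<and> ev_cost e s \<le> ecost e * \<beta>"
proof (induction e)
  case (Add e f)
  then show ?case using bits_add[of "ev e s" "ev f s"] by (auto simp: algebra_simps)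
next
  case (Mul e f)
  then show ?case using bits_mult[of "ev e s" "ev f s"] by (auto simp: algebra_simps)
next
  case (Sub e f)
  then show ?case using bits_mono[of "ev e s - ev f s" "ev e s"] by (auto simp: algebra_simps)
next
  case (Quot e f)
  then show ?case using bits_mono[of "ev e s div ev f s" "ev e s"] by (auto simp: algebra_simps)
qed (auto simp: algebra_simps)

primrec writes :: "com \<Rightarrow> string set" where
  "writes Skip = {}"
| "writes (Put a e f) = {a}"
| "writes (Seq c d) = writes c \<union> writes d"
| "writes (Ite e c d) = writes c \<union> writes d"
| "writes (While e c) = writes c"

lemma exec_frame: "exec c s T s' \<Longrightarrow> a \<notin> writes c \<Longrightarrow> s' a = s a"
  by (induction rule: exec.induct) auto

primrec loop_free :: "com \<Rightarrow> bool" where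
  "loop_free Skip \<longleftrightarrow> True"
| "loop_free (Put a e f) \<longleftrightarrow> True"
| "loop_free (Seq c d) \<longleftrightarrow> loop_free c \<and> loop_free d"
| "loop_free (Ite e c d) \<longleftrightarrow> loop_free c \<and> loop_free d"
| "loop_free (While e c) \<longleftrightarrow> False"

primrec fin :: "com \<Rightarrow> store \<Rightarrow> store" where
  "fin Skip s = s"
| "fin (Put a e f) s = s(a := (s a)(ev e s := ev f s))"
| "fin (Seq c d) s = fin d (fin c s)"
| "fin (Ite e c d) s = (if ev e s \<noteq> 0 then fin c s else fin d s)"
| "fin (While e c) s = s"

primrec ccost :: "com \<Rightarrow> nat" where
  "ccost Skip = 1"
| "ccost (Put a e f) = ecost e + ecost f + wt e + wt f"
| "ccost (Seq c d) = ccost c + ccost d"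
| "ccost (Ite e c d) = ecost e + wt e + ccost c + ccost d"
| "ccost (While e c) = 0"

primrec okc :: "nat \<Rightarrow> com \<Rightarrow> store \<Rightarrow> bool" where
  "okc \<beta> Skip s \<longleftrightarrow> True"
| "okc \<beta> (Put a e f) s \<longleftrightarrow> okx \<beta> e s \<and> okx \<beta> f s"
| "okc \<beta> (Seq c d) s \<longleftrightarrow> okc \<beta> c s \<and> okc \<beta> d (fin c s)"
| "okc \<beta> (Ite e c d) s \<longleftrightarrow> okx \<beta> e s \<and> (if ev e s \<noteq> 0 then okc \<beta> c s else okc \<beta> d s)"
| "okc \<beta> (While e c) s \<longleftrightarrow> False"

definition runs :: "com \<Rightarrow> store \<Rightarrow> nat \<Rightarrow> (store \<Rightarrow> bool) \<Rightarrow> bool" where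
  "runs c s \<tau> Q \<longleftrightarrow> (\<exists>T s'. exec c s T s' \<and> T \<le> \<tau> \<and> Q s')"

lemma runs_loop_free_aux:
  "loop_free c \<Longrightarrow> okc \<beta> c s \<Longrightarrow> 1 \<le> \<beta> \<Longrightarrow> \<exists>T. exec c s T (fin c s) \<and> T \<le> ccost c * \<beta>"
proof (induction c arbitrary: s)
  case Skip
  then show ?case by (auto intro: exec.Skip)
next
  case (Put a e f)
  have "exec (Put a e f) s (ev_cost e s + ev_cost f s + bits (ev e s) + bits (ev f s)) (fin (Put a e f) s)"
    using exec.Put by simp
  moreover have "ev_cost e s + ev_cost f s + bits (ev e s) + bits (ev f s) \<le> ccost (Put a e f) * \<beta>"
    using Put okx_bounds[of \<beta> e s] okx_bounds[of \<beta> f s] by (simp add: algebra_simps)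
  ultimately show ?case by blast
next
  case (Seq c d)
  then obtain T U where "exec c s T (fin c s)" "T \<le> ccost c * \<beta>"
    "exec d (fin c s) U (fin d (fin c s))" "U \<le> ccost d * \<beta>" by fastforce
  then show ?case using exec.Seq by (fastforce simp: algebra_simps)
next
  case (Ite e c d)
  have b: "ev_cost e s + bits (ev e s) \<le> (ecost e + wt e) * \<beta>"
    using Ite okx_bounds[of \<beta> e s] by (simp add: algebra_simps)
  show ?case
  proof (cases "ev e s = 0")
    case True
    then obtain U where U: "exec d s U (fin d s)" "U \<le> ccost d * \<beta>" using Ite by auto
    show ?thesis using True b U exec.IteFalse[OF True U(1), of c]
      by (intro exI[of _ "ev_cost e s + bits (ev e s) + U"]) (auto simp: algebra_simps)
  next
    case False
    then obtain U where U: "exec c s U (fin c s)" "U \<le> ccost c * \<beta>" using Ite by auto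
    show ?thesis using False b U exec.IteTrue[OF False U(1), of d]
      by (intro exI[of _ "ev_cost e s + bits (ev e s) + U"]) (auto simp: algebra_simps)
  qed
qed simp

lemma runs_loop_free:
  "loop_free c \<Longrightarrow> okc \<beta> c s \<Longrightarrow> 1 \<le> \<beta> \<Longrightarrow> ccost c * \<beta> \<le> \<tau> \<Longrightarrow> Q (fin c s) \<Longrightarrow> runs c s \<tau> Q"
  unfolding runs_def using runs_loop_free_aux[of c \<beta> s] le_trans by blast

lemma runs_weaken: "runs c s \<tau> Q \<Longrightarrow> \<tau> \<le> \<tau>' \<Longrightarrow> (\<And>s'. Q s' \<Longrightarrow> Q' s') \<Longrightarrow> runs c s \<tau>' Q'"
  unfolding runs_def by (meson le_trans)

lemma runs_frame:
  "runs c s \<tau> Q \<Longrightarrow> runs c s \<tau> (\<lambda>s'. Q s' \<and> (\<forall>a. a \<notin> writes c \<longrightarrow> s' a = s a))"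
  unfolding runs_def by (meson exec_frame)

lemma runs_Seq:
  assumes "runs c s \<tau> R" "\<And>s'. R s' \<Longrightarrow> (\<And>a. a \<notin> writes c \<Longrightarrow> s' a = s a) \<Longrightarrow> runs d s' \<upsilon> Q"
    "\<tau> + \<upsilon> \<le> \<tau>'"
  shows "runs (Seq c d) s \<tau>' Q"
proof -
  obtain T s1 where 1: "exec c s T s1" "T \<le> \<tau>" "R s1" "\<And>a. a \<notin> writes c \<Longrightarrow> s1 a = s a"
    using runs_frame[OF assms(1)] unfolding runs_def by blast
  obtain U s2 where 2: "exec d s1 U s2" "U \<le> \<upsilon>" "Q s2"
    using assms(2)[OF 1(3,4)] unfolding runs_def by blast
  have "T + U \<le> \<tau>'" using 1 2 assms(3) by linarith
  then show ?thesis unfolding runs_def using exec.Seq[OF 1(1) 2(1)] 2(3) by blast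
qed

lemma runs_Ite:
  assumes "okx \<beta> e s" "ev e s \<noteq> 0 \<Longrightarrow> runs c s \<tau> Q" "ev e s = 0 \<Longrightarrow> runs d s \<tau> Q"
    "(ecost e + wt e) * \<beta> + \<tau> \<le> \<tau>'"
  shows "runs (Ite e c d) s \<tau>' Q"
proof -
  have b: "ev_cost e s + bits (ev e s) \<le> (ecost e + wt e) * \<beta>"
    using okx_bounds[OF assms(1)] by (simp add: algebra_simps)
  show ?thesis
  proof (cases "ev e s = 0")
    case True
    then obtain U s' where U: "exec d s U s'" "U \<le> \<tau>" "Q s'" using assms(3) by (auto simp: runs_def)
    moreover have "ev_cost e s + bits (ev e s) + U \<le> \<tau>'" using b U assms(4) by linarith
    ultimately show ?thesis using exec.IteFalse[OF True U(1), of c] unfolding runs_def by blast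
  next
    case False
    then obtain U s' where U: "exec c s U s'" "U \<le> \<tau>" "Q s'" using assms(2) by (auto simp: runs_def)
    moreover have "ev_cost e s + bits (ev e s) + U \<le> \<tau>'" using b U assms(4) by linarith
    ultimately show ?thesis using exec.IteTrue[OF False U(1), of d] unfolding runs_def by blast
  qed
qed

lemma runs_While:
  fixes I :: "nat \<Rightarrow> store \<Rightarrow> bool"
  assumes init: "I 0 s"
    and step: "\<And>j s'. j < n \<Longrightarrow> I j s' \<Longrightarrow> (\<And>a. a \<notin> writes c \<Longrightarrow> s' a = s a) \<Longrightarrow>
      ev e s' \<noteq> 0 \<and> okx \<beta> e s' \<and> runs c s' (\<tau> j) (I (Suc j))"
    and stop: "\<And>s'. I n s' \<Longrightarrow> (\<And>a. a \<notin> writes c \<Longrightarrow> s' a = s a) \<Longrightarrow> ev e s' = 0 \<and> okx \<beta> e s'"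
    and cost: "(\<Sum>j<n. \<tau> j + (ecost e + wt e) * \<beta>) + (ecost e + wt e) * \<beta> \<le> \<upsilon>"
  shows "runs (While e c) s \<upsilon> (I n)"
proof -
  let ?g = "(ecost e + wt e) * \<beta>"
  have g: "ev_cost e s' + bits (ev e s') \<le> ?g" if "okx \<beta> e s'" for s'
    using okx_bounds[OF that] by (simp add: algebra_simps)
  have "\<exists>T s''. exec (While e c) s' T s'' \<and> T \<le> (\<Sum>j\<in>{j..<n}. \<tau> j + ?g) + ?g \<and> I n s''"
    if "j \<le> n" "I j s'" "\<And>a. a \<notin> writes c \<Longrightarrow> s' a = s a" for j s'
    using that
  proof (induction j arbitrary: s' rule: inc_induct)
    case base
    then have "ev e s' = 0 \<and> okx \<beta> e s'" using stop by blast
    then show ?case using exec.WhileFalse[of e s' c] g base by fastforce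
  next
    case (step j)
    then have r: "ev e s' \<noteq> 0" "okx \<beta> e s'" "runs c s' (\<tau> j) (I (Suc j))" using assms(2) by blast+
    obtain T s1 where 1: "exec c s' T s1" "T \<le> \<tau> j" "I (Suc j) s1"
      "\<And>a. a \<notin> writes c \<Longrightarrow> s1 a = s' a"
      using runs_frame[OF r(3)] unfolding runs_def by blast
    have "\<And>a. a \<notin> writes c \<Longrightarrow> s1 a = s a" using 1(4) step.prems by metis
    then obtain U s2 where 2: "exec (While e c) s1 U s2"
      "U \<le> (\<Sum>j\<in>{Suc j..<n}. \<tau> j + ?g) + ?g" "I n s2"
      using step.IH[OF 1(3)] by blast
    have "(\<Sum>j\<in>{j..<n}. \<tau> j + ?g) = \<tau> j + ?g + (\<Sum>j\<in>{Suc j..<n}. \<tau> j + ?g)"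
      using step.hyps by (simp add: sum.atLeast_Suc_lessThan)
    then have "ev_cost e s' + bits (ev e s') + T + U \<le> (\<Sum>j\<in>{j..<n}. \<tau> j + ?g) + ?g"
      using g[OF r(2)] 1(2) 2(2) by linarith
    then show ?case using exec.WhileTrue[OF r(1) 1(1) 2(1)] 2(3) by blast
  qed
  from this[of 0 s] init have "\<exists>T s''. exec (While e c) s T s'' \<and> T \<le> (\<Sum>j<n. \<tau> j + ?g) + ?g \<and> I n s''"
    by (simp add: lessThan_atLeast0)
  then show ?thesis unfolding runs_def using cost le_trans by blast
qed

abbreviation V :: "string \<Rightarrow> expr" where
  "V x \<equiv> Elem x (Const 0)"

abbreviation Assign :: "string \<Rightarrow> expr \<Rightarrow> com" (infix "::=" 61) where
  "x ::= e \<equiv> Put x (Const 0) e"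

notation Seq (infixr ";;" 60)

abbreviation Mod :: "expr \<Rightarrow> expr \<Rightarrow> expr" where
  "Mod e f \<equiv> Sub e (Mul (Quot e f) f)"

text \<open>The arrays whose cells are not bounded by the global bound \<open>M\<close> on all other cells.\<close>

definition big :: "string set" where
  "big = {''n'', ''z'', ''P'', ''Q'', ''U'', ''W''}"

definition bounded :: "nat \<Rightarrow> store \<Rightarrow> bool" where
  "bounded M s \<longleftrightarrow> (\<forall>a i. a \<notin> big \<longrightarrow> s a i \<le> M)"

lemma boundedD: "bounded M s \<Longrightarrow> a \<notin> big \<Longrightarrow> s a i \<le> M"
  by (simp add: bounded_def)

lemma boundedD_bits: "bounded M s \<Longrightarrow> a \<notin> big \<Longrightarrow> bits (s a i) \<le> bits M"
  by (simp add: bounded_def bits_mono)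

primrec chk :: "nat \<Rightarrow> expr \<Rightarrow> store \<Rightarrow> bool" where
  "chk \<beta> (Const c) s \<longleftrightarrow> bits c \<le> \<beta>"
| "chk \<beta> (Elem a e) s \<longleftrightarrow> chk \<beta> e s \<and> (a \<in> big \<longrightarrow> bits (s a (ev e s)) \<le> \<beta>)"
| "chk \<beta> (Add e f) s \<longleftrightarrow> chk \<beta> e s \<and> chk \<beta> f s"
| "chk \<beta> (Sub e f) s \<longleftrightarrow> chk \<beta> e s \<and> chk \<beta> f s"
| "chk \<beta> (Mul e f) s \<longleftrightarrow> chk \<beta> e s \<and> chk \<beta> f s"
| "chk \<beta> (Quot e f) s \<longleftrightarrow> chk \<beta> e s \<and> chk \<beta> f s"

primrec chkc :: "nat \<Rightarrow> nat \<Rightarrow> com \<Rightarrow> store \<Rightarrow> bool" where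
  "chkc M \<beta> Skip s \<longleftrightarrow> True"
| "chkc M \<beta> (Put a e f) s \<longleftrightarrow> chk \<beta> e s \<and> chk \<beta> f s \<and> (a \<notin> big \<longrightarrow> ev f s \<le> M)"
| "chkc M \<beta> (Seq c d) s \<longleftrightarrow> chkc M \<beta> c s \<and> chkc M \<beta> d (fin c s)"
| "chkc M \<beta> (Ite e c d) s \<longleftrightarrow> chk \<beta> e s \<and> (ev e s \<noteq> 0 \<longrightarrow> chkc M \<beta> c s) \<and> (ev e s = 0 \<longrightarrow> chkc M \<beta> d s)"
| "chkc M \<beta> (While e c) s \<longleftrightarrow> False"

lemma chk_okx: "bounded M s \<Longrightarrow> chk \<beta> e s \<Longrightarrow> bits M \<le> \<beta> \<Longrightarrow> okx \<beta> e s"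
  by (induction e) (auto intro: order_trans[OF boundedD_bits])

lemma chkc_okc:
  "bounded M s \<Longrightarrow> chkc M \<beta> c s \<Longrightarrow> bits M \<le> \<beta> \<Longrightarrow> okc \<beta> c s \<and> bounded M (fin c s)"
proof (induction c arbitrary: s)
  case (Put a e f)
  then show ?case by (auto intro: chk_okx simp: bounded_def)
next
  case (Ite e c d)
  then show ?case by (auto intro: chk_okx)
qed auto

lemma runs_chk:
  assumes "bounded M s" "loop_free c" "chkc M \<beta> c s" "bits M \<le> \<beta>" "ccost c * \<beta> \<le> \<tau>"
    "bounded M (fin c s) \<Longrightarrow> Q (fin c s)"
  shows "runs c s \<tau> Q"
  using runs_loop_free[of c \<beta> s \<tau> Q] chkc_okc[OF assms(1,3,4)] assms bits_pos(1)[of M] le_trans by blast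

lemma runs_loop:
  fixes I :: "nat \<Rightarrow> store \<Rightarrow> bool"
  assumes init: "I 0 s"
    and bd: "\<And>j s'. I j s' \<Longrightarrow> bounded M s'" "bits M \<le> \<beta>"
    and step: "\<And>j s'. j < n \<Longrightarrow> I j s' \<Longrightarrow> (\<And>a. a \<notin> writes c \<Longrightarrow> s' a = s a) \<Longrightarrow>
      ev e s' \<noteq> 0 \<and> chk \<beta> e s' \<and> runs c s' (\<tau> j) (I (Suc j))"
    and stop: "\<And>s'. I n s' \<Longrightarrow> (\<And>a. a \<notin> writes c \<Longrightarrow> s' a = s a) \<Longrightarrow> ev e s' = 0 \<and> chk \<beta> e s'"
    and cost: "(\<Sum>j<n. \<tau> j + (ecost e + wt e) * \<beta>) + (ecost e + wt e) * \<beta> \<le> \<upsilon>"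
    and post: "\<And>s'. I n s' \<Longrightarrow> (\<And>a. a \<notin> writes c \<Longrightarrow> s' a = s a) \<Longrightarrow> Q s'"
  shows "runs (While e c) s \<upsilon> Q"
proof -
  have "runs (While e c) s \<upsilon> (I n)"
    by (rule runs_While[where I = I and \<beta> = \<beta> and \<tau> = \<tau>, OF init _ _ cost])
      (use step stop chk_okx[OF bd(1) _ bd(2)] in blast)+
  from runs_weaken[OF runs_frame[OF this] order_refl, of Q] post show ?thesis by auto
qed

section \<open>Recoding mixed-radix numbers\<close>

lemma mod_div_minus: "(x::nat) - x div y * y = x mod y"
  by (simp add: minus_div_mult_eq_mod)

definition dig1 :: "nat \<Rightarrow> nat \<Rightarrow> nat \<Rightarrow> nat \<Rightarrow> nat" where
  "dig1 x1 x2 u i = u div (x1 * x2) ^ i mod x1"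

definition dig2 :: "nat \<Rightarrow> nat \<Rightarrow> nat \<Rightarrow> nat \<Rightarrow> nat" where
  "dig2 x1 x2 u i = u div (x1 * x2) ^ i div x1 mod x2"

definition rval :: "nat \<Rightarrow> nat \<Rightarrow> nat \<Rightarrow> nat \<Rightarrow> nat \<Rightarrow> nat \<Rightarrow> nat \<Rightarrow> nat" where
  "rval k x1 x2 y1 y2 y3 u = (\<Sum>i<k. y3 ^ i * (y1 * dig1 x1 x2 u i + y2 * dig2 x1 x2 u i))"

definition rok :: "nat \<Rightarrow> nat \<Rightarrow> nat \<Rightarrow> nat \<Rightarrow> nat \<Rightarrow> nat \<Rightarrow> nat \<Rightarrow> bool" where
  "rok k x1 x2 u1 u2 lm u \<longleftrightarrow> (\<forall>i<k. u1 * dig1 x1 x2 u i + u2 * dig2 x1 x2 u i \<le> lm)"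

text \<open>
  \<open>recode\<close> reads the number in \<open>u\<close> as \<open>k\<close> pairs \<open>(d, f)\<close> of digits in the alternating radices \<open>x1\<close>, \<open>x2\<close>.
  A pair is admissible iff \<open>u1 d + u2 f\<close> is at most \<open>lim\<close>; it contributes \<open>y1 d + y2 f\<close> to the
  digit of the result \<open>r\<close> in radix \<open>y3\<close>.
\<close>

definition recode_body :: com where
  "recode_body =
    ''d'' ::= Mod (V ''u'') (V ''x1'') ;; ''u'' ::= Quot (V ''u'') (V ''x1'') ;;
    ''f'' ::= Mod (V ''u'') (V ''x2'') ;; ''u'' ::= Quot (V ''u'') (V ''x2'') ;;
    Ite (Sub (Add (Mul (V ''u1'') (V ''d'')) (Mul (V ''u2'') (V ''f''))) (V ''lim''))
      (''ok'' ::= Const 0) Skip ;;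
    ''r'' ::= Add (V ''r'') (Mul (V ''w'') (Add (Mul (V ''y1'') (V ''d'')) (Mul (V ''y2'') (V ''f'')))) ;;
    ''w'' ::= Mul (V ''w'') (V ''y3'') ;;
    ''c'' ::= Sub (V ''c'') (Const 1)"

definition recode :: "nat \<Rightarrow> com" where
  "recode k =
    (''r'' ::= Const 0 ;; ''w'' ::= Const 1 ;; ''ok'' ::= Const 1 ;; ''c'' ::= Const k) ;;
    While (V ''c'') recode_body"

lemma writes_recode [simp]: "writes (recode k) = {''r'', ''w'', ''ok'', ''c'', ''d'', ''u'', ''f''}"
  by (auto simp: recode_def recode_body_def)

lemma runs_recode:
  assumes bd: "bounded M s" and k: "k \<le> M" "1 \<le> M"
    and y3: "s ''y3'' 0 \<ge> 1" "s ''y3'' 0 ^ k \<le> M"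
    and rv: "rval k (s ''x1'' 0) (s ''x2'' 0) (s ''y1'' 0) (s ''y2'' 0) (s ''y3'' 0) (s ''u'' 0) \<le> M"
    and tau: "300 * (k + 1) * bits M \<le> \<tau>"
  shows "runs (recode k) s \<tau> (\<lambda>s'. bounded M s' \<and>
      s' ''r'' 0 = rval k (s ''x1'' 0) (s ''x2'' 0) (s ''y1'' 0) (s ''y2'' 0) (s ''y3'' 0) (s ''u'' 0) \<and>
      s' ''ok'' 0 = of_bool (rok k (s ''x1'' 0) (s ''x2'' 0) (s ''u1'' 0) (s ''u2'' 0) (s ''lim'' 0) (s
          ''u'' 0)))"
proof -
  define x1 x2 y1 y2 y3 u1 u2 lm u where defs: "x1 = s ''x1'' 0" "x2 = s ''x2'' 0"
    "y1 = s ''y1'' 0" "y2 = s ''y2'' 0" "y3 = s ''y3'' 0"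
    "u1 = s ''u1'' 0" "u2 = s ''u2'' 0" "lm = s ''lim'' 0" "u = s ''u'' 0"
  have uM: "u \<le> M" using bd by (simp add: defs boundedD big_def)
  define I where "I j s' \<longleftrightarrow> bounded M s' \<and> s' ''u'' 0 = u div (x1 * x2) ^ j \<and> s' ''w'' 0 = y3 ^ j \<and>
    s' ''c'' 0 = k - j \<and> s' ''r'' 0 = rval j x1 x2 y1 y2 y3 u \<and>
    s' ''ok'' 0 = of_bool (rok j x1 x2 u1 u2 lm u)" for j s'
  have mono: "rval j x1 x2 y1 y2 y3 u \<le> rval k x1 x2 y1 y2 y3 u" "y3 ^ j \<le> y3 ^ k" if "j \<le> k" for j
    using that y3 by (auto simp: rval_def defs intro: sum_mono2 power_increasing)
  have body: "runs recode_body s' (200 * bits M) (I (Suc j))"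
    if "j < k" "I j s'" and fr: "\<And>a. a \<notin> writes recode_body \<Longrightarrow> s' a = s a" for j s'
  proof (rule runs_chk)
    have fr': "s' ''x1'' 0 = x1" "s' ''x2'' 0 = x2" "s' ''y1'' 0 = y1" "s' ''y2'' 0 = y2"
      "s' ''y3'' 0 = y3" "s' ''u1'' 0 = u1" "s' ''u2'' 0 = u2" "s' ''lim'' 0 = lm"
      using fr by (simp_all add: recode_body_def defs)
    have st: "bounded M s'" "s' ''u'' 0 = u div (x1 * x2) ^ j" "s' ''w'' 0 = y3 ^ j"
      "s' ''c'' 0 = k - j" "s' ''r'' 0 = rval j x1 x2 y1 y2 y3 u"
      "s' ''ok'' 0 = of_bool (rok j x1 x2 u1 u2 lm u)"
      using that by (simp_all add: I_def)
    have q: "q \<le> M" if "q \<le> u div (x1 * x2) ^ j" for q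
      using that uM by (meson div_le_dividend le_trans)
    have q1: "u div (x1 * x2) ^ j mod x1 \<le> M" by (intro q) simp
    have q2: "u div (x1 * x2) ^ j div x1 \<le> M" by (intro q) simp
    have q3: "u div (x1 * x2) ^ j div x1 mod x2 \<le> M" by (rule le_trans[OF _ q2]) simp
    have q4: "u div (x1 * x2) ^ j div x1 div x2 \<le> M" by (rule le_trans[OF _ q2]) simp
    have d: "u div (x1 * x2) ^ j mod x1 = dig1 x1 x2 u j"
      "u div (x1 * x2) ^ j div x1 mod x2 = dig2 x1 x2 u j" by (simp_all add: dig1_def dig2_def)
    have r: "rval j x1 x2 y1 y2 y3 u + y3 ^ j * (y1 * dig1 x1 x2 u j + y2 * dig2 x1 x2 u j)
        = rval (Suc j) x1 x2 y1 y2 y3 u" by (simp add: rval_def)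
    have r': "rval (Suc j) x1 x2 y1 y2 y3 u \<le> M" "y3 ^ Suc j \<le> M"
      using mono[of "Suc j"] \<open>j < k\<close> rv y3 by (auto simp: defs)
    have w: "y3 ^ j * y3 = y3 ^ Suc j" by simp
    have e: "u div (x1 * x2) ^ j div x1 div x2 = u div (x1 * x2) ^ Suc j"
      by (metis div_mult2_eq mult.commute power_Suc)
    show "bounded M s'" "loop_free recode_body" "bits M \<le> bits M"
        "ccost recode_body * bits M \<le> 200 * bits M"
      using st by (simp_all add: recode_body_def)
    have e': "u div (x1 * x2) ^ j div x1 - u div (x1 * x2) ^ Suc j * x2 = dig2 x1 x2 u j"
      unfolding e[symmetric] mod_div_minus dig2_def ..
    have okS: "rok (Suc j) x1 x2 u1 u2 lm u \<longleftrightarrow> rok j x1 x2 u1 u2 lm u \<and>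
        u1 * dig1 x1 x2 u j + u2 * dig2 x1 x2 u j \<le> lm" by (auto simp: rok_def less_Suc_eq)
    have ks: "k - Suc j \<le> M" "k - j - Suc 0 \<le> M" using k by simp_all
    show "chkc M (bits M) recode_body s'"
      unfolding recode_body_def using k
      by (simp add: big_def fr' st mod_div_minus d q1[unfolded d] q2 q3[unfolded d] q4 r r' w ks del:
          power_Suc)
    assume "bounded M (fin recode_body s')"
    then show "I (Suc j) (fin recode_body s')"
      unfolding I_def
      by (simp add: recode_body_def fr' st mod_div_minus d r w e e' okS del: power_Suc)
  qed
  show ?thesis
    unfolding recode_def
  proof (rule runs_Seq)
    show "runs (''r'' ::= Const 0 ;; ''w'' ::= Const 1 ;; ''ok'' ::= Const 1 ;; ''c'' ::= Const k) s
        (20 * bits M) (I 0)"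
      by (rule runs_chk[where \<beta> = "bits M", OF bd])
          (use k in \<open>auto simp: big_def bits_mono I_def defs rval_def rok_def\<close>)
  next
    fix s1 assume I0: "I 0 s1"
      and fr: "\<And>a. a \<notin> writes (''r'' ::= Const 0 ;; ''w'' ::= Const 1 ;; ''ok'' ::= Const 1
          ;; ''c'' ::= Const k)
        \<Longrightarrow> s1 a = s a"
    show "runs (While (V ''c'') recode_body) s1 (250 * (k + 1) * bits M) (\<lambda>s'. bounded M s' \<and>
      s' ''r'' 0 = rval k (s ''x1'' 0) (s ''x2'' 0) (s ''y1'' 0) (s ''y2'' 0) (s ''y3'' 0) (s ''u'' 0) \<and>
      s' ''ok'' 0 = of_bool (rok k (s ''x1'' 0) (s ''x2'' 0) (s ''u1'' 0) (s ''u2'' 0) (s ''lim'' 0) (s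
          ''u'' 0)))"
    proof (rule runs_loop[where I = I and n = k and M = M and \<beta> = "bits M" and \<tau> = "\<lambda>_. 200 * bits M"])
      show "I 0 s1" by (rule I0)
    next
      fix j s' assume j: "j < k" "I j s'" and fr': "\<And>a. a \<notin> writes recode_body \<Longrightarrow> s' a = s1 a"
      have "runs recode_body s' (200 * bits M) (I (Suc j))"
        by (rule body[OF j]) (simp add: fr fr' recode_body_def)
      then show "ev (V ''c'') s' \<noteq> 0 \<and> chk (bits M) (V ''c'') s'
          \<and> runs recode_body s' (200 * bits M) (I (Suc j))"
        using j by (auto simp: I_def big_def)
    qed (auto simp: I_def defs big_def algebra_simps)
  next
    show "20 * bits M + 250 * (k + 1) * bits M \<le> \<tau>" using tau by (simp add: algebra_simps)
  qed
qed

section \<open>Packing arrays into large integers\<close>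

definition packv :: "(nat \<Rightarrow> nat) \<Rightarrow> nat \<Rightarrow> nat \<Rightarrow> nat \<Rightarrow> nat" where
  "packv f w m i = (\<Sum>j<m. f (i * m + j) * w ^ j)"

lemma packv_1 [simp]: "packv f w (Suc 0) i = f i"
  by (simp add: packv_def)

lemma packv_double: "packv f w (2 * m) i = packv f w m (2 * i) + packv f w m (Suc (2 * i)) * w ^ m"
proof -
  have "packv f w (2 * m) i = (\<Sum>j<m + m. f (i * (2 * m) + j) * w ^ j)" by (simp add: packv_def mult_2)
  also have "\<dots> = (\<Sum>j<m. f (i * (2 * m) + j) * w ^ j) + (\<Sum>j<m. f (i * (2 * m) + (m + j)) * w ^ (m + j))"
    using sum.nat_group[of "\<lambda>j. f (i * (2 * m) + j) * w ^ j" m 2]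
    by (simp add: numeral_2_eq_2 lessThan_atLeast0 sum.shift_bounds_nat_ivl[of _ 0 m m, simplified]
        add.commute)
  also have "\<dots> = packv f w m (2 * i) + packv f w m (Suc (2 * i)) * w ^ m"
    by (simp add: packv_def sum_distrib_left power_add algebra_simps)
  finally show ?thesis .
qed

lemma packv_less: "(\<And>j. f j < w) \<Longrightarrow> packv f w m i < w ^ m"
proof -
  assume f: "\<And>j. f j < w"
  have "(\<Sum>j<m. f (i * p + j) * w ^ j) < w ^ m" for p
  proof (induction m)
    case (Suc m)
    have "f (i * p + m) * w ^ m + w ^ m \<le> w * w ^ m"
      using mult_le_mono1[of "Suc (f (i * p + m))" w "w ^ m"] f[of "i * p + m"] by simp
    then show ?case using Suc by simp
  qed simp
  then show ?thesis by (simp add: packv_def)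
qed

definition conv :: "(nat \<Rightarrow> nat) \<Rightarrow> (nat \<Rightarrow> nat) \<Rightarrow> nat \<Rightarrow> nat" where
  "conv f g x = (\<Sum>a\<le>x. f a * g (x - a))"

lemma packv_mult:
  assumes "\<And>a b. f a \<noteq> 0 \<Longrightarrow> g b \<noteq> 0 \<Longrightarrow> a + b < N"
  shows "packv f w N 0 * packv g w N 0 = packv (conv f g) w N 0"
proof -
  have "packv f w N 0 * packv g w N 0 = (\<Sum>(a, b)\<in>{..<N} \<times> {..<N}. (f a * w ^ a) * (g b * w ^ b))"
    by (simp add: packv_def sum_product sum.cartesian_product)
  also have "\<dots> = (\<Sum>(a, b)\<in>{(a, b). a + b < N}. (f a * w ^ a) * (g b * w ^ b))"
    by (rule sum.mono_neutral_right) (use assms in fastforce)+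
  also have "\<dots> = (\<Sum>x<N. \<Sum>a\<le>x. (f a * w ^ a) * (g (x - a) * w ^ (x - a)))"
    by (rule sum.triangle_reindex)
  also have "\<dots> = (\<Sum>x<N. conv f g x * w ^ x)"
  proof (intro sum.cong refl)
    fix x
    have "(f a * w ^ a) * (g (x - a) * w ^ (x - a)) = f a * g (x - a) * w ^ x" if "a \<le> x" for a
      using power_add[of w a "x - a"] that by simp
    then show "(\<Sum>a\<le>x. (f a * w ^ a) * (g (x - a) * w ^ (x - a))) = conv f g x * w ^ x"
      unfolding conv_def sum_distrib_right by (intro sum.cong refl) simp
  qed
  finally show ?thesis by (simp add: packv_def)
qed

lemma cost_Sub_V: "ecost (Sub (V a) (V b)) + wt (Sub (V a) (V b)) = 9"
  by simp

definition pows :: com where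
  "pows = (''g'' ::= Const 0 ;; Put ''W'' (Const 0) (Mul (Const 2) (V ''N''))) ;;
    While (Sub (V ''h'') (V ''g''))
      (Put ''W'' (Add (V ''g'') (Const 1)) (Mul (Elem ''W'' (V ''g'')) (Elem ''W'' (V ''g''))) ;;
       ''g'' ::= Add (V ''g'') (Const 1))"

lemma writes_pows [simp]: "writes pows = {''g'', ''W''}"
  by (auto simp: pows_def)

lemma less_bits_if_power_le: "2 * 2 ^ i \<le> M \<Longrightarrow> i < bits M"
  using less_two_power_bits[of M] le_less_trans[of "2 ^ Suc i" M "2 ^ bits M"]
  by (simp del: power_Suc add: power_Suc[symmetric])

lemma runs_pows:
  assumes bd: "bounded M s" and N: "s ''N'' 0 = 2 ^ h" "s ''h'' 0 = h" "2 * 2 ^ h \<le> M"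
    and tau: "100 * 2 ^ h * bits M * bits M \<le> \<tau>"
  shows "runs pows s \<tau> (\<lambda>s'. bounded M s' \<and> (\<forall>i\<le>h. s' ''W'' i = (2 * 2 ^ h) ^ (2 ^ i)))"
proof -
  have M: "2 \<le> M" using N(3) one_le_power[of "2 :: nat" h] by linarith
  then have bM: "2 \<le> bits M" using bits_mono[OF M] by simp
  have hM: "h < bits M" using N by (simp add: less_bits_if_power_le)
  have hM': "h < M" using N(3) less_exp[of h] by linarith
  let ?I = "\<lambda>j s'. bounded M s' \<and> s' ''g'' 0 = j \<and> (\<forall>i\<le>j. s' ''W'' i = (2 * 2 ^ h) ^ (2 ^ i))"
  show ?thesis
    unfolding pows_def
  proof (rule runs_Seq)
    show "runs (''g'' ::= Const 0 ;; Put ''W'' (Const 0) (Mul (Const 2) (V ''N''))) s (20 * bits M) (?I 0)"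
      by (rule runs_chk[where \<beta> = "bits M", OF bd]) (use N bM in \<open>auto simp: big_def bits_mono\<close>)
    fix s1 assume I0: "?I 0 s1" and
      fr: "\<And>a. a \<notin> writes (''g'' ::= Const 0 ;; Put ''W'' (Const 0) (Mul (Const 2) (V ''N''))) \<Longrightarrow> s1 a = s a"
    show "runs (While (Sub (V ''h'') (V ''g''))
        (Put ''W'' (Add (V ''g'') (Const 1)) (Mul (Elem ''W'' (V ''g'')) (Elem ''W'' (V ''g''))) ;;
         ''g'' ::= Add (V ''g'') (Const 1))) s1 (50 * (h + 1) * 2 ^ h * bits M)
         (\<lambda>s'. bounded M s' \<and> (\<forall>i\<le>h. s' ''W'' i = (2 * 2 ^ h) ^ (2 ^ i)))"
    proof (rule runs_loop[where I = ?I and n = h and M = M and \<beta> = "2 ^ h * bits M"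
        and \<tau> = "\<lambda>_. 35 * 2 ^ h * bits M"])
      show "?I 0 s1" by (rule I0)
      fix j s' assume j: "j < h" and I: "?I j s'"
          and fr':  "\<And>a. a \<notin> writes (Put ''W'' (Add (V ''g'') (Const 1)) (Mul (Elem ''W'' (V ''g'')) (Elem
          ''W'' (V ''g''))) ;;
         ''g'' ::= Add (V ''g'') (Const 1)) \<Longrightarrow> s' a = s1 a"
      have h: "s' ''h'' 0 = h" using fr fr' N by simp
      have "bits ((2 * 2 ^ h) ^ (2 ^ j)) \<le> 2 ^ j * bits (2 * 2 ^ h)" by (rule bits_power) simp
      also have "\<dots> \<le> 2 ^ h * bits M" using j N by (intro mult_mono bits_mono power_increasing) auto
      finally have W: "bits (s' ''W'' j) \<le> 2 ^ h * bits M" using I by simp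
      have sq: "(2 * 2 ^ h) ^ 2 ^ j * (2 * 2 ^ h) ^ 2 ^ j = ((2 * 2 ^ h) ^ 2 ^ Suc j :: nat)"
        unfolding power_add[symmetric] by (simp only: power_Suc mult_2)
      have "runs (Put ''W'' (Add (V ''g'') (Const 1)) (Mul (Elem ''W'' (V ''g'')) (Elem ''W'' (V ''g''))) ;;
         ''g'' ::= Add (V ''g'') (Const 1)) s' (35 * 2 ^ h * bits M) (?I (Suc j))"
        by (rule runs_chk[where M = M and \<beta> = "2 ^ h * bits M"])
          (use I j hM' W sq in \<open>auto simp: big_def le_Suc_eq simp del: power_Suc\<close>)
      then show "ev (Sub (V ''h'') (V ''g'')) s' \<noteq> 0 \<and> chk (2 ^ h * bits M) (Sub (V ''h'') (V ''g'')) s' \<and>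
        runs (Put ''W'' (Add (V ''g'') (Const 1)) (Mul (Elem ''W'' (V ''g'')) (Elem ''W'' (V ''g''))) ;;
         ''g'' ::= Add (V ''g'') (Const 1)) s' (35 * 2 ^ h * bits M) (?I (Suc j))"
        using I j h by (auto simp: big_def)
    qed (use fr N in \<open>auto simp: big_def algebra_simps\<close>)
  next
    have "20 * bits M + 50 * (h + 1) * 2 ^ h * bits M \<le> 20 * (2 ^ h * bits M * bits M)
        + 50 * bits M * 2 ^ h * bits M"
      using hM by (intro add_mono mult_mono) auto
    then show "20 * bits M + 50 * (h + 1) * 2 ^ h * bits M \<le> \<tau>"
      using tau by (simp add: algebra_simps)
  qed
qed

definition pack_step :: "string \<Rightarrow> com" where
  "pack_step P = Put P (V ''j'') (Add (Elem P (Mul (Const 2) (V ''j'')))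
     (Mul (Elem P (Add (Mul (Const 2) (V ''j'')) (Const 1))) (Elem ''W'' (V ''g'')))) ;;
   ''j'' ::= Add (V ''j'') (Const 1)"

definition pack :: "string \<Rightarrow> com" where
  "pack P = (''g'' ::= Const 0 ;; ''e'' ::= V ''N'') ;;
    While (Sub (V ''h'') (V ''g''))
      ((''e'' ::= Quot (V ''e'') (Const 2) ;; ''j'' ::= Const 0) ;;
       While (Sub (V ''e'') (V ''j'')) (pack_step P) ;;
       ''g'' ::= Add (V ''g'') (Const 1))"

lemma writes_pack [simp]: "writes (pack P) = {P, ''g'', ''e'', ''j''}"
  by (auto simp: pack_def pack_step_def)

lemma bits_packv:
  assumes "\<And>j. f j < w" "w \<le> M" "0 < m" "m \<le> n"
  shows "bits (packv f w m i) \<le> n * bits M"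
proof -
  have "bits (packv f w m i) \<le> m * bits w"
    by (rule bits_less_power[OF assms(3) packv_less]) (rule assms)
  also have "\<dots> \<le> n * bits M" using assms by (intro mult_mono bits_mono) auto
  finally show ?thesis .
qed

lemma runs_pack_level:
  assumes P: "P \<in> {''P'', ''Q''}" and bd: "bounded M s"
    and N: "s ''e'' 0 = 2 ^ e" "s ''j'' 0 = 0" "s ''W'' (s ''g'' 0) = w ^ (2 ^ l)" "2 * 2 ^ e \<le> M" "w \<le> M"
    and f: "\<And>j. f j < w" and cells: "\<And>x. x < 2 * 2 ^ e \<Longrightarrow> s P x = packv f w (2 ^ l) x"
    and tau: "200 * 2 ^ (e + l) * bits M \<le> \<tau>"
  shows "runs (While (Sub (V ''e'') (V ''j'')) (pack_step P)) s \<tau>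
    (\<lambda>s'. bounded M s' \<and> (\<forall>x<2 ^ e. s' P x = packv f w (2 ^ Suc l) x))"
proof -
  let ?b = "2 ^ Suc l * bits M"
  have P': "P \<in> big" "P \<noteq> ''j''" "P \<noteq> ''e''" "P \<noteq> ''g''" "P \<noteq> ''W''" "''W'' \<noteq> P" "''g'' \<noteq> P" "''e'' \<noteq> P"
      "''j'' \<noteq> P"
    using P by (auto simp: big_def)
  have M: "2 \<le> M" using N(4) one_le_power[of "2 :: nat" e] by linarith
  then have bM: "2 \<le> bits M" using bits_mono[OF M] by simp
  have bM': "bits M \<le> ?b" "2 \<le> ?b" using bM
      by (simp, simp add: mult_le_mono[of 1 _ 2 _, simplified] trans_le_add1)
  let ?I = "\<lambda>i s'. bounded M s' \<and> s' ''j'' 0 = i \<and> (\<forall>x<i. s' P x = packv f w (2 ^ Suc l) x) \<and>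
    (\<forall>x. i \<le> x \<and> x < 2 * 2 ^ e \<longrightarrow> s' P x = packv f w (2 ^ l) x)"
  show ?thesis
  proof (rule runs_loop[where I = ?I and n = "2 ^ e" and M = M and \<beta> = ?b and \<tau> = "\<lambda>_. 50 * ?b"])
    show "?I 0 s" using bd N cells by simp
    fix i s' assume i: "i < 2 ^ e" and I: "?I i s'" and fr: "\<And>a. a \<notin> writes (pack_step P) \<Longrightarrow> s' a = s a"
    have v: "s' ''e'' 0 = 2 ^ e" "s' ''W'' (s' ''g'' 0) = w ^ (2 ^ l)"
      using fr N P' by (simp_all add: pack_step_def)
    have r: "s' P (2 * i) = packv f w (2 ^ l) (2 * i)"
        "s' P (Suc (2 * i)) = packv f w (2 ^ l) (Suc (2 * i))"
      using I i by auto
    have b: "bits (s' P (2 * i)) \<le> ?b" "bits (s' P (Suc (2 * i))) \<le> ?b"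
      unfolding r by (rule bits_packv[OF f]; use N in simp)+
    have "0 < w" using f[of 0] by simp
    have "bits (w ^ (2 ^ l)) \<le> 2 ^ l * bits w" by (rule bits_power) simp
    also have "\<dots> \<le> ?b" using N by (intro mult_mono bits_mono) auto
    finally have bW: "bits (s' ''W'' (s' ''g'' 0)) \<le> ?b" using v by simp
    have new: "packv f w (2 ^ l) (2 * i) + packv f w (2 ^ l) (Suc (2 * i)) * w ^ 2 ^ l
        = packv f w (2 ^ Suc l) i"
      by (simp add: packv_double)
    have "Suc i \<le> M" using i N by linarith
    have "runs (pack_step P) s' (50 * ?b) (?I (Suc i))"
      by (rule runs_chk[where M = M and \<beta> = ?b])
        (use I i b bW r v new P' \<open>Suc i \<le> M\<close> bM' in \<open>auto simp: pack_step_def big_def less_Suc_eq simp del: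
            power_Suc\<close>)
    then show "ev (Sub (V ''e'') (V ''j'')) s' \<noteq> 0 \<and> chk ?b (Sub (V ''e'') (V ''j'')) s' \<and>
      runs (pack_step P) s' (50 * ?b) (?I (Suc i))"
      using I i v by (auto simp: big_def)
  next
    have "(\<Sum>j<(2::nat) ^ e. 50 * ?b + 9 * ?b) + 9 * ?b \<le> 59 * (2 ^ e * ?b) + 9 * (2 ^ e * ?b)"
      by simp
    also have "\<dots> = 136 * 2 ^ (e + l) * bits M" by (simp add: power_add)
    also have "\<dots> \<le> \<tau>" by (rule le_trans[OF _ tau]) simp
    finally show "(\<Sum>j<(2::nat) ^ e. 50 * ?b + (ecost (Sub (V ''e'') (V ''j''))
        + wt (Sub (V ''e'') (V ''j''))) * ?b) +
      (ecost (Sub (V ''e'') (V ''j'')) + wt (Sub (V ''e'') (V ''j''))) * ?b \<le> \<tau>"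
      unfolding cost_Sub_V .
  qed (use N P' bM' in \<open>auto simp: pack_step_def big_def simp del: power_Suc\<close>)
qed

lemma runs_pack:
  assumes P: "P \<in> {''P'', ''Q''}" and bd: "bounded M s"
    and N: "s ''N'' 0 = 2 ^ h" "s ''h'' 0 = h" "2 * 2 ^ h \<le> M" "w \<le> M"
    and W: "\<And>i. i \<le> h \<Longrightarrow> s ''W'' i = w ^ (2 ^ i)"
    and f: "\<And>j. f j < w" and cells: "\<And>x. x < 2 ^ h \<Longrightarrow> s P x = f x"
    and tau: "500 * 2 ^ h * bits M * bits M \<le> \<tau>"
  shows "runs (pack P) s \<tau> (\<lambda>s'. bounded M s' \<and> s' P 0 = packv f w (2 ^ h) 0)"
proof -
  have P': "P \<in> big" "P \<noteq> ''j''" "P \<noteq> ''e''" "P \<noteq> ''g''" "P \<noteq> ''W''" "''W'' \<noteq> P" "''g'' \<noteq> P" "''e'' \<noteq> P"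
    "''j'' \<noteq> P" "''h'' \<noteq> P" "''N'' \<noteq> P"
    using P by (auto simp: big_def)
  have M: "2 \<le> M" using N(3) one_le_power[of "2 :: nat" h] by linarith
  then have bM: "2 \<le> bits M" using bits_mono[OF M] by simp
  have hM: "h < bits M" using N by (simp add: less_bits_if_power_le)
  have hM': "h < M" using N(3) less_exp[of h] by linarith
  let ?I = "\<lambda>j s'. bounded M s' \<and> s' ''g'' 0 = j \<and> s' ''e'' 0 = 2 ^ (h - j) \<and>
    (\<forall>x<2 ^ (h - j). s' P x = packv f w (2 ^ j) x)"
  let ?c = "(''e'' ::= Quot (V ''e'') (Const 2) ;; ''j'' ::= Const 0) ;;
       While (Sub (V ''e'') (V ''j'')) (pack_step P) ;;
       ''g'' ::= Add (V ''g'') (Const 1)"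
  have NM: "2 ^ h \<le> M" using N by simp
  show ?thesis
    unfolding pack_def
  proof (rule runs_Seq)
    show "runs (''g'' ::= Const 0 ;; ''e'' ::= V ''N'') s (20 * bits M) (?I 0)"
      by (rule runs_chk[where \<beta> = "bits M", OF bd]) (use N cells bM NM P' in \<open>auto simp: big_def\<close>)
    fix s1 assume I0: "?I 0 s1" and
      fr: "\<And>a. a \<notin> writes (''g'' ::= Const 0 ;; ''e'' ::= V ''N'') \<Longrightarrow> s1 a = s a"
    show "runs (While (Sub (V ''h'') (V ''g'')) ?c) s1 (260 * (h + 1) * 2 ^ h * bits M)
       (\<lambda>s'. bounded M s' \<and> s' P 0 = packv f w (2 ^ h) 0)"
    proof (rule runs_loop[where I = ?I and n = h and M = M and \<beta> = "bits M"
        and \<tau> = "\<lambda>_. 250 * 2 ^ h * bits M"])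
      show "?I 0 s1" by (rule I0)
      fix j s' assume j: "j < h" and I: "?I j s'" and fr':  "\<And>a. a \<notin> writes ?c \<Longrightarrow> s' a = s1 a"
      have v: "s' ''h'' 0 = h" "s' ''W'' = s ''W''" using fr fr' N P' by (simp_all add: pack_step_def)
      define e where "e = h - Suc j"
      have e: "h - j = Suc e" "e + j \<le> h" using j by (simp_all add: e_def)
      have e2: "(2::nat) ^ (e + j) \<le> 2 ^ h"
          "(2::nat) ^ Suc e \<le> 2 ^ h" using e j by (intro power_increasing; simp)+
      have "runs ?c s' (250 * 2 ^ h * bits M) (?I (Suc j))"
      proof (rule runs_Seq)
        let ?R = "\<lambda>s'. bounded M s' \<and> s' ''e'' 0 = 2 ^ e \<and> s' ''j'' 0 = 0"
        show "runs (''e'' ::= Quot (V ''e'') (Const 2) ;; ''j'' ::= Const 0) s' (20 * bits M) ?R"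
          by (rule runs_chk[where M = M and \<beta> = "bits M"]) (use I e e2 N bM in \<open>auto simp: big_def\<close>)
        fix s2 assume R: "?R s2" and
          fr2: "\<And>a. a \<notin> writes (''e'' ::= Quot (V ''e'') (Const 2) ;; ''j'' ::= Const 0) \<Longrightarrow> s2 a = s' a"
        have v2: "s2 ''W'' (s2 ''g'' 0) = w ^ (2 ^ j)" "\<And>x. x < 2 * 2 ^ e \<Longrightarrow> s2 P x = packv f w (2 ^ j) x"
          "s2 ''g'' 0 = j"
          using I e j W v fr2 P' by auto
        show "runs (While (Sub (V ''e'') (V ''j'')) (pack_step P) ;; ''g'' ::= Add (V ''g'') (Const 1)) s2
           (220 * 2 ^ h * bits M) (?I (Suc j))"
        proof (rule runs_Seq[OF runs_pack_level[OF P _ _ _ v2(1) _ _ f v2(2) order_refl]])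
          fix s3 assume R3: "bounded M s3 \<and> (\<forall>x<2 ^ e. s3 P x = packv f w (2 ^ Suc j) x)"
            and fr3: "\<And>a. a \<notin> writes (While (Sub (V ''e'') (V ''j'')) (pack_step P)) \<Longrightarrow> s3 a = s2 a"
          have v3: "s3 ''g'' 0 = j" "s3 ''e'' 0 = 2 ^ e" using v2 R fr3 P' by (simp_all add: pack_step_def)
          show "runs (''g'' ::= Add (V ''g'') (Const 1)) s3 (10 * bits M) (?I (Suc j))"
            by (rule runs_chk[where M = M and \<beta> = "bits M"])
              (use R3 v3 P' hM' j in \<open>auto simp: big_def e_def simp del: power_Suc\<close>)
        next
          have "200 * 2 ^ (e + j) * bits M + 10 * bits M \<le> 200 * 2 ^ h * bits M + 20 * (2 ^ h * bits M)"
            using e2 by (intro add_mono mult_mono) auto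
          then show "200 * 2 ^ (e + j) * bits M + 10 * bits M \<le> 220 * 2 ^ h * bits M"
              by (simp add: algebra_simps)
        qed (use R N e2 in auto)
      next
        have "20 * bits M \<le> 20 * (2 ^ h * bits M)" by simp
        then show "20 * bits M + 220 * 2 ^ h * bits M \<le> 250 * 2 ^ h * bits M" by linarith
      qed
      then show "ev (Sub (V ''h'') (V ''g'')) s' \<noteq> 0 \<and> chk (bits M) (Sub (V ''h'') (V ''g'')) s' \<and>
        runs ?c s' (250 * 2 ^ h * bits M) (?I (Suc j))"
        using I j v by (auto simp: big_def)
    next
      have "(\<Sum>j<h. 250 * 2 ^ h * bits M + 9 * bits M) + 9 * bits M \<le> (\<Sum>j<h. 250 * 2 ^ h * bits M
          + 10 * (2 ^ h * bits M)) + 10 * (2 ^ h * bits M)"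
        by (intro add_mono sum_mono mult_mono) auto
      also have "\<dots> \<le> 260 * (h + 1) * 2 ^ h * bits M" by (simp add: algebra_simps)
      finally show "(\<Sum>j<h. 250 * 2 ^ h * bits M + (ecost (Sub (V ''h'') (V ''g''))
          + wt (Sub (V ''h'') (V ''g''))) * bits M) +
        (ecost (Sub (V ''h'') (V ''g'')) + wt (Sub (V ''h'') (V ''g''))) * bits M \<le> 260 * (h
            + 1) * 2 ^ h * bits M"
        unfolding cost_Sub_V .
    qed (use fr N P' in \<open>auto simp: big_def pack_step_def\<close>)
  next
    have "20 * bits M + 260 * (h + 1) * 2 ^ h * bits M \<le> 20 * (2 ^ h * bits M * bits M)
        + 260 * bits M * 2 ^ h * bits M"
      using hM by (intro add_mono mult_mono) auto
    then show "20 * bits M + 260 * (h + 1) * 2 ^ h * bits M \<le> \<tau>"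
      using tau by (simp add: algebra_simps)
  qed
qed

definition unpack_step :: com where
  "unpack_step = ''j'' ::= Sub (V ''j'') (Const 1) ;;
    Put ''U'' (Add (Mul (Const 2) (V ''j'')) (Const 1)) (Quot (Elem ''U'' (V ''j'')) (Elem ''W'' (V ''g'')))
        ;;
    Put ''U'' (Mul (Const 2) (V ''j'')) (Sub (Elem ''U'' (V ''j''))
      (Mul (Elem ''U'' (Add (Mul (Const 2) (V ''j'')) (Const 1))) (Elem ''W'' (V ''g''))))"

definition unpack :: com where
  "unpack = (''g'' ::= V ''h'' ;; ''e'' ::= Const 1) ;;
    While (V ''g'')
      ((''g'' ::= Sub (V ''g'') (Const 1) ;; ''j'' ::= V ''e'') ;;
       While (V ''j'') unpack_step ;;
       ''e'' ::= Mul (Const 2) (V ''e''))"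

lemma writes_unpack [simp]: "writes unpack = {''U'', ''g'', ''e'', ''j''}"
  by (auto simp: unpack_def unpack_step_def)

lemma cost_V: "ecost (V a) + wt (V a) = 4"
  by simp

lemma runs_unpack_level:
  assumes bd: "bounded M s"
    and N: "s ''j'' 0 = 2 ^ e" "s ''W'' (s ''g'' 0) = w ^ (2 ^ l)" "2 * 2 ^ e \<le> M" "w \<le> M"
    and f: "\<And>j. f j < w" and cells: "\<And>x. x < 2 ^ e \<Longrightarrow> s ''U'' x = packv f w (2 ^ Suc l) x"
    and tau: "200 * 2 ^ (e + l) * bits M \<le> \<tau>"
  shows "runs (While (V ''j'') unpack_step) s \<tau>
    (\<lambda>s'. bounded M s' \<and> (\<forall>x<2 * 2 ^ e. s' ''U'' x = packv f w (2 ^ l) x))"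
proof -
  let ?b = "2 ^ Suc l * bits M"
  have M: "2 \<le> M" using N(3) one_le_power[of "2 :: nat" e] by linarith
  then have bM: "2 \<le> bits M" using bits_mono[OF M] by simp
  have bM': "bits M \<le> ?b" "2 \<le> ?b" using bM
      by (simp, simp add: mult_le_mono[of 1 _ 2 _, simplified] trans_le_add1)
  let ?I = "\<lambda>i s'. bounded M s' \<and> s' ''j'' 0 = 2 ^ e - i \<and>
    (\<forall>x<2 ^ e - i. s' ''U'' x = packv f w (2 ^ Suc l) x) \<and>
    (\<forall>x. 2 * (2 ^ e - i) \<le> x \<and> x < 2 * 2 ^ e \<longrightarrow> s' ''U'' x = packv f w (2 ^ l) x)"
  show ?thesis
  proof (rule runs_loop[where I = ?I and n = "2 ^ e" and M = M and \<beta> = ?b and \<tau> = "\<lambda>_. 80 * ?b"])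
    show "?I 0 s" using bd N cells by simp
    fix i s' assume i: "i < 2 ^ e" and I: "?I i s'" and fr: "\<And>a. a \<notin> writes unpack_step \<Longrightarrow> s' a = s a"
    define q where "q = 2 ^ e - Suc i"
    have q: "2 ^ e - i = Suc q" "2 ^ e - Suc i = q" "Suc q \<le> 2 ^ e" using i by (simp_all add: q_def)
    have v: "s' ''W'' (s' ''g'' 0) = w ^ (2 ^ l)" "s' ''j'' 0 = Suc q"
      using fr N I q by (simp_all add: unpack_step_def)
    have U: "s' ''U'' x = packv f w (2 ^ Suc l) x" if "x < Suc q" for x using I that q by auto
    have U': "s' ''U'' x = packv f w (2 ^ l) x" if "2 * Suc q \<le> x"
        "x < 2 * 2 ^ e" for x using I that q by auto
    have "0 < w" using f[of 0] by simp
    have new1: "packv f w (2 ^ Suc l) q div w ^ 2 ^ l = packv f w (2 ^ l) (Suc (2 * q))"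
      using packv_less[of f w "2 ^ l" "2 * q", OF f] \<open>0 < w\<close> by (simp add: packv_double)
    have new2: "packv f w (2 ^ Suc l) q - packv f w (2 ^ l) (Suc (2 * q)) * w ^ 2 ^ l
        = packv f w (2 ^ l) (2 * q)"
      by (simp add: packv_double)
    have b: "bits (s' ''U'' q) \<le> ?b" "bits (packv f w (2 ^ l) (Suc (2 * q))) \<le> ?b"
      "bits (packv f w (2 ^ Suc l) q) \<le> ?b"
      unfolding U[of q, simplified] by (rule bits_packv[OF f]; use N in simp)+
    have "bits (w ^ (2 ^ l)) \<le> 2 ^ l * bits w" by (rule bits_power) simp
    also have "\<dots> \<le> ?b" using N by (intro mult_mono bits_mono) auto
    finally have bW: "bits (s' ''W'' (s' ''g'' 0)) \<le> ?b" using v by simp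
    have bW': "bits (w ^ (2 ^ l)) \<le> ?b" using bW v by simp
    have "Suc q \<le> M" "q \<le> M" using q N by linarith+
    have Uq: "s' ''U'' q = packv f w (2 ^ Suc l) q" using U by simp
    have s1: "Suc q - 1 = q" by simp
    have "runs unpack_step s' (80 * ?b) (?I (Suc i))"
    proof (rule runs_chk[where M = M and \<beta> = ?b])
      show "chkc M ?b unpack_step s'"
        unfolding unpack_step_def using b(1) bW bW' b bM' v new1 Uq \<open>q \<le> M\<close>
        by (simp add: big_def del: power_Suc)
      assume bd': "bounded M (fin unpack_step s')"
      have Usuc: "fin unpack_step s' ''U'' = (s' ''U'')(Suc (2 * q) := packv f w (2 ^ l) (Suc (2 * q)),
          2 * q := packv f w (2 ^ l) (2 * q))" "fin unpack_step s' ''j'' 0 = q"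
        unfolding unpack_step_def using v new1 new2 Uq by (simp_all add: fun_upd_twist del: power_Suc)
      have "fin unpack_step s' ''U'' x = packv f w (2 ^ Suc l) x" if "x < q" for x
        using that U[of x] by (simp add: Usuc)
      moreover have "fin unpack_step s' ''U'' x = packv f w (2 ^ l) x" if "2 * q \<le> x" "x < 2 * 2 ^ e" for x
        using that U'[of x] by (auto simp: Usuc)
      ultimately show "?I (Suc i) (fin unpack_step s')" using bd' by (simp add: Usuc q)
    qed (use I bM' in \<open>simp_all add: unpack_step_def\<close>)
    then show "ev (V ''j'') s' \<noteq> 0 \<and> chk ?b (V ''j'') s' \<and> runs unpack_step s' (80 * ?b) (?I (Suc i))"
      using I i v bM' by (auto simp: big_def)
  next
    have "(\<Sum>j<(2::nat) ^ e. 80 * ?b + 4 * ?b) + 4 * ?b \<le> 84 * (2 ^ e * ?b) + 4 * (2 ^ e * ?b)"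
      by simp
    also have "\<dots> = 176 * 2 ^ (e + l) * bits M" by (simp add: power_add)
    also have "\<dots> \<le> \<tau>" by (rule le_trans[OF _ tau]) simp
    finally show "(\<Sum>j<(2::nat) ^ e. 80 * ?b + (ecost (V ''j'') + wt (V ''j'')) * ?b) + (ecost (V ''j'')
        + wt (V ''j'')) * ?b \<le> \<tau>"
      unfolding cost_V .
  qed (use N bM' in \<open>auto simp: unpack_step_def big_def simp del: power_Suc\<close>)
qed

lemma runs_unpack:
  assumes bd: "bounded M s"
    and N: "s ''h'' 0 = h" "2 * 2 ^ h \<le> M" "w \<le> M"
    and W: "\<And>i. i \<le> h \<Longrightarrow> s ''W'' i = w ^ (2 ^ i)"
    and f: "\<And>j. f j < w" and U: "s ''U'' 0 = packv f w (2 ^ h) 0"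
    and tau: "500 * 2 ^ h * bits M * bits M \<le> \<tau>"
  shows "runs unpack s \<tau> (\<lambda>s'. bounded M s' \<and> (\<forall>x<2 ^ h. s' ''U'' x = f x))"
proof -
  have M: "2 \<le> M" using N(2) one_le_power[of "2 :: nat" h] by linarith
  then have bM: "2 \<le> bits M" using bits_mono[OF M] by simp
  have hM: "h < bits M" using N by (simp add: less_bits_if_power_le)
  have hM': "h < M" using N(2) less_exp[of h] by linarith
  let ?I = "\<lambda>j s'. bounded M s' \<and> s' ''g'' 0 = h - j \<and> s' ''e'' 0 = 2 ^ j \<and>
    (\<forall>x<2 ^ j. s' ''U'' x = packv f w (2 ^ (h - j)) x)"
  let ?c = "(''g'' ::= Sub (V ''g'') (Const 1) ;; ''j'' ::= V ''e'') ;;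
       While (V ''j'') unpack_step ;; ''e'' ::= Mul (Const 2) (V ''e'')"
  show ?thesis
    unfolding unpack_def
  proof (rule runs_Seq)
    show "runs (''g'' ::= V ''h'' ;; ''e'' ::= Const 1) s (20 * bits M) (?I 0)"
      by (rule runs_chk[where \<beta> = "bits M", OF bd]) (use N U bM hM' in \<open>auto simp: big_def\<close>)
    fix s1 assume I0: "?I 0 s1" and
      fr: "\<And>a. a \<notin> writes (''g'' ::= V ''h'' ;; ''e'' ::= Const 1) \<Longrightarrow> s1 a = s a"
    show "runs (While (V ''g'') ?c) s1 (260 * (h + 1) * 2 ^ h * bits M)
       (\<lambda>s'. bounded M s' \<and> (\<forall>x<2 ^ h. s' ''U'' x = f x))"
    proof (rule runs_loop[where I = ?I and n = h and M = M and \<beta> = "bits M"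
        and \<tau> = "\<lambda>_. 250 * 2 ^ h * bits M"])
      show "?I 0 s1" by (rule I0)
      fix j s' assume j: "j < h" and I: "?I j s'" and fr':  "\<And>a. a \<notin> writes ?c \<Longrightarrow> s' a = s1 a"
      have v: "s' ''W'' = s ''W''" using fr fr' N by (simp_all add: unpack_step_def)
      define l where "l = h - Suc j"
      have l: "h - j = Suc l" "j + l \<le> h" "l \<le> M" using j hM' by (simp_all add: l_def)
      have e2: "(2::nat) ^ (j + l) \<le> 2 ^ h" "2 * 2 ^ j \<le> M" "2 ^ j \<le> M"
        using l j N power_increasing[of "Suc j" h "2::nat"] by (auto intro: power_increasing)
      have "runs ?c s' (250 * 2 ^ h * bits M) (?I (Suc j))"
      proof (rule runs_Seq)
        let ?R = "\<lambda>s'. bounded M s' \<and> s' ''g'' 0 = l \<and> s' ''j'' 0 = 2 ^ j"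
        show "runs (''g'' ::= Sub (V ''g'') (Const 1) ;; ''j'' ::= V ''e'') s' (20 * bits M) ?R"
          by (rule runs_chk[where M = M and \<beta> = "bits M"]) (use I l e2 N bM in \<open>auto simp: big_def\<close>)
        fix s2 assume R: "?R s2" and
          fr2: "\<And>a. a \<notin> writes (''g'' ::= Sub (V ''g'') (Const 1) ;; ''j'' ::= V ''e'') \<Longrightarrow> s2 a = s' a"
        have v2: "s2 ''W'' (s2 ''g'' 0) = w ^ (2 ^ l)" "\<And>x. x < 2 ^ j
            \<Longrightarrow> s2 ''U'' x = packv f w (2 ^ Suc l) x"
          "s2 ''e'' 0 = 2 ^ j"
          using I l W v fr2 R by auto
        show "runs (While (V ''j'') unpack_step ;; ''e'' ::= Mul (Const 2) (V ''e'')) s2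
           (220 * 2 ^ h * bits M) (?I (Suc j))"
        proof (rule runs_Seq[OF runs_unpack_level[OF _ _ v2(1) _ _ f v2(2) order_refl]])
          fix s3 assume R3: "bounded M s3 \<and> (\<forall>x<2 * 2 ^ j. s3 ''U'' x = packv f w (2 ^ l) x)"
            and fr3: "\<And>a. a \<notin> writes (While (V ''j'') unpack_step) \<Longrightarrow> s3 a = s2 a"
          have v3: "s3 ''g'' 0 = l" "s3 ''e'' 0 = 2 ^ j" using v2 R fr3 by (simp_all add: unpack_step_def)
          show "runs (''e'' ::= Mul (Const 2) (V ''e'')) s3 (10 * bits M) (?I (Suc j))"
            by (rule runs_chk[where M = M and \<beta> = "bits M"])
              (use R3 v3 e2 bM in \<open>auto simp: big_def l_def\<close>)
        next
          have "200 * 2 ^ (j + l) * bits M + 10 * bits M \<le> 200 * 2 ^ h * bits M + 20 * (2 ^ h * bits M)"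
            using e2 by (intro add_mono mult_mono) auto
          then show "200 * 2 ^ (j + l) * bits M + 10 * bits M \<le> 220 * 2 ^ h * bits M"
              by (simp add: algebra_simps)
        qed (use R N e2 in auto)
      next
        have "20 * bits M \<le> 20 * (2 ^ h * bits M)" by simp
        then show "20 * bits M + 220 * 2 ^ h * bits M \<le> 250 * 2 ^ h * bits M" by linarith
      qed
      then show "ev (V ''g'') s' \<noteq> 0 \<and> chk (bits M) (V ''g'') s'
          \<and> runs ?c s' (250 * 2 ^ h * bits M) (?I (Suc j))"
        using I j v by (auto simp: big_def)
    next
      have "(\<Sum>j<h. 250 * 2 ^ h * bits M + 4 * bits M) + 4 * bits M \<le> (\<Sum>j<h. 250 * 2 ^ h * bits M
          + 10 * (2 ^ h * bits M)) + 10 * (2 ^ h * bits M)"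
        by (intro add_mono sum_mono mult_mono) auto
      also have "\<dots> \<le> 260 * (h + 1) * 2 ^ h * bits M" by (simp add: algebra_simps)
      finally show "(\<Sum>j<h. 250 * 2 ^ h * bits M + (ecost (V ''g'') + wt (V ''g'')) * bits M) +
        (ecost (V ''g'') + wt (V ''g'')) * bits M \<le> 260 * (h + 1) * 2 ^ h * bits M"
        unfolding cost_V .
    qed (use fr N in \<open>auto simp: big_def unpack_step_def\<close>)
  next
    have "20 * bits M + 260 * (h + 1) * 2 ^ h * bits M \<le> 20 * (2 ^ h * bits M * bits M)
        + 260 * bits M * 2 ^ h * bits M"
      using hM by (intro add_mono mult_mono) auto
    then show "20 * bits M + 260 * (h + 1) * 2 ^ h * bits M \<le> \<tau>"
      using tau by (simp add: algebra_simps)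
  qed
qed

lemma runsE:
  assumes "runs c s \<tau> Q"
  obtains T s' where "exec c s T s'" "T \<le> \<tau>" "Q s'" "\<And>a. a \<notin> writes c \<Longrightarrow> s' a = s a"
  using runs_frame[OF assms] unfolding runs_def by blast

lemma runsI: "exec c s T s' \<Longrightarrow> T \<le> \<tau> \<Longrightarrow> Q s' \<Longrightarrow> runs c s \<tau> Q"
  unfolding runs_def by blast

primrec epow :: "expr \<Rightarrow> nat \<Rightarrow> expr" where
  "epow e 0 = Const 1"
| "epow e (Suc n) = Mul e (epow e n)"

lemma ev_epow [simp]: "ev (epow e n) s = ev e s ^ n"
  by (induction n) auto

lemma chk_epow [simp]: "1 \<le> \<beta> \<Longrightarrow> chk \<beta> e s \<Longrightarrow> chk \<beta> (epow e n) s"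
  by (induction n) auto

lemma wt_epow: "wt (epow e n) = n * wt e + 1"
  by (induction n) auto

lemma ecost_epow: "ecost (epow e n) \<le> (ecost e + 2 * wt e + 1) * (n + 1) ^ 2"
  by (induction n) (auto simp: wt_epow power2_eq_square algebra_simps)

definition sizes :: "nat \<Rightarrow> com" where
  "sizes k = (''N0'' ::= epow (Mul (V ''J'') (V ''S'')) k ;; ''N'' ::= Const 1 ;; ''h'' ::= Const 0) ;;
    While (Sub (V ''N0'') (V ''N'')) (''N'' ::= Mul (Const 2) (V ''N'')
        ;; ''h'' ::= Add (V ''h'') (Const 1))"

lemma writes_sizes [simp]: "writes (sizes k) = {''N0'', ''N'', ''h''}"
  by (auto simp: sizes_def)

lemma runs_sizes:
  assumes bd: "bounded M s" and J: "1 \<le> s ''J'' 0" "1 \<le> s ''S'' 0"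
    and M: "4 * (s ''J'' 0 * s ''S'' 0) ^ k \<le> M"
    and tau: "100 * (k + 1)^2 * bits M * bits M \<le> \<tau>"
  shows "runs (sizes k) s \<tau> (\<lambda>s'. bounded M s' \<and> s' ''N'' 0 = 2 ^ s' ''h'' 0 \<and>
    (s ''J'' 0 * s ''S'' 0) ^ k \<le> s' ''N'' 0 \<and> s' ''N'' 0 \<le> 2 * (s ''J'' 0 * s ''S'' 0) ^ k)"
proof -
  define N0 where "N0 = (s ''J'' 0 * s ''S'' 0) ^ k"
  have N0: "1 \<le> N0" using J by (simp add: N0_def)
  have M4: "4 * N0 \<le> M" using M by (simp add: N0_def)
  then have M': "4 \<le> M" "N0 \<le> M" using N0 by linarith+
  have bM: "2 \<le> bits M" using bits_mono[of 2 M] M' by simp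
  define n where "n = (LEAST h. N0 \<le> 2 ^ h)"
  have n1: "N0 \<le> 2 ^ n" unfolding n_def by (rule LeastI[of _ N0]) (use less_exp[of N0] in simp)
  have n2: "2 ^ h < N0" if "h < n" for h using not_less_Least[of h "\<lambda>h. N0 \<le> 2 ^ h"] that
      by (simp add: n_def)
  have n3: "2 ^ n \<le> 2 * N0" using n2[of "n - 1"] N0 by (cases n) auto
  have n4: "n < bits M" by (rule less_bits_if_power_le) (use n3 M4 in linarith)
  have n5: "n < M" using less_exp[of n] n3 M4 N0 by linarith
  let ?I = "\<lambda>j s'. bounded M s' \<and> s' ''N0'' 0 = N0 \<and> s' ''N'' 0 = 2 ^ j \<and> s' ''h'' 0 = j"
  let ?i = "''N0'' ::= epow (Mul (V ''J'') (V ''S'')) k ;; ''N'' ::= Const 1 ;; ''h'' ::= Const 0"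
  let ?c = "''N'' ::= Mul (Const 2) (V ''N'') ;; ''h'' ::= Add (V ''h'') (Const 1)"
  have c: "ccost ?i \<le> 30 * (k + 1)^2"
    using ecost_epow[of "Mul (V ''J'') (V ''S'')" k] by (simp add: wt_epow power2_eq_square algebra_simps)
  show ?thesis
    unfolding sizes_def
  proof (rule runs_Seq)
    show "runs ?i s (30 * (k + 1)^2 * bits M) (?I 0)"
    proof (rule runs_chk[where \<beta> = "bits M", OF bd])
      show "ccost ?i * bits M \<le> 30 * (k + 1)^2 * bits M" using mult_le_mono1[OF c] .
    qed (use M' bM in \<open>auto simp: big_def N0_def\<close>)
  next
    fix s1 assume "?I 0 s1"
    then show "runs (While (Sub (V ''N0'') (V ''N'')) ?c) s1 (50 * (n + 1) * bits M)
      (\<lambda>s'. bounded M s' \<and> s' ''N'' 0 = 2 ^ s' ''h'' 0 \<and>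
        (s ''J'' 0 * s ''S'' 0) ^ k \<le> s' ''N'' 0 \<and> s' ''N'' 0 \<le> 2 * (s ''J'' 0 * s ''S'' 0) ^ k)"
    proof (rule runs_loop[where I = ?I and n = n and M = M and \<beta> = "bits M" and \<tau> = "\<lambda>_. 20 * bits M"])
      fix j s' assume j: "j < n" and I: "?I j s'"
      have "2 * 2 ^ j \<le> M" "Suc j \<le> M" using n2[OF j] M4 j n5 by linarith+
      then have "runs ?c s' (20 * bits M) (?I (Suc j))"
        by (intro runs_chk[where M = M and \<beta> = "bits M"]) (use I bM in \<open>auto simp: big_def\<close>)
      then show "ev (Sub (V ''N0'') (V ''N'')) s' \<noteq> 0 \<and> chk (bits M) (Sub (V ''N0'') (V ''N'')) s' \<and>
        runs ?c s' (20 * bits M) (?I (Suc j))" using I n2[OF j] by (auto simp: big_def)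
    next
      show "(\<Sum>j<n. 20 * bits M + (ecost (Sub (V ''N0'') (V ''N''))
          + wt (Sub (V ''N0'') (V ''N''))) * bits M) +
        (ecost (Sub (V ''N0'') (V ''N'')) + wt (Sub (V ''N0'') (V ''N''))) * bits M \<le> 50 * (n + 1) * bits M"
        unfolding cost_Sub_V by (simp add: algebra_simps)
    qed (use n1 n3 in \<open>auto simp: big_def N0_def\<close>)
  next
    have "30 * (k + 1)^2 * bits M + 50 * (n + 1) * bits M \<le> 30 * (k + 1)^2 * (bits M * bits M) + 50 * (k
        + 1)^2 * (bits M * bits M)"
    proof (intro add_mono)
      have "50 * (n + 1) * bits M \<le> 50 * 1 * (bits M * bits M)" using n4 by simp
      also have "\<dots> \<le> 50 * (k + 1)^2 * (bits M * bits M)" by (intro mult_mono) auto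
      finally show "50 * (n + 1) * bits M \<le> 50 * (k + 1)^2 * (bits M * bits M)" .
    qed simp
    then show "30 * (k + 1)^2 * bits M + 50 * (n + 1) * bits M \<le> \<tau>" using tau by (simp add: algebra_simps)
  qed
qed

definition clear :: com where
  "clear = ''j'' ::= Const 0 ;; While (Sub (V ''N'') (V ''j''))
    (Put ''P'' (V ''j'') (Const 0) ;; Put ''Q'' (V ''j'') (Const 0) ;; ''j'' ::= Add (V ''j'') (Const 1))"

lemma writes_clear [simp]: "writes clear = {''j'', ''P'', ''Q''}"
  by (auto simp: clear_def)

lemma runs_clear:
  assumes bd: "bounded M s" and N: "s ''N'' 0 = N" "N \<le> M" and tau: "100 * (N + 1) * bits M \<le> \<tau>"
  shows "runs clear s \<tau> (\<lambda>s'. bounded M s' \<and> (\<forall>x<N. s' ''P'' x = 0 \<and> s' ''Q'' x = 0))"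
proof -
  let ?I = "\<lambda>j s'. bounded M s' \<and> s' ''j'' 0 = j \<and> (\<forall>x<j. s' ''P'' x = 0 \<and> s' ''Q'' x = 0)"
  let ?c = "Put ''P'' (V ''j'') (Const 0) ;; Put ''Q'' (V ''j'') (Const 0)
      ;; ''j'' ::= Add (V ''j'') (Const 1)"
  show ?thesis
    unfolding clear_def
  proof (rule runs_Seq)
    show "runs (''j'' ::= Const 0) s (10 * bits M) (?I 0)"
      by (rule runs_chk[where \<beta> = "bits M", OF bd]) auto
  next
    fix s1 assume I0: "?I 0 s1" and fr: "\<And>a. a \<notin> writes (''j'' ::= Const 0) \<Longrightarrow> s1 a = s a"
    show "runs (While (Sub (V ''N'') (V ''j'')) ?c) s1 (90 * (N + 1) * bits M)
       (\<lambda>s'. bounded M s' \<and> (\<forall>x<N. s' ''P'' x = 0 \<and> s' ''Q'' x = 0))"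
    proof (rule runs_loop[where I = ?I and n = N and M = M and \<beta> = "bits M" and \<tau> = "\<lambda>_. 50 * bits M"])
      show "?I 0 s1" by (rule I0)
      fix j s' assume j: "j < N" and I: "?I j s'" and fr': "\<And>a. a \<notin> writes ?c \<Longrightarrow> s' a = s1 a"
      have v: "s' ''N'' 0 = N" using fr fr' N by simp
      have "runs ?c s' (50 * bits M) (?I (Suc j))"
        by (rule runs_chk[where M = M and \<beta> = "bits M"]) (use I N j in \<open>auto simp: big_def less_Suc_eq\<close>)
      then show "ev (Sub (V ''N'') (V ''j'')) s' \<noteq> 0 \<and> chk (bits M) (Sub (V ''N'') (V ''j'')) s' \<and>
        runs ?c s' (50 * bits M) (?I (Suc j))" using I j v by (auto simp: big_def)
    next
      show "(\<Sum>j<N. 50 * bits M + (ecost (Sub (V ''N'') (V ''j''))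
          + wt (Sub (V ''N'') (V ''j''))) * bits M) +
        (ecost (Sub (V ''N'') (V ''j'')) + wt (Sub (V ''N'') (V ''j''))) * bits M \<le> 90 * (N + 1) * bits M"
        unfolding cost_Sub_V by (simp add: algebra_simps)
    qed (use fr N in \<open>auto simp: big_def\<close>)
  next
    have "10 * bits M + 90 * (N + 1) * bits M \<le> 100 * (N + 1) * bits M" by (simp add: algebra_simps)
    then show "10 * bits M + 90 * (N + 1) * bits M \<le> \<tau>" using tau by linarith
  qed
qed

lemma fun_upd_if:
  "(\<And>x. f x = (if H x then 1 else g x)) \<Longrightarrow> (if c then f(v := 1) else f) x = (if H x \<or> c
      \<and> v = x then 1 else g x)"
  by simp

lemma ex_less_Suc_from:
  "lo \<le> n \<Longrightarrow> (\<exists>i. lo \<le> i \<and> i < Suc n \<and> R i) \<longleftrightarrow> (\<exists>i. lo \<le> i \<and> i < n \<and> R i) \<or> R n"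
  by (auto simp: less_Suc_eq)

definition scatter :: "nat \<Rightarrow> string \<Rightarrow> string \<Rightarrow> com" where
  "scatter k a P = While (Sub (V ''hi'') (V ''lo''))
    (''u'' ::= Elem a (V ''lo'') ;; recode k ;;
     Ite (V ''ok'') (Put P (V ''r'') (Const 1)) Skip ;; ''lo'' ::= Add (V ''lo'') (Const 1))"

lemma writes_scatter [simp]: "writes (scatter k a P)
    = {P, ''lo'', ''r'', ''w'', ''ok'', ''c'', ''d'', ''u'', ''f''}"
  by (auto simp: scatter_def)

lemma runs_scatter:
  assumes a: "a \<in> {''A'', ''L''}" and P: "P \<in> {''P'', ''Q''}"
    and bd: "bounded M s" and k: "k \<le> M" "1 \<le> M"
    and lo: "s ''lo'' 0 = lo" "s ''hi'' 0 = hi" "lo \<le> hi" "hi \<le> M"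
    and par: "s ''x1'' 0 = x1" "s ''x2'' 0 = x2" "s ''u1'' 0 = u1" "s ''u2'' 0 = u2" "s ''lim'' 0 = lm"
      "s ''y1'' 0 = y1" "s ''y2'' 0 = y2" "s ''y3'' 0 = y3"
    and y3: "1 \<le> y3" "y3 ^ k \<le> M" and rv: "\<And>x. rval k x1 x2 y1 y2 y3 x \<le> M"
    and tau: "500 * (k + 1) * (hi - lo + 1) * bits M \<le> \<tau>"
  shows "runs (scatter k a P) s \<tau> (\<lambda>s'. bounded M s' \<and>
    (\<forall>x. s' P x = (if \<exists>i. lo \<le> i \<and> i < hi \<and> rok k x1 x2 u1 u2 lm (s a i) \<and> rval k x1 x2 y1 y2 y3 (s a i) = x
       then 1 else s P x)))"
proof -
  have P': "P \<in> big" "a \<notin> big" "P \<noteq> a" "a \<noteq> P"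
    "\<And>x. x \<in> {''lo'', ''hi'', ''r'', ''w'', ''ok'', ''c'', ''d'', ''u'', ''f'', ''x1'', ''x2'', ''u1'',
        ''u2'', ''lim'', ''y1'', ''y2'', ''y3''}
      \<Longrightarrow> P \<noteq> x \<and> x \<noteq> P \<and> a \<noteq> x \<and> x \<noteq> a"
    using P a by (auto simp: big_def)
  let ?H = "\<lambda>n x. \<exists>i. lo \<le> i \<and> i < n \<and> rok k x1 x2 u1 u2 lm (s a i) \<and> rval k x1 x2 y1 y2 y3 (s a i) = x"
  let ?I = "\<lambda>j s'. bounded M s' \<and> s' ''lo'' 0 = lo + j
      \<and> (\<forall>x. s' P x = (if ?H (lo + j) x then 1 else s P x))"
  let ?c = "''u'' ::= Elem a (V ''lo'') ;; recode k ;;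
     Ite (V ''ok'') (Put P (V ''r'') (Const 1)) Skip ;; ''lo'' ::= Add (V ''lo'') (Const 1)"
  show ?thesis
    unfolding scatter_def
  proof (rule runs_loop[where I = ?I and n = "hi - lo" and M = M and \<beta> = "bits M"
      and \<tau> = "\<lambda>_. 380 * (k + 1) * bits M"])
    show "?I 0 s" using bd lo by auto
    fix j s' assume j: "j < hi - lo" and I: "?I j s'" and fr: "\<And>a. a \<notin> writes ?c \<Longrightarrow> s' a = s a"
    have "runs ?c s' (380 * (k + 1) * bits M) (?I (Suc j))"
    proof -
      have "runs (''u'' ::= Elem a (V ''lo'')) s' (20 * bits M) (\<lambda>s'. bounded M s'
          \<and> s' ''u'' 0 = s a (lo + j))"
        by (rule runs_chk[where M = M and \<beta> = "bits M"]) (use I bd P' fr in \<open>auto simp: big_def boundedD\<close>)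
      then obtain T1 s1 where 1: "exec (''u'' ::= Elem a (V ''lo'')) s' T1 s1" "T1 \<le> 20 * bits M"
        "bounded M s1" "s1 ''u'' 0 = s a (lo + j)" and fr1: "\<And>a. a \<noteq> ''u'' \<Longrightarrow> s1 a = s' a"
        by (rule runsE) auto
      have par1: "s1 ''x1'' 0 = x1" "s1 ''x2'' 0 = x2" "s1 ''u1'' 0 = u1" "s1 ''u2'' 0 = u2"
          "s1 ''lim'' 0 = lm"
        "s1 ''y1'' 0 = y1" "s1 ''y2'' 0 = y2" "s1 ''y3'' 0 = y3"
        using par fr fr1 P'(5) by simp_all
      obtain T2 s2 where 2: "exec (recode k) s1 T2 s2" "T2 \<le> 300 * (k + 1) * bits M"
        "bounded M s2" "s2 ''r'' 0 = rval k x1 x2 y1 y2 y3 (s a (lo + j))"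
        "s2 ''ok'' 0 = of_bool (rok k x1 x2 u1 u2 lm (s a (lo + j)))" and fr2: "\<And>a. a \<notin> writes (recode k)
            \<Longrightarrow> s2 a = s1 a"
        by (rule runsE[OF runs_recode[OF 1(3) k _ _ _ order_refl]]) (use y3 rv par1 1 in auto)
      have v: "s2 ''lo'' 0 = lo + j" "s2 P = s' P" using fr2 fr1 P'(5) I by simp_all
      have M: "Suc (lo + j) \<le> M" using j lo by linarith
      let ?d = "Ite (V ''ok'') (Put P (V ''r'') (Const 1)) Skip ;; ''lo'' ::= Add (V ''lo'') (Const 1)"
      have ex: "?H (lo + Suc j) x \<longleftrightarrow> ?H (lo + j) x \<or>
          rok k x1 x2 u1 u2 lm (s a (lo + j)) \<and> rval k x1 x2 y1 y2 y3 (s a (lo + j)) = x" for x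
        using ex_less_Suc_from[of lo "lo + j" "\<lambda>i. rok k x1 x2 u1 u2 lm (s a i)
            \<and> rval k x1 x2 y1 y2 y3 (s a i) = x"]
        by (simp only: add_Suc_right le_add1)
      have "runs ?d s2 (40 * bits M) (?I (Suc j))"
      proof (rule runs_chk[where M = M and \<beta> = "bits M"])
        show "chkc M (bits M) ?d s2" using 2 v M P' by (simp add: big_def)
        assume b: "bounded M (fin ?d s2)"
        have f: "fin ?d s2 ''lo'' 0 = lo + Suc j"
          "fin ?d s2 P = (if rok k x1 x2 u1 u2 lm (s a (lo + j))
            then (s' P)(rval k x1 x2 y1 y2 y3 (s a (lo + j)) := 1) else s' P)"
          using 2 v P'(5) by simp_all
        have h: "s' P x = (if ?H (lo + j) x then 1 else s P x)" for x
          using I by (elim conjE) (erule spec)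
        have H: "fin ?d s2 P x = (if ?H (lo + Suc j) x then 1 else s P x)" for x
          using fun_upd_if[where f = "s' P" and H = "?H (lo + j)" and g = "s P" and x = x
              and c = "rok k x1 x2 u1 u2 lm (s a (lo + j))"
                  and v = "rval k x1 x2 y1 y2 y3 (s a (lo + j))", OF h]
          by (simp only: ex f(2))
        show "?I (Suc j) (fin ?d s2)" by (intro conjI allI b f(1) H)
      qed (use 2 in simp_all)
      then obtain T3 s3 where 3: "exec ?d s2 T3 s3" "T3 \<le> 40 * bits M" "?I (Suc j) s3" by (rule runsE)
      show ?thesis
        by (rule runsI[OF exec.Seq[OF 1(1) exec.Seq[OF 2(1) 3(1)]] ], use 1(2) 2(2) 3(2) in \<open>simp add:
            algebra_simps\<close>, rule 3(3))
    qed
    then show "ev (Sub (V ''hi'') (V ''lo'')) s' \<noteq> 0 \<and> chk (bits M) (Sub (V ''hi'') (V ''lo'')) s' \<and>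
      runs ?c s' (380 * (k + 1) * bits M) (?I (Suc j))"
      using I j lo fr P'(5) by (auto simp: big_def)
  next
    have "(\<Sum>j<hi - lo. 380 * (k + 1) * bits M + 9 * bits M) + 9 * bits M \<le>
       (\<Sum>j<hi - lo. 380 * (k + 1) * bits M + 9 * ((k + 1) * bits M)) + 9 * ((k + 1) * bits M)"
      by (intro add_mono sum_mono mult_mono) auto
    also have "\<dots> \<le> 500 * (k + 1) * (hi - lo + 1) * bits M" by (simp add: algebra_simps)
    finally show "(\<Sum>j<hi - lo. 380 * (k + 1) * bits M + (ecost (Sub (V ''hi'') (V ''lo''))
        + wt (Sub (V ''hi'') (V ''lo''))) * bits M) +
        (ecost (Sub (V ''hi'') (V ''lo'')) + wt (Sub (V ''hi'') (V ''lo''))) * bits M \<le> \<tau>"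
      unfolding cost_Sub_V using tau by linarith
  qed (use lo P'(5) in \<open>auto simp: big_def\<close>)
qed

definition collect :: "nat \<Rightarrow> string \<Rightarrow> com" where
  "collect k a = ''j'' ::= Const 0 ;; While (Sub (V ''N'') (V ''j''))
    (Ite (Elem ''U'' (V ''j''))
      ((''u'' ::= V ''j'' ;; recode k) ;; Ite (V ''ok'') (Put a (V ''p'') (V ''r'')
          ;; ''p'' ::= Add (V ''p'') (Const 1)) Skip)
      Skip ;;
     ''j'' ::= Add (V ''j'') (Const 1))"

lemma writes_collect [simp]: "writes (collect k a)
    = {a, ''j'', ''p'', ''r'', ''w'', ''ok'', ''c'', ''d'', ''u'', ''f''}"
  by (auto simp: collect_def)

lemma runs_collect:
  assumes a: "a \<in> {''A'', ''L''}"
    and bd: "bounded M s" and k: "k \<le> M" "1 \<le> M"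
    and N: "s ''N'' 0 = N" "s ''p'' 0 = p" "p + N \<le> M"
    and U: "\<And>x. x < N \<Longrightarrow> bits (s ''U'' x) \<le> bits M"
    and par: "s ''x1'' 0 = x1" "s ''x2'' 0 = x2" "s ''u1'' 0 = u1" "s ''u2'' 0 = u2" "s ''lim'' 0 = lm"
      "s ''y1'' 0 = y1" "s ''y2'' 0 = y2" "s ''y3'' 0 = y3"
    and y3: "1 \<le> y3" "y3 ^ k \<le> M" and rv: "\<And>x. rval k x1 x2 y1 y2 y3 x \<le> M"
    and tau: "500 * (k + 1) * (N + 1) * bits M \<le> \<tau>"
  shows "runs (collect k a) s \<tau> (\<lambda>s'. bounded M s' \<and> p \<le> s' ''p'' 0 \<and> s' ''p'' 0 \<le> p + N \<and>
    s' a ` {p..<s' ''p'' 0} = rval k x1 x2 y1 y2 y3 ` {x. x < N \<and> s ''U'' x \<noteq> 0 \<and> rok k x1 x2 u1 u2 lm x} \<and>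
    (\<forall>i<p. s' a i = s a i))"
proof -
  have a': "a \<notin> big"
    "\<And>x. x \<in> {''U'', ''p'', ''N'', ''j'', ''r'', ''w'', ''ok'', ''c'', ''d'', ''u'', ''f'', ''x1'', ''x2'',
        ''u1'', ''u2'', ''lim'', ''y1'', ''y2'', ''y3''}
      \<Longrightarrow> a \<noteq> x \<and> x \<noteq> a"
    using a by (auto simp: big_def)
  let ?X = "\<lambda>j. {x. x < j \<and> s ''U'' x \<noteq> 0 \<and> rok k x1 x2 u1 u2 lm x}"
  let ?I = "\<lambda>j s'. bounded M s' \<and> s' ''j'' 0 = j \<and> p \<le> s' ''p'' 0 \<and> s' ''p'' 0 \<le> p + j \<and>
    s' a ` {p..<s' ''p'' 0} = rval k x1 x2 y1 y2 y3 ` ?X j \<and> (\<forall>i<p. s' a i = s a i)"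
  let ?d = "Ite (V ''ok'') (Put a (V ''p'') (V ''r'') ;; ''p'' ::= Add (V ''p'') (Const 1)) Skip"
  let ?e = "Ite (Elem ''U'' (V ''j'')) ((''u'' ::= V ''j'' ;; recode k) ;; ?d) Skip"
  let ?c = "?e ;; ''j'' ::= Add (V ''j'') (Const 1)"
  show ?thesis
    unfolding collect_def
  proof (rule runs_Seq)
    show "runs (''j'' ::= Const 0) s (10 * bits M) (?I 0)"
      by (rule runs_chk[where \<beta> = "bits M", OF bd]) (use N a' in auto)
  next
    fix s1 assume I0: "?I 0 s1" and fr0: "\<And>a. a \<notin> writes (''j'' ::= Const 0) \<Longrightarrow> s1 a = s a"
    show "runs (While (Sub (V ''N'') (V ''j'')) ?c) s1 (450 * (k + 1) * (N + 1) * bits M)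
      (\<lambda>s'. bounded M s' \<and> p \<le> s' ''p'' 0 \<and> s' ''p'' 0 \<le> p + N \<and>
        s' a ` {p..<s' ''p'' 0} = rval k x1 x2 y1 y2 y3 ` ?X N \<and> (\<forall>i<p. s' a i = s a i))"
    proof (rule runs_loop[where I = ?I and n = N and M = M and \<beta> = "bits M"
        and \<tau> = "\<lambda>_. 420 * (k + 1) * bits M"])
      show "?I 0 s1" by (rule I0)
    next
      fix j s' assume j: "j < N" and I: "?I j s'" and fr': "\<And>a. a \<notin> writes ?c \<Longrightarrow> s' a = s1 a"
      have fr: "\<And>x. x \<noteq> a \<Longrightarrow> x \<notin> {''j'', ''p'', ''r'', ''w'', ''ok'', ''c'', ''d'', ''u'', ''f''}
          \<Longrightarrow> s' x = s x"
        using fr' fr0 by auto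
      have U': "s' ''U'' = s ''U''" using fr a' by simp
      let ?R = "\<lambda>s''. bounded M s'' \<and> s'' ''j'' 0 = j \<and> p \<le> s'' ''p'' 0 \<and> s'' ''p'' 0 \<le> p + Suc j \<and>
        s'' a ` {p..<s'' ''p'' 0} = rval k x1 x2 y1 y2 y3 ` ?X (Suc j) \<and> (\<forall>i<p. s'' a i = s a i)"
      have X: "?X (Suc j) = (if s ''U'' j \<noteq> 0 \<and> rok k x1 x2 u1 u2 lm j then insert j (?X j) else ?X j)"
        by (auto simp: less_Suc_eq)
      have "runs ?e s' (370 * (k + 1) * bits M) ?R"
      proof (rule runs_Ite[where \<beta> = "bits M"])
        show "okx (bits M) (Elem ''U'' (V ''j'')) s'"
          by (rule chk_okx[of M]) (use I U U' j in \<open>auto simp: big_def\<close>)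
        assume nz: "ev (Elem ''U'' (V ''j'')) s' \<noteq> 0"
        have nz': "s ''U'' j \<noteq> 0" using nz I U' by simp
        have "runs (''u'' ::= V ''j'') s' (10 * bits M) (\<lambda>s'. bounded M s' \<and> s' ''u'' 0 = j)"
          by (rule runs_chk[where M = M and \<beta> = "bits M"]) (use I N j in \<open>auto simp: big_def\<close>)
        then obtain T1 s1 where 1: "exec (''u'' ::= V ''j'') s' T1 s1" "T1 \<le> 10 * bits M"
          "bounded M s1" "s1 ''u'' 0 = j" and fr1: "\<And>a. a \<noteq> ''u'' \<Longrightarrow> s1 a = s' a"
          by (rule runsE) auto
        have par1: "s1 ''x1'' 0 = x1" "s1 ''x2'' 0 = x2" "s1 ''u1'' 0 = u1" "s1 ''u2'' 0 = u2"
            "s1 ''lim'' 0 = lm"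
          "s1 ''y1'' 0 = y1" "s1 ''y2'' 0 = y2" "s1 ''y3'' 0 = y3"
          using par fr fr1 a' by simp_all
        obtain T2 s2 where 2: "exec (recode k) s1 T2 s2" "T2 \<le> 300 * (k + 1) * bits M"
          "bounded M s2" "s2 ''r'' 0 = rval k x1 x2 y1 y2 y3 j"
          "s2 ''ok'' 0 = of_bool (rok k x1 x2 u1 u2 lm j)" and fr2: "\<And>a. a \<notin> writes (recode k)
              \<Longrightarrow> s2 a = s1 a"
          by (rule runsE[OF runs_recode[OF 1(3) k _ _ _ order_refl]]) (use y3 rv par1 1 in auto)
        have v: "s2 ''j'' 0 = j" "s2 ''p'' 0 = s' ''p'' 0" "s2 a = s' a" using fr2 fr1 a'(2) I by simp_all
        have M: "Suc (s' ''p'' 0) \<le> M" using I j N by linarith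
        have "runs ?d s2 (30 * bits M) ?R"
        proof (rule runs_chk[where M = M and \<beta> = "bits M"])
          show "chkc M (bits M) ?d s2"
            using 2 v M a' rv by (simp add: big_def)
          assume b: "bounded M (fin ?d s2)"
          have iv: "{p..<Suc (s' ''p'' 0)} = insert (s' ''p'' 0) {p..<s' ''p'' 0}" using I by auto
          show "?R (fin ?d s2)"
          proof (cases "rok k x1 x2 u1 u2 lm j")
            case True
            have f: "fin ?d s2 ''j'' 0 = j" "fin ?d s2 ''p'' 0 = Suc (s' ''p'' 0)"
              "fin ?d s2 a = (s' a)(s' ''p'' 0 := rval k x1 x2 y1 y2 y3 j)"
              using True 2 v a' by simp_all
            have XT: "?X (Suc j) = insert j (?X j)" unfolding X using nz' True by simp
            have "(s' a)(s' ''p'' 0 := rval k x1 x2 y1 y2 y3 j) ` {p..<s' ''p'' 0}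
                = s' a ` {p..<s' ''p'' 0}"
              by (intro image_cong) auto
            then have im: "fin ?d s2 a ` {p..<Suc (s' ''p'' 0)} = rval k x1 x2 y1 y2 y3 ` ?X (Suc j)"
              unfolding XT f(3) iv image_insert using I by (elim conjE) (simp only: fun_upd_same)
            have lt: "\<forall>i<p. fin ?d s2 a i = s a i" unfolding f(3) using I by simp
            have "?R s3" if "bounded M s3" "s3 ''j'' 0 = j" "s3 ''p'' 0 = Suc (s' ''p'' 0)"
              "s3 a ` {p..<Suc (s' ''p'' 0)} = rval k x1 x2 y1 y2 y3 ` ?X (Suc j)"
                  "\<forall>i<p. s3 a i = s a i" for s3
              using that I by simp
            from this[OF b f(1,2) im lt] show ?thesis .
          next
            case False
            show ?thesis
            proof -
            have f: "fin ?d s2 ''j'' 0 = j" "fin ?d s2 ''p'' 0 = s' ''p'' 0" "fin ?d s2 a = s' a"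
              using False 2 v a' by simp_all
            have XF: "?X (Suc j) = ?X j" unfolding X using False by simp
            show ?thesis
              unfolding XF f by (intro conjI b) (use I in simp_all)
          qed
          qed
        qed (use 2 in \<open>simp_all\<close>)
        then obtain T3 s3 where 3: "exec ?d s2 T3 s3" "T3 \<le> 30 * bits M" "?R s3" by (rule runsE)
        show "runs ((''u'' ::= V ''j'' ;; recode k) ;; ?d) s' (340 * (k + 1) * bits M) ?R"
          by (rule runsI[OF exec.Seq[OF exec.Seq[OF 1(1) 2(1)] 3(1)] ], use 1(2) 2(2) 3(2) in \<open>simp add:
              algebra_simps\<close>, rule 3(3))
      next
        assume z: "ev (Elem ''U'' (V ''j'')) s' = 0"
        then have "s ''U'' j = 0" using I U' by simp
        then have XF: "?X (Suc j) = ?X j" unfolding X by simp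
        show "runs Skip s' (340 * (k + 1) * bits M) ?R"
          unfolding XF by (intro runs_chk[where M = M and \<beta> = "bits M"]) (use I in simp_all)
      qed (simp add: algebra_simps)
      then obtain T1 s2 where 1: "exec ?e s' T1 s2" "T1 \<le> 370 * (k + 1) * bits M" "?R s2" by (rule runsE)
      have "Suc j \<le> M" using j N by simp
      then have "runs (''j'' ::= Add (V ''j'') (Const 1)) s2 (20 * bits M) (?I (Suc j))"
        by (intro runs_chk[where M = M and \<beta> = "bits M"]) (use 1 a'(2) in \<open>auto simp: big_def\<close>)
      then obtain T2 s3 where 2: "exec (''j'' ::= Add (V ''j'') (Const 1)) s2 T2 s3" "T2 \<le> 20 * bits M"
          "?I (Suc j) s3"
        by (rule runsE)
      have "runs ?c s' (420 * (k + 1) * bits M) (?I (Suc j))"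
        by (rule runsI[OF exec.Seq[OF 1(1) 2(1)] ], use 1(2) 2(2) in \<open>simp add: algebra_simps\<close>, rule 2(3))
      then show "ev (Sub (V ''N'') (V ''j'')) s' \<noteq> 0 \<and> chk (bits M) (Sub (V ''N'') (V ''j'')) s' \<and>
        runs ?c s' (420 * (k + 1) * bits M) (?I (Suc j))" using I j N fr a' by (auto simp: big_def)
    next
      have "(\<Sum>j<N. 420 * (k + 1) * bits M + 9 * bits M) + 9 * bits M \<le>
       (\<Sum>j<N. 420 * (k + 1) * bits M + 9 * ((k + 1) * bits M)) + 9 * ((k + 1) * bits M)"
        by (intro add_mono sum_mono mult_mono) auto
      also have "\<dots> \<le> 450 * (k + 1) * (N + 1) * bits M" by (simp add: algebra_simps)
      finally show "(\<Sum>j<N. 420 * (k + 1) * bits M + (ecost (Sub (V ''N'') (V ''j''))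
          + wt (Sub (V ''N'') (V ''j''))) * bits M) +
          (ecost (Sub (V ''N'') (V ''j'')) + wt (Sub (V ''N'') (V ''j''))) * bits M \<le> 450 * (k + 1) * (N
              + 1) * bits M"
        unfolding cost_Sub_V .
    qed (use N fr0 a' in \<open>auto simp: big_def\<close>)
  next
    have "10 * bits M + 450 * (k + 1) * (N + 1) * bits M \<le> 500 * (k + 1) * (N + 1) * bits M"
        by (simp add: algebra_simps)
    then show "10 * bits M + 450 * (k + 1) * (N + 1) * bits M \<le> \<tau>" using tau by linarith
  qed
qed

section \<open>Sumsets by integer multiplication\<close>

text \<open>
  \<open>convolve\<close> adds the codes in \<open>a[l1..<h1]\<close> to those in \<open>b[l2..<h2]\<close> and appends the admissible results to \<open>c\<close>
  from position \<open>p\<close> on. The lists hold codes in the common radix \<open>D\<close>; for the multiplication the digits are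
  recoded to the smallest radices \<open>J\<close>, \<open>S\<close> that exclude carries.
\<close>

definition convolve :: "nat \<Rightarrow> string \<Rightarrow> string \<Rightarrow> string \<Rightarrow> com" where
  "convolve k a b c =
    sizes k ;; clear ;; pows ;;
    (''x1'' ::= V ''D'' ;; ''x2'' ::= V ''D'' ;; ''u1'' ::= Const 0 ;; ''u2'' ::= Const 1 ;;
     ''y1'' ::= Const 1 ;; ''y2'' ::= V ''J'' ;; ''y3'' ::= Mul (V ''J'') (V ''S'') ;;
     ''lo'' ::= V ''l1'' ;; ''hi'' ::= V ''h1'') ;;
    scatter k a ''P'' ;;
    (''u1'' ::= V ''U1'' ;; ''u2'' ::= V ''U2'' ;; ''y1'' ::= V ''Y1'' ;; ''y2'' ::= V ''Y2'' ;;
     ''lo'' ::= V ''l2'' ;; ''hi'' ::= V ''h2'') ;;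
    scatter k b ''Q'' ;;
    pack ''P'' ;; pack ''Q'' ;;
    Put ''U'' (Const 0) (Mul (Elem ''P'' (Const 0)) (Elem ''Q'' (Const 0))) ;;
    unpack ;;
    (''x1'' ::= V ''J'' ;; ''x2'' ::= V ''S'' ;; ''u1'' ::= Const 0 ;; ''u2'' ::= Const 1 ;;
     ''y1'' ::= Const 1 ;; ''y2'' ::= V ''D'' ;; ''y3'' ::= Mul (V ''D'') (V ''D'')) ;;
    collect k c"

lemma writes_convolve [simp]:
  "writes (convolve k a b c) = {c, ''N0'', ''N'', ''h'', ''g'', ''e'', ''j'', ''p'', ''r'', ''w'', ''ok'',
      ''c'', ''d'', ''u'', ''f'',
     ''x1'', ''x2'', ''u1'', ''u2'', ''y1'', ''y2'', ''y3'', ''lo'', ''hi'', ''P'', ''Q'', ''U'', ''W''}"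
  by (auto simp: convolve_def)

lemma conv_neq_0_iff: "conv f g x \<noteq> 0 \<longleftrightarrow> (\<exists>a b. x = a + b \<and> f a \<noteq> 0 \<and> g b \<noteq> 0)"
proof
  assume "conv f g x \<noteq> 0"
  then obtain a where "a \<le> x" "f a * g (x - a) \<noteq> 0" by (auto simp: conv_def)
  then show "\<exists>a b. x = a + b \<and> f a \<noteq> 0 \<and> g b \<noteq> 0"
    by (intro exI[of _ a] exI[of _ "x - a"]) auto
next
  assume "\<exists>a b. x = a + b \<and> f a \<noteq> 0 \<and> g b \<noteq> 0"
  then obtain a b where "x = a + b" "f a \<noteq> 0" "g b \<noteq> 0" by blast
  then have "\<exists>i\<in>{..x}. f i * g (x - i) \<noteq> 0" by (intro bexI[of _ a]) auto
  then show "conv f g x \<noteq> 0" by (auto simp: conv_def)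
qed

lemma conv_le: "(\<And>x. f x \<le> 1) \<Longrightarrow> (\<And>x. g x \<le> 1) \<Longrightarrow> conv f g x \<le> x + 1"
proof -
  assume "\<And>x. f x \<le> 1" "\<And>x. g x \<le> 1"
  then have "f a * g (x - a) \<le> 1 * 1" for a by (intro mult_mono) auto
  then have "conv f g x \<le> (\<Sum>a\<le>x. 1)" unfolding conv_def by (intro sum_mono) simp
  then show ?thesis by simp
qed

lemma runs_convolve:
  assumes abc: "a \<in> {''A'', ''L''}" "b \<in> {''A'', ''L''}" "c \<in> {''A'', ''L''}"
    and bd: "bounded M s" and k: "k \<le> M" "1 \<le> M"
    and par: "s ''D'' 0 = D" "s ''J'' 0 = J" "s ''S'' 0 = S" "s ''lim'' 0 = lm"
      "s ''U1'' 0 = U1" "s ''U2'' 0 = U2" "s ''Y1'' 0 = Y1" "s ''Y2'' 0 = Y2"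
      "s ''l1'' 0 = l1" "s ''h1'' 0 = h1" "s ''l2'' 0 = l2" "s ''h2'' 0 = h2" "s ''p'' 0 = p"
    and ge: "1 \<le> D" "1 \<le> J" "1 \<le> S" "l1 \<le> h1" "l2 \<le> h2"
    and M: "4 * (J * S) ^ k \<le> M" "J * S \<le> M" "D * D \<le> M" "(D * D) ^ k \<le> M" "p + 2 * (J * S) ^ k \<le> M"
    and r1: "\<And>x. rval k D D 1 J (J * S) x \<le> M" and r2: "\<And>x. rval k D D Y1 Y2 (J * S) x \<le> M"
    and r3: "\<And>x. rval k J S 1 D (D * D) x \<le> M"
    and sums: "\<And>x y. x \<in> s a ` {l1..<h1} \<Longrightarrow> y \<in> s b ` {l2..<h2} \<Longrightarrow> rok k D D 0 1 lm x \<Longrightarrow> rok k D D U1 U2 lm y \<Longrightarrow>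
      rval k D D 1 J (J * S) x + rval k D D Y1 Y2 (J * S) y < (J * S) ^ k"
    and tau: "20000 * ((k + 1)^2 * ((J * S) ^ k + (h1 - l1) + (h2 - l2)) * bits M ^ 2) \<le> \<tau>"
  shows "runs (convolve k a b c) s \<tau> (\<lambda>s'. bounded M s' \<and> p \<le> s' ''p'' 0
      \<and> s' ''p'' 0 \<le> p + 2 * (J * S) ^ k \<and>
    s' c ` {p..<s' ''p'' 0} = rval k J S 1 D (D * D) ` {z. rok k J S 0 1 lm z \<and>
      (\<exists>x\<in>s a ` {l1..<h1}. \<exists>y\<in>s b ` {l2..<h2}. rok k D D 0 1 lm x \<and> rok k D D U1 U2 lm y \<and>
        z = rval k D D 1 J (J * S) x + rval k D D Y1 Y2 (J * S) y)} \<and>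
    (\<forall>i<p. s' c i = s c i))"
proof -
  define N0 where "N0 = (J * S) ^ k"
  have N0: "1 \<le> N0" "4 * N0 \<le> M" "p + 2 * N0 \<le> M" using ge M by (simp_all add: N0_def)
  have abc': "a \<notin> big" "b \<notin> big" "c \<notin> big"
    "\<And>x. x \<in> {''D'', ''J'', ''S'', ''lim'', ''U1'', ''U2'', ''Y1'', ''Y2'', ''l1'', ''h1'', ''l2'', ''h2'',
      ''N0'', ''N'', ''h'', ''g'', ''e'', ''j'', ''p'', ''r'', ''w'', ''ok'', ''c'', ''d'', ''u'', ''f'',
     ''x1'', ''x2'', ''u1'', ''u2'', ''y1'', ''y2'', ''y3'', ''lo'', ''hi'', ''P'', ''Q'', ''U'', ''W''} \<Longrightarrow>
      a \<noteq> x \<and> x \<noteq> a \<and> b \<noteq> x \<and> x \<noteq> b \<and> c \<noteq> x \<and> x \<noteq> c"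
    using abc by (auto simp: big_def)
  let ?b = "bits M"
  let ?r1 = "rval k D D 1 J (J * S)" and ?r2 = "rval k D D Y1 Y2 (J * S)" and ?r3 = "rval k J S 1 D (D * D)"
  let ?k1 = "rok k D D 0 1 lm" and ?k2 = "rok k D D U1 U2 lm" and ?k3 = "rok k J S 0 1 lm"
  have le: "D \<le> M" "J \<le> M" "S \<le> M" "lm \<le> M" "U1 \<le> M" "U2 \<le> M" "Y1 \<le> M" "Y2 \<le> M" "l1 \<le> M" "h1 \<le> M" "l2 \<le> M"
      "h2 \<le> M"
    using boundedD[OF bd] par by (fastforce simp: big_def)+
  obtain T1 s1 where 1: "exec (sizes k) s T1 s1" "T1 \<le> 100 * (k + 1)^2 * ?b * ?b"
    "bounded M s1" "s1 ''N'' 0 = 2 ^ s1 ''h'' 0" "N0 \<le> s1 ''N'' 0" "s1 ''N'' 0 \<le> 2 * N0"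
    and fr1: "\<And>a. a \<notin> writes (sizes k) \<Longrightarrow> s1 a = s a"
    by (rule runsE[OF runs_sizes[OF bd _ _ _ order_refl]]) (use par ge M in \<open>auto simp: N0_def\<close>)
  define h N where "h = s1 ''h'' 0" and "N = s1 ''N'' 0"
  have N: "N = 2 ^ h" "N0 \<le> N" "N \<le> 2 * N0" "2 * 2 ^ h \<le> M" "N \<le> M" "p + N \<le> M" "1 \<le> N"
    using 1 N0 by (auto simp: h_def N_def)
  obtain T2 s2 where 2: "exec clear s1 T2 s2" "T2 \<le> 100 * (N + 1) * ?b"
    "bounded M s2" "\<And>x. x < N \<Longrightarrow> s2 ''P'' x = 0 \<and> s2 ''Q'' x = 0"
    and fr2: "\<And>a. a \<notin> writes clear \<Longrightarrow> s2 a = s1 a"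
    by (rule runsE[OF runs_clear[OF 1(3) N_def[symmetric] N(5) order_refl]]) blast
  have "s2 ''N'' 0 = 2 ^ h" "s2 ''h'' 0 = h" using fr2 N by (simp_all add: h_def N_def)
  then obtain T3 s3 where 3: "exec pows s2 T3 s3" "T3 \<le> 100 * 2 ^ h * ?b * ?b"
    "bounded M s3" "\<And>i. i \<le> h \<Longrightarrow> s3 ''W'' i = (2 * 2 ^ h) ^ (2 ^ i)"
    and fr3: "\<And>a. a \<notin> writes pows \<Longrightarrow> s3 a = s2 a"
    by (rule runsE[OF runs_pows[OF 2(3) _ _ N(4) order_refl]]) blast+
  have fr3': "s3 x = s x" if "x \<notin> {''N0'', ''N'', ''h'', ''j'', ''P'', ''Q'', ''g'', ''W''}" for x
    using fr1 fr2 fr3 that by simp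
  have p3: "s3 ''D'' 0 = D" "s3 ''J'' 0 = J" "s3 ''S'' 0 = S" "s3 ''lim'' 0 = lm"
      "s3 ''U1'' 0 = U1" "s3 ''U2'' 0 = U2" "s3 ''Y1'' 0 = Y1" "s3 ''Y2'' 0 = Y2"
      "s3 ''l1'' 0 = l1" "s3 ''h1'' 0 = h1" "s3 ''l2'' 0 = l2" "s3 ''h2'' 0 = h2" "s3 ''p'' 0 = p"
      "s3 ''N'' 0 = 2 ^ h" "s3 ''h'' 0 = h"
    using par fr3' fr3 \<open>s2 ''N'' 0 = 2 ^ h\<close> \<open>s2 ''h'' 0 = h\<close> by simp_all
  have z3: "\<And>x. x < N \<Longrightarrow> s3 ''P'' x = 0 \<and> s3 ''Q'' x = 0" using fr3 2 by simp
  let ?c4 = "''x1'' ::= V ''D'' ;; ''x2'' ::= V ''D'' ;; ''u1'' ::= Const 0 ;; ''u2'' ::= Const 1 ;;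
     ''y1'' ::= Const 1 ;; ''y2'' ::= V ''J'' ;; ''y3'' ::= Mul (V ''J'') (V ''S'') ;;
     ''lo'' ::= V ''l1'' ;; ''hi'' ::= V ''h1''"
  have "runs ?c4 s3 (100 * ?b) (\<lambda>s4. bounded M s4 \<and> s4 ''x1'' 0 = D \<and> s4 ''x2'' 0 = D \<and> s4 ''u1'' 0 = 0
      \<and> s4 ''u2'' 0 = 1 \<and>
      s4 ''y1'' 0 = 1 \<and> s4 ''y2'' 0 = J \<and> s4 ''y3'' 0 = J * S \<and> s4 ''lo'' 0 = l1 \<and> s4 ''hi'' 0 = h1)"
    by (rule runs_chk[where M = M and \<beta> = ?b]) (use 3(3) p3 le M k in \<open>simp_all add: big_def\<close>)
  then obtain T4 s4 where 4: "exec ?c4 s3 T4 s4" "T4 \<le> 100 * ?b"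
    "bounded M s4" "s4 ''x1'' 0 = D" "s4 ''x2'' 0 = D" "s4 ''u1'' 0 = 0" "s4 ''u2'' 0 = 1"
    "s4 ''y1'' 0 = 1" "s4 ''y2'' 0 = J" "s4 ''y3'' 0 = J * S" "s4 ''lo'' 0 = l1" "s4 ''hi'' 0 = h1"
    and fr4: "\<And>a. a \<notin> writes ?c4 \<Longrightarrow> s4 a = s3 a"
    by (rule runsE) blast
  have JS: "1 \<le> J * S" "(J * S) ^ k \<le> M" using ge N0 by (simp_all add: N0_def)
  have s4a: "s4 a = s a" "s4 b = s b" using fr4 fr3' abc' by simp_all
  have "s4 ''lim'' 0 = lm" using fr4 p3 by simp
  note r = runs_scatter[OF abc(1) _ 4(3) k 4(11,12) ge(4) le(10) 4(4-7) this 4(8-10) JS r1 order_refl, of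
      "''P''"]
  obtain T5 s5 where 5: "exec (scatter k a ''P'') s4 T5 s5" "T5 \<le> 500 * (k + 1) * (h1 - l1 + 1) * ?b"
    "bounded M s5" "\<forall>x. s5 ''P'' x = (if \<exists>i. l1 \<le> i \<and> i < h1 \<and> ?k1 (s4 a i)
        \<and> ?r1 (s4 a i) = x then 1 else s4 ''P'' x)"
    and fr5: "\<And>x. x \<notin> writes (scatter k a ''P'') \<Longrightarrow> s5 x = s4 x"
    by (rule runsE[OF r]) (simp, elim conjE, blast)
  have p5: "s5 ''D'' 0 = D" "s5 ''J'' 0 = J" "s5 ''S'' 0 = S" "s5 ''lim'' 0 = lm"
      "s5 ''U1'' 0 = U1" "s5 ''U2'' 0 = U2" "s5 ''Y1'' 0 = Y1" "s5 ''Y2'' 0 = Y2"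
      "s5 ''l2'' 0 = l2" "s5 ''h2'' 0 = h2" "s5 ''p'' 0 = p"
      "s5 ''N'' 0 = 2 ^ h" "s5 ''h'' 0 = h" "s5 ''x1'' 0 = D" "s5 ''x2'' 0 = D" "s5 ''y3'' 0 = J * S"
    using p3 fr4 fr5 4 by simp_all
  let ?c6 = "''u1'' ::= V ''U1'' ;; ''u2'' ::= V ''U2'' ;; ''y1'' ::= V ''Y1'' ;; ''y2'' ::= V ''Y2'' ;;
     ''lo'' ::= V ''l2'' ;; ''hi'' ::= V ''h2''"
  have "runs ?c6 s5 (100 * ?b) (\<lambda>s4. bounded M s4 \<and> s4 ''u1'' 0 = U1 \<and> s4 ''u2'' 0 = U2 \<and>
      s4 ''y1'' 0 = Y1 \<and> s4 ''y2'' 0 = Y2 \<and> s4 ''lo'' 0 = l2 \<and> s4 ''hi'' 0 = h2)"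
    by (rule runs_chk[where M = M and \<beta> = ?b]) (use 5(3) p5 le M k in \<open>simp_all add: big_def\<close>)
  then obtain T6 s6 where 6: "exec ?c6 s5 T6 s6" "T6 \<le> 100 * ?b"
    "bounded M s6" "s6 ''u1'' 0 = U1" "s6 ''u2'' 0 = U2"
    "s6 ''y1'' 0 = Y1" "s6 ''y2'' 0 = Y2" "s6 ''lo'' 0 = l2" "s6 ''hi'' 0 = h2"
    and fr6: "\<And>a. a \<notin> writes ?c6 \<Longrightarrow> s6 a = s5 a"
    by (rule runsE) blast
  have p6: "s6 ''x1'' 0 = D" "s6 ''x2'' 0 = D" "s6 ''y3'' 0 = J * S"
      "s6 ''lim'' 0 = lm" using fr6 p5 by simp_all
  have s6b: "s6 b = s b" using fr6 fr5 s4a abc' by simp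
  note r = runs_scatter[OF abc(2) _ 6(3) k 6(8,9) ge(5) le(12) p6(1,2) 6(4,5) p6(4) 6(6,7) p6(3) JS r2
      order_refl, of "''Q''"]
  obtain T7 s7 where 7: "exec (scatter k b ''Q'') s6 T7 s7" "T7 \<le> 500 * (k + 1) * (h2 - l2 + 1) * ?b"
    "bounded M s7" "\<forall>x. s7 ''Q'' x = (if \<exists>i. l2 \<le> i \<and> i < h2 \<and> ?k2 (s6 b i)
        \<and> ?r2 (s6 b i) = x then 1 else s6 ''Q'' x)"
    and fr7: "\<And>x. x \<notin> writes (scatter k b ''Q'') \<Longrightarrow> s7 x = s6 x"
    by (rule runsE[OF r]) (simp, elim conjE, blast)
  define f where "f x = (of_bool (x < N \<and> (\<exists>y\<in>s a ` {l1..<h1}. ?k1 y \<and> ?r1 y = x)) :: nat)" for x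
  define g where "g x = (of_bool (x < N \<and> (\<exists>y\<in>s b ` {l2..<h2}. ?k2 y \<and> ?r2 y = x)) :: nat)" for x
  have P7: "s7 ''P'' x = f x" if "x < 2 ^ h" for x
  proof -
    have "s7 ''P'' x = s5 ''P'' x" using fr7 fr6 by simp
    also have "\<dots> = f x"
      using that 5(4) z3[of x] fr4 unfolding f_def s4a by (auto simp: N(1))
    finally show ?thesis .
  qed
  have Q7: "s7 ''Q'' x = g x" if "x < 2 ^ h" for x
  proof -
    have "s6 ''Q'' x = 0" using fr6 fr5 fr4 z3 N that by simp
    then show "s7 ''Q'' x = g x" using that 7(4) unfolding g_def s6b by (auto simp: N(1))
  qed
  have p7: "s7 ''D'' 0 = D" "s7 ''J'' 0 = J" "s7 ''S'' 0 = S" "s7 ''lim'' 0 = lm" "s7 ''p'' 0 = p"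
      "s7 ''N'' 0 = 2 ^ h" "s7 ''h'' 0 = h"
    using p5 fr6 fr7 by simp_all
  have W7: "s7 ''W'' i = (2 * 2 ^ h) ^ (2 ^ i)" if "i \<le> h" for i
    using fr7 fr6 fr5 fr4 3(4) that by simp
  let ?w = "2 * 2 ^ h :: nat"
  have fg: "f j < ?w" "g j < ?w" for j
  proof -
    have "1 < ?w" using one_le_power[of "2::nat" h] by linarith
    moreover have "f j \<le> 1" "g j \<le> 1" by (simp_all add: f_def g_def)
    ultimately show "f j < ?w" "g j < ?w" by linarith+
  qed
  note r = runs_pack[OF _ 7(3) p7(6,7) N(4,4) W7 fg(1) P7 order_refl, simplified]
  obtain T8 s8 where 8: "exec (pack ''P'') s7 T8 s8" "T8 \<le> 500 * 2 ^ h * ?b * ?b"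
    "bounded M s8" "s8 ''P'' 0 = packv f ?w (2 ^ h) 0"
    and fr8: "\<And>x. x \<notin> writes (pack ''P'') \<Longrightarrow> s8 x = s7 x"
    by (rule runsE[OF r]) blast
  have p8: "s8 ''N'' 0 = 2 ^ h" "s8 ''h'' 0 = h" using fr8 p7 by simp_all
  have W8: "s8 ''W'' i = ?w ^ (2 ^ i)" if "i \<le> h" for i using fr8 W7 that by simp
  have Q8: "s8 ''Q'' x = g x" if "x < 2 ^ h" for x using fr8 Q7 that by simp
  note r = runs_pack[OF _ 8(3) p8 N(4,4) W8 fg(2) Q8 order_refl, simplified]
  obtain T9 s9 where 9: "exec (pack ''Q'') s8 T9 s9" "T9 \<le> 500 * 2 ^ h * ?b * ?b"
    "bounded M s9" "s9 ''Q'' 0 = packv g ?w (2 ^ h) 0"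
    and fr9: "\<And>x. x \<notin> writes (pack ''Q'') \<Longrightarrow> s9 x = s8 x"
    by (rule runsE[OF r]) blast
  have P9: "s9 ''P'' 0 = packv f ?w (2 ^ h) 0" using fr9 8 by simp
  have fgN: "x + y < N" if "f x \<noteq> 0" "g y \<noteq> 0" for x y
  proof -
    have "x + y < (J * S) ^ k" using that sums unfolding f_def g_def
        by (auto simp: of_bool_def split: if_splits)
    then show ?thesis using N(2) unfolding N0_def by linarith
  qed
  have prod: "packv f ?w (2 ^ h) 0 * packv g ?w (2 ^ h) 0 = packv (conv f g) ?w (2 ^ h) 0"
    by (rule packv_mult) (use fgN N(1) in blast)
  have f1: "f x \<le> 1" "g x \<le> 1" for x by (simp_all add: f_def g_def)
  have cf: "conv f g j < ?w" "conv f g j \<le> N" for j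
  proof -
    show "conv f g j \<le> N"
    proof (cases "j < N")
      case True
      then show ?thesis using conv_le[of f g j, OF f1] by linarith
    next
      case False
      then have "conv f g j = 0" using conv_neq_0_iff[of f g j] fgN by blast
      then show ?thesis by simp
    qed
    then show "conv f g j < ?w" using N(1,7) by linarith
  qed
  let ?c10 = "Put ''U'' (Const 0) (Mul (Elem ''P'' (Const 0)) (Elem ''Q'' (Const 0)))"
  have "runs ?c10 s9 (20 * (2 ^ h * ?b)) (\<lambda>s. bounded M s \<and> s ''U'' 0 = packv (conv f g) ?w (2 ^ h) 0)"
  proof (rule runs_chk[where M = M and \<beta> = "2 ^ h * ?b"])
    show "chkc M (2 ^ h * ?b) ?c10 s9"
      using P9 9(4) bits_packv[of f ?w M "2 ^ h" "2 ^ h", OF fg(1) N(4)] bits_packv[of g ?w M "2 ^ h"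
          "2 ^ h", OF fg(2) N(4)]
      by (simp add: big_def)
  qed (use 9 P9 prod in simp_all)
  then obtain T10 s10 where 10: "exec ?c10 s9 T10 s10" "T10 \<le> 20 * (2 ^ h * ?b)"
    "bounded M s10" "s10 ''U'' 0 = packv (conv f g) ?w (2 ^ h) 0"
    and fr10: "\<And>x. x \<notin> writes ?c10 \<Longrightarrow> s10 x = s9 x" by (rule runsE) blast
  have p10: "s10 ''h'' 0 = h" using fr10 fr9 p8 by simp
  have W10: "s10 ''W'' i = ?w ^ (2 ^ i)" if "i \<le> h" for i using fr10 fr9 W8 that by simp
  note r = runs_unpack[OF 10(3) p10 N(4,4) W10 cf(1) 10(4) order_refl]
  obtain T11 s11 where 11: "exec unpack s10 T11 s11" "T11 \<le> 500 * 2 ^ h * ?b * ?b"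
    "bounded M s11" "\<And>x. x < 2 ^ h \<Longrightarrow> s11 ''U'' x = conv f g x"
    and fr11: "\<And>x. x \<notin> writes unpack \<Longrightarrow> s11 x = s10 x"
    by (rule runsE[OF r]) blast+
  have p11: "s11 ''D'' 0 = D" "s11 ''J'' 0 = J" "s11 ''S'' 0 = S" "s11 ''lim'' 0 = lm" "s11 ''p'' 0 = p"
      "s11 ''N'' 0 = N"
    using p7 fr8 fr9 fr10 fr11 N by simp_all
  let ?c12 = "''x1'' ::= V ''J'' ;; ''x2'' ::= V ''S'' ;; ''u1'' ::= Const 0 ;; ''u2'' ::= Const 1 ;;
     ''y1'' ::= Const 1 ;; ''y2'' ::= V ''D'' ;; ''y3'' ::= Mul (V ''D'') (V ''D'')"
  have "runs ?c12 s11 (100 * ?b) (\<lambda>s4. bounded M s4 \<and> s4 ''x1'' 0 = J \<and> s4 ''x2'' 0 = S \<and> s4 ''u1'' 0 = 0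
      \<and> s4 ''u2'' 0 = 1 \<and>
      s4 ''y1'' 0 = 1 \<and> s4 ''y2'' 0 = D \<and> s4 ''y3'' 0 = D * D)"
    by (rule runs_chk[where M = M and \<beta> = ?b]) (use 11(3) p11 le M k in \<open>simp_all add: big_def\<close>)
  then obtain T12 s12 where 12: "exec ?c12 s11 T12 s12" "T12 \<le> 100 * ?b"
    "bounded M s12" "s12 ''x1'' 0 = J" "s12 ''x2'' 0 = S" "s12 ''u1'' 0 = 0" "s12 ''u2'' 0 = 1"
    "s12 ''y1'' 0 = 1" "s12 ''y2'' 0 = D" "s12 ''y3'' 0 = D * D"
    and fr12: "\<And>a. a \<notin> writes ?c12 \<Longrightarrow> s12 a = s11 a"
    by (rule runsE) blast
  have p12: "s12 ''N'' 0 = N" "s12 ''p'' 0 = p" "s12 ''lim'' 0 = lm" using fr12 p11 by simp_all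
  have U12: "s12 ''U'' x = conv f g x" if "x < N" for x using fr12 11(4) N that by simp
  have Ub: "bits (s12 ''U'' x) \<le> ?b" if "x < N" for x
    unfolding U12[OF that] by (rule bits_mono) (use cf N in \<open>meson le_trans\<close>)
  have DD: "1 \<le> D * D" using ge by simp
  note r = runs_collect[OF abc(3) 12(3) k p12(1,2) N(6) Ub 12(4-7) p12(3) 12(8-10) DD M(4) r3 order_refl]
  obtain T13 s13 where 13: "exec (collect k c) s12 T13 s13" "T13 \<le> 500 * (k + 1) * (N + 1) * ?b"
    "bounded M s13" "p \<le> s13 ''p'' 0" "s13 ''p'' 0 \<le> p + N"
    "s13 c ` {p..<s13 ''p'' 0} = ?r3 ` {x. x < N \<and> s12 ''U'' x \<noteq> 0 \<and> ?k3 x}"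
    "\<forall>i<p. s13 c i = s12 c i"
    by (rule runsE[OF r], assumption, elim conjE, blast)
  have s12c: "s12 c = s c" using fr12 fr11 fr10 fr9 fr8 fr7 fr6 fr5 fr4 fr3' abc' by simp
  have set: "{x. x < N \<and> s12 ''U'' x \<noteq> 0 \<and> ?k3 x} = {z. ?k3 z \<and>
      (\<exists>x\<in>s a ` {l1..<h1}. \<exists>y\<in>s b ` {l2..<h2}. ?k1 x \<and> ?k2 y \<and> z = ?r1 x + ?r2 y)}" (is "?L = ?R")
  proof (intro set_eqI iffI)
    fix z assume "z \<in> ?L"
    then have z: "?k3 z" "conv f g z \<noteq> 0" using U12 by auto
    then obtain x y where xy: "z = x + y" "f x \<noteq> 0" "g y \<noteq> 0" using conv_neq_0_iff by blast
    then obtain x' y' where "x' \<in> s a ` {l1..<h1}" "?k1 x'" "?r1 x' = x" "y' \<in> s b ` {l2..<h2}" "?k2 y'"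
        "?r2 y' = y"
      unfolding f_def g_def of_bool_def by (auto split: if_splits)
    then show "z \<in> ?R" using z xy by blast
  next
    fix z assume "z \<in> ?R"
    then obtain x y where xy: "?k3 z" "x \<in> s a ` {l1..<h1}" "y \<in> s b ` {l2..<h2}" "?k1 x" "?k2 y"
        "z = ?r1 x + ?r2 y"
      by blast
    then have lt: "?r1 x + ?r2 y < N" using sums[OF xy(2-5)] N(2) unfolding N0_def by linarith
    then have "f (?r1 x) \<noteq> 0" "g (?r2 y) \<noteq> 0" using xy unfolding f_def g_def by auto
    then have "conv f g z \<noteq> 0" using conv_neq_0_iff xy(6) by blast
    then show "z \<in> ?L" using xy lt U12[of z] by simp
  qed
  have ex: "exec (convolve k a b c) s (T1 + (T2 + (T3 + (T4 + (T5 + (T6 + (T7 + (T8 + (T9 + (T10 + (T11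
      + (T12 + T13)))))))))))) s13"
    unfolding convolve_def
    by (rule exec.Seq[OF 1(1)], rule exec.Seq[OF 2(1)], rule exec.Seq[OF 3(1)], rule exec.Seq[OF 4(1)], rule
        exec.Seq[OF 5(1)], rule exec.Seq[OF 6(1)], rule exec.Seq[OF 7(1)], rule exec.Seq[OF 8(1)], rule
        exec.Seq[OF 9(1)], rule exec.Seq[OF 10(1)], rule exec.Seq[OF 11(1)], rule exec.Seq[OF 12(1) 13(1)])
  have cost: "T1 + (T2 + (T3 + (T4 + (T5 + (T6 + (T7 + (T8 + (T9 + (T10 + (T11 + (T12 + T13))))))))))) \<le> \<tau>"
  proof -
    let ?X = "(k + 1)^2 * (N0 + (h1 - l1) + (h2 - l2)) * ?b ^ 2"
    have X: "x * y * (z1 * z2) \<le> ?X" if "x \<le> (k + 1)^2" "y \<le> N0 + (h1 - l1) + (h2 - l2)" "z1 \<le> ?b"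
        "z2 \<le> ?b" for x y z1 z2
      unfolding power2_eq_square[of ?b] by (intro mult_mono that) auto
    have kk: "k + 1 \<le> (k + 1)^2" "1 \<le> (k + 1)^2" by (simp_all add: power2_eq_square)
    have X1: "(k + 1)^2 * ?b * ?b \<le> ?X" using X[of "(k + 1)^2" 1 ?b ?b] N0 by simp
    have X2: "N * ?b \<le> 2 * ?X"
    proof -
      have "N * ?b \<le> 2 * (1 * N0 * (?b * 1))" using mult_le_mono1[OF N(3), of ?b] by simp
      also have "\<dots> \<le> 2 * ?X" by (intro mult_le_mono2 X) (use kk in auto)
      finally show ?thesis .
    qed
    have X3: "N * ?b * ?b \<le> 2 * ?X"
    proof -
      have "N * ?b * ?b \<le> 2 * (1 * N0 * (?b * ?b))" using mult_le_mono1[OF N(3), of "?b * ?b"]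
          by (simp add: mult.assoc)
      also have "\<dots> \<le> 2 * ?X" by (intro mult_le_mono2 X) (use kk in auto)
      finally show ?thesis .
    qed
    have X4: "?b \<le> ?X" using X[of 1 1 ?b 1] N0 kk by simp
    have X5: "(k + 1) * (h1 - l1 + 1) * ?b \<le> ?X" using X[of "k + 1"
        "h1 - l1 + 1" ?b 1] N0 kk by (simp add: mult.assoc)
    have X6: "(k + 1) * (h2 - l2 + 1) * ?b \<le> ?X" using X[of "k + 1"
        "h2 - l2 + 1" ?b 1] N0 kk by (simp add: mult.assoc)
    have X7: "(k + 1) * (N + 1) * ?b \<le> 3 * ?X"
    proof -
      have "(k + 1) * (N + 1) * ?b \<le> (k + 1) * (3 * N0) * ?b" using N N0 by (intro mult_mono) auto
      also have "\<dots> = 3 * ((k + 1) * N0 * (?b * 1))" by simp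
      also have "\<dots> \<le> 3 * ?X" by (intro mult_le_mono2 X) (use kk in auto)
      finally show ?thesis .
    qed
    have e: "500 * (k + 1) * (h1 - l1 + 1) * ?b = 500 * ((k + 1) * (h1 - l1 + 1) * ?b)"
      "500 * (k + 1) * (h2 - l2 + 1) * ?b = 500 * ((k + 1) * (h2 - l2 + 1) * ?b)"
      "500 * (k + 1) * (N + 1) * ?b = 500 * ((k + 1) * (N + 1) * ?b)"
      "100 * (k + 1)^2 * ?b * ?b = 100 * ((k + 1)^2 * ?b * ?b)"
      "500 * N * ?b * ?b = 500 * (N * ?b * ?b)" "100 * N * ?b * ?b = 100 * (N * ?b * ?b)"
      by (simp_all only: mult.assoc)
    have e': "100 * (N + 1) * ?b = 100 * (N * ?b) + 100 * ?b" by (simp add: algebra_simps)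
    have "T1 + (T2 + (T3 + (T4 + (T5 + (T6 + (T7 + (T8 + (T9 + (T10 + (T11 + (T12 + T13)))))))))))
        \<le> 20000 * ?X"
      using 1(2) 2(2) 3(2) 4(2) 5(2) 6(2) 7(2) 8(2) 9(2) 10(2) 11(2) 12(2) 13(2) X1 X2 X3 X4 X5 X6 X7
      unfolding N(1)[symmetric] e e' by linarith
    then show ?thesis using tau unfolding N0_def by linarith
  qed
  have pl: "s13 ''p'' 0 \<le> p + 2 * (J * S) ^ k" using 13(5) N(3) by (simp add: N0_def)
  show ?thesis
    by (rule runsI[OF ex cost], intro conjI 13(3,4) pl)
      (simp only: 13(6) set, use 13(7) s12c in simp)
qed

section \<open>Reachable vectors\<close>

definition enc :: "nat \<Rightarrow> nat \<Rightarrow> nat \<Rightarrow> (nat \<Rightarrow> nat) \<Rightarrow> (nat \<Rightarrow> nat) \<Rightarrow> nat" where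
  "enc k x1 x2 a s = (\<Sum>i<k. (x1 * x2) ^ i * (a i + x1 * s i))"

lemma digits_nth:
  fixes B :: nat
  assumes "\<And>i. i < k \<Longrightarrow> c i < B" "i < k"
  shows "(\<Sum>j<k. B ^ j * c j) div B ^ i mod B = c i"
  using assms
proof (induction k arbitrary: c i)
  case (Suc k)
  have "(\<Sum>j<Suc k. B ^ j * c j) = c 0 + B * (\<Sum>j<k. B ^ j * c (Suc j))"
    by (simp add: sum.lessThan_Suc_shift sum_distrib_left mult.assoc del: sum.lessThan_Suc)
  moreover have "c 0 < B" using Suc.prems by simp
  ultimately have d: "(\<Sum>j<Suc k. B ^ j * c j) div B = (\<Sum>j<k. B ^ j * c (Suc j))"
    "(\<Sum>j<Suc k. B ^ j * c j) mod B = c 0" by simp_all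
  show ?case
  proof (cases i)
    case 0
    then show ?thesis using d(2) by simp
  next
    case (Suc i')
    have "(\<Sum>j<Suc k. B ^ j * c j) div B ^ i = (\<Sum>j<k. B ^ j * c (Suc j)) div B ^ i'"
      using Suc d(1) by (simp add: div_mult2_eq del: sum.lessThan_Suc)
    then show ?thesis using Suc.IH[of "\<lambda>j. c (Suc j)" i'] Suc.prems Suc by simp
  qed
qed simp

lemma digits_less:
  fixes B :: nat
  assumes "\<And>i. i < k \<Longrightarrow> c i < B"
  shows "(\<Sum>j<k. B ^ j * c j) < B ^ k"
  using assms
proof (induction k)
  case (Suc k)
  have "B ^ k * c k + B ^ k \<le> B ^ k * B"
    using mult_le_mono2[of "Suc (c k)" B "B ^ k"] Suc.prems[of k] by simp
  moreover have "(\<Sum>j<k. B ^ j * c j) < B ^ k" using Suc by simp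
  ultimately show ?case by (simp add: mult.commute)
qed simp

lemma enc_digit_less: "a < x1 \<Longrightarrow> s < x2 \<Longrightarrow> a + x1 * s < x1 * (x2 :: nat)"
  using mult_le_mono2[of "Suc s" x2 x1] by simp

lemma
  assumes "\<And>i. i < k \<Longrightarrow> a i < x1" "\<And>i. i < k \<Longrightarrow> s i < x2"
  shows enc_less: "enc k x1 x2 a s < (x1 * x2) ^ k"
    and dig1_enc: "i < k \<Longrightarrow> dig1 x1 x2 (enc k x1 x2 a s) i = a i"
    and dig2_enc: "i < k \<Longrightarrow> dig2 x1 x2 (enc k x1 x2 a s) i = s i"
proof -
  have c: "a i + x1 * s i < x1 * x2" if "i < k" for i using assms that by (simp add: enc_digit_less)
  show "enc k x1 x2 a s < (x1 * x2) ^ k" unfolding enc_def by (rule digits_less) (rule c)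
  assume i: "i < k"
  let ?y = "enc k x1 x2 a s div (x1 * x2) ^ i"
  have y: "?y mod (x1 * x2) = a i + x1 * s i" unfolding enc_def by (rule digits_nth) (use c i in auto)
  have "?y mod x1 = ?y mod (x1 * x2) mod x1" by (simp add: mod_mod_cancel)
  then show "dig1 x1 x2 (enc k x1 x2 a s) i = a i" using assms(1)[OF i] by (simp add: dig1_def y)
  have "?y mod (x1 * x2) div x1 = ?y div x1 mod x2"
    using assms(1)[OF i] by (simp add: mod_mult2_eq)
  then show "dig2 x1 x2 (enc k x1 x2 a s) i = s i" using assms(1)[OF i] by (simp add: dig2_def y)
qed

lemma
  assumes "\<And>i. i < k \<Longrightarrow> a i < x1" "\<And>i. i < k \<Longrightarrow> s i < x2"
  shows rval_enc: "rval k x1 x2 y1 y2 y3 (enc k x1 x2 a s) = (\<Sum>i<k. y3 ^ i * (y1 * a i + y2 * s i))"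
    and rok_enc: "rok k x1 x2 u1 u2 L (enc k x1 x2 a s) \<longleftrightarrow> (\<forall>i<k. u1 * a i + u2 * s i \<le> L)"
  using dig1_enc[where k = k and a = a and s = s, OF assms] dig2_enc[where k = k and a = a
      and s = s, OF assms] by (auto simp: rval_def rok_def)

lemma rval_recode:
  assumes "\<And>i. i < k \<Longrightarrow> a i < x1" "\<And>i. i < k \<Longrightarrow> s i < x2"
  shows "rval k x1 x2 1 y2 (y2 * z) (enc k x1 x2 a s) = enc k y2 z a s"
  by (subst rval_enc) (use assms in \<open>simp_all add: enc_def\<close>)

lemma enc_add: "enc k x1 x2 a s + enc k x1 x2 a' s' = enc k x1 x2 (\<lambda>i. a i + a' i) (\<lambda>i. s i + s' i)"
  by (simp add: enc_def sum.distrib[symmetric] algebra_simps)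

lemma enc_cong: "(\<And>i. i < k \<Longrightarrow> a i = a' i) \<Longrightarrow> (\<And>i. i < k \<Longrightarrow> s i = s' i) \<Longrightarrow> enc k x1 x2 a s = enc k x1 x2 a' s'"
  by (simp add: enc_def)

lemma rval_le:
  assumes "1 \<le> x1" "1 \<le> x2" "1 \<le> y3"
  shows "rval k x1 x2 y1 y2 y3 u \<le> k * (y3 ^ k * (y1 * x1 + y2 * x2))"
proof -
  have "rval k x1 x2 y1 y2 y3 u \<le> (\<Sum>i<k. y3 ^ k * (y1 * x1 + y2 * x2))"
    unfolding rval_def
    by (intro sum_mono mult_mono add_mono power_increasing)
      (use assms in \<open>auto simp: dig1_def dig2_def less_imp_le\<close>)
  then show ?thesis by simp
qed

definition part_sum :: "('a \<Rightarrow> nat) \<Rightarrow> ('a \<Rightarrow> nat) \<Rightarrow> 'a set \<Rightarrow> nat \<Rightarrow> nat" where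
  "part_sum w \<phi> E i = (\<Sum>e\<in>{e\<in>E. \<phi> e = i}. w e)"

definition reach :: "nat \<Rightarrow> nat \<Rightarrow> ('a \<Rightarrow> nat) \<Rightarrow> ('a \<Rightarrow> nat) \<Rightarrow> nat \<Rightarrow> 'a set \<Rightarrow> nat set" where
  "reach k D v w L E = {enc k D D (part_sum v \<phi> E) (part_sum w \<phi> E) | \<phi>. \<forall>i<k. part_sum w \<phi> E i \<le> L}"

lemma part_sum_le: "finite E \<Longrightarrow> part_sum w \<phi> E i \<le> sum w E"
  unfolding part_sum_def by (intro sum_mono2) auto

lemma part_sum_Un:
  "finite E \<Longrightarrow> finite E' \<Longrightarrow> E \<inter> E' = {} \<Longrightarrow> part_sum w \<phi> (E \<union> E') i = part_sum w \<phi> E i + part_sum w \<phi> E' i"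
  unfolding part_sum_def by (subst sum.union_disjoint[symmetric]) (auto intro: sum.cong)

lemma part_sum_cong: "(\<And>e. e \<in> E \<Longrightarrow> \<phi> e = \<psi> e) \<Longrightarrow> part_sum w \<phi> E i = part_sum w \<psi> E i"
  unfolding part_sum_def by (intro sum.cong) auto

lemma part_sum_cong_weight: "(\<And>e. e \<in> E \<Longrightarrow> v e = w e) \<Longrightarrow> part_sum v \<phi> E i = part_sum w \<phi> E i"
  unfolding part_sum_def by (intro sum.cong) auto

lemma part_sum_linear: "part_sum (\<lambda>e. a * v e + b * w e) \<phi> E i = a * part_sum v \<phi> E i
    + b * part_sum w \<phi> E i"
  unfolding part_sum_def by (simp add: sum.distrib sum_distrib_left)

lemma reach_digits:
  assumes "x \<in> reach k D v w L E" "finite E" "sum v E < D" "L < D"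
  obtains \<phi> where "x = enc k D D (part_sum v \<phi> E) (part_sum w \<phi> E)" "\<forall>i<k. part_sum w \<phi> E i \<le> L"
    "\<forall>i<k. part_sum v \<phi> E i < D" "\<forall>i<k. part_sum w \<phi> E i < D"
  using assms part_sum_le[OF assms(2), of v] unfolding reach_def by (fastforce intro: le_less_trans)

context
  fixes k D J S L :: nat and v w :: "'a \<Rightarrow> nat" and E E' :: "'a set" and r2 :: "nat \<Rightarrow> nat"
      and k2 :: "nat \<Rightarrow> bool" and Y
  assumes fin: "finite E" "finite E'" "E \<inter> E' = {}"
    and J: "sum v (E \<union> E') < J" "J \<le> D" and S: "2 * L < S" "S \<le> D"
    and Y: "{r2 y | y. y \<in> Y \<and> k2 y} =
      {enc k J S (part_sum v \<phi> E') (part_sum w \<phi> E') | \<phi>. \<forall>i<k. part_sum w \<phi> E' i \<le> L}"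
begin

lemma sum_v_less: "sum v E < J" "sum v E' < J" "part_sum v \<phi> E i + part_sum v \<psi> E' i < J"
proof -
  have "sum v (E \<union> E') = sum v E + sum v E'" using fin by (rule sum.union_disjoint)
  then show "sum v E < J" "sum v E' < J" "part_sum v \<phi> E i + part_sum v \<psi> E' i < J"
    using J part_sum_le[OF fin(1), of v \<phi> i] part_sum_le[OF fin(2), of v \<psi> i] by linarith+
qed

lemma reach_recode:
  assumes "x \<in> reach k D v w L E"
  obtains \<phi> where "rval k D D 1 J (J * S) x = enc k J S (part_sum v \<phi> E) (part_sum w \<phi> E)"
     "\<forall>i<k. part_sum w \<phi> E i \<le> L"
proof -
  obtain \<phi> where f: "x = enc k D D (part_sum v \<phi> E) (part_sum w \<phi> E)" "\<forall>i<k. part_sum w \<phi> E i \<le> L"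
    "\<forall>i<k. part_sum v \<phi> E i < D" "\<forall>i<k. part_sum w \<phi> E i < D"
    by (rule reach_digits[OF assms fin(1)]) (use sum_v_less J S in auto)
  show ?thesis by (rule that[OF _ f(2)], unfold f(1), rule rval_recode) (use f(3,4) in auto)
qed

lemma second_recode:
  assumes "y \<in> Y" "k2 y"
  obtains \<phi> where "r2 y = enc k J S (part_sum v \<phi> E') (part_sum w \<phi> E')" "\<forall>i<k. part_sum w \<phi> E' i \<le> L"
proof -
  have "r2 y \<in> {r2 y | y. y \<in> Y \<and> k2 y}" using assms by blast
  then show ?thesis unfolding Y using that by blast
qed

lemma reach_sums_less:
  assumes "x \<in> reach k D v w L E" "y \<in> Y" "k2 y"
  shows "rval k D D 1 J (J * S) x + r2 y < (J * S) ^ k"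
proof -
  obtain \<phi> where f: "rval k D D 1 J (J * S) x = enc k J S (part_sum v \<phi> E) (part_sum w \<phi> E)"
     "\<forall>i<k. part_sum w \<phi> E i \<le> L" by (rule reach_recode[OF assms(1)])
  obtain \<psi> where g: "r2 y = enc k J S (part_sum v \<psi> E') (part_sum w \<psi> E')" "\<forall>i<k. part_sum w \<psi> E' i \<le> L"
    by (rule second_recode[OF assms(2,3)])
  have "part_sum w \<phi> E i + part_sum w \<psi> E' i < S" if "i < k" for i
    using f(2)[rule_format, OF that] g(2)[rule_format, OF that] S by linarith
  then show ?thesis unfolding f(1) g(1) enc_add by (intro enc_less sum_v_less) auto
qed

lemma reach_convolve:
  "rval k J S 1 D (D * D) ` {z. rok k J S 0 1 L z \<and> (\<exists>x\<in>reach k D v w L E. \<exists>y\<in>Y.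
      rok k D D 0 1 L x \<and> k2 y \<and> z = rval k D D 1 J (J * S) x + r2 y)} = reach k D v w L (E \<union> E')"
  (is "?f ` ?Z = _")
proof (intro set_eqI iffI)
  fix u assume "u \<in> ?f ` ?Z"
  then obtain x y where xy: "u = ?f (rval k D D 1 J (J * S) x + r2 y)"
      "rok k J S 0 1 L (rval k D D 1 J (J * S) x + r2 y)"
    "x \<in> reach k D v w L E" "y \<in> Y" "k2 y" by blast
  obtain \<phi> where f: "rval k D D 1 J (J * S) x = enc k J S (part_sum v \<phi> E) (part_sum w \<phi> E)"
     "\<forall>i<k. part_sum w \<phi> E i \<le> L" by (rule reach_recode[OF xy(3)])
  obtain \<psi> where g: "r2 y = enc k J S (part_sum v \<psi> E') (part_sum w \<psi> E')" "\<forall>i<k. part_sum w \<psi> E' i \<le> L"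
    by (rule second_recode[OF xy(4,5)])
  define \<chi> where "\<chi> e = (if e \<in> E then \<phi> e else \<psi> e)" for e
  have "part_sum q \<phi> E i = part_sum q \<chi> E i" for q i by (rule part_sum_cong) (simp add: \<chi>_def)
  moreover have "part_sum q \<psi> E' i = part_sum q \<chi> E' i" for q i
    by (rule part_sum_cong) (use fin in \<open>auto simp: \<chi>_def\<close>)
  ultimately have c: "part_sum q \<phi> E i + part_sum q \<psi> E' i = part_sum q \<chi> (E \<union> E') i" for q i
    by (simp add: part_sum_Un[OF fin])
  have d: "part_sum v \<chi> (E \<union> E') i < J" "i < k \<Longrightarrow> part_sum w \<chi> (E \<union> E') i < S" for i
  proof -
    show "part_sum v \<chi> (E \<union> E') i < J" unfolding c[symmetric] by (rule sum_v_less)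
    assume "i < k"
    then show "part_sum w \<chi> (E \<union> E') i < S" using f(2) g(2) S c[of w i] by fastforce
  qed
  have z: "rval k D D 1 J (J * S) x + r2 y = enc k J S (part_sum v \<chi> (E \<union> E')) (part_sum w \<chi> (E \<union> E'))"
    unfolding f(1) g(1) enc_add c ..
  have "\<forall>i<k. part_sum w \<chi> (E \<union> E') i \<le> L" using xy(2) unfolding z by (subst (asm) rok_enc) (use d in auto)
  moreover have "u = enc k D D (part_sum v \<chi> (E \<union> E')) (part_sum w \<chi> (E \<union> E'))"
    unfolding xy(1) z by (rule rval_recode) (use d in auto)
  ultimately show "u \<in> reach k D v w L (E \<union> E')" unfolding reach_def by blast
next
  fix u assume "u \<in> reach k D v w L (E \<union> E')"
  then obtain \<phi> where f: "u = enc k D D (part_sum v \<phi> (E \<union> E')) (part_sum w \<phi> (E \<union> E'))"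
    "\<And>i. i < k \<Longrightarrow> part_sum w \<phi> (E \<union> E') i \<le> L" unfolding reach_def by blast
  note un = part_sum_Un[OF fin]
  have le: "part_sum w \<phi> E i \<le> L" "part_sum w \<phi> E' i \<le> L" if "i < k" for i using f(2)[rule_format, OF that]
      by (simp_all add: un)
  define x where "x = enc k D D (part_sum v \<phi> E) (part_sum w \<phi> E)"
  have x: "x \<in> reach k D v w L E" unfolding x_def reach_def using le by blast
  have dx: "part_sum v \<phi> E i < D" "i < k \<Longrightarrow> part_sum w \<phi> E i < D" for i
    using sum_v_less(3)[of \<phi> i \<phi>] J S le[of i] by linarith+
  have "enc k J S (part_sum v \<phi> E') (part_sum w \<phi> E') \<in> {r2 y | y. y \<in> Y
      \<and> k2 y}" unfolding Y using le by blast
  then obtain y where y: "y \<in> Y" "k2 y" "r2 y = enc k J S (part_sum v \<phi> E') (part_sum w \<phi> E')" by auto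
  have rx: "rval k D D 1 J (J * S) x = enc k J S (part_sum v \<phi> E) (part_sum w \<phi> E)"
    unfolding x_def by (rule rval_recode) (use dx in auto)
  have z: "rval k D D 1 J (J * S) x + r2 y = enc k J S (part_sum v \<phi> (E \<union> E')) (part_sum w \<phi> (E \<union> E'))"
    unfolding rx y(3) enc_add by (intro enc_cong) (simp_all add: un)
  have d: "part_sum v \<phi> (E \<union> E') i < J" "i < k \<Longrightarrow> part_sum w \<phi> (E \<union> E') i < S" for i
    using sum_v_less(3)[of \<phi> i \<phi>] f(2)[rule_format, of i] S by (simp_all add: un)
  have "rok k J S 0 1 L (rval k D D 1 J (J * S) x + r2 y)" unfolding z by (subst rok_enc) (use d f in auto)
  moreover have "rok k D D 0 1 L x" unfolding x_def by (subst rok_enc) (use dx le in auto)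
  ultimately have "rval k D D 1 J (J * S) x + r2 y \<in> ?Z" using x y by blast
  moreover have "u = ?f (rval k D D 1 J (J * S) x + r2 y)"
    unfolding z f(1) by (rule rval_recode[symmetric]) (use d in auto)
  ultimately show "u \<in> ?f ` ?Z" by blast
qed

end

lemma recode_image_reach:
  assumes "finite E" "sum v E < J" "J \<le> D" "L < S" "S \<le> D"
  shows "{rval k D D 1 J (J * S) y | y. y \<in> reach k D v w L E \<and> rok k D D 0 1 L y} =
      {enc k J S (part_sum v \<phi> E) (part_sum w \<phi> E) | \<phi>. \<forall>i<k. part_sum w \<phi> E i \<le> L}"
proof -
  have 1: "rval k D D 1 J (J * S) (enc k D D (part_sum v \<phi> E) (part_sum w \<phi> E))
      = enc k J S (part_sum v \<phi> E) (part_sum w \<phi> E)"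
    "rok k D D 0 1 L (enc k D D (part_sum v \<phi> E) (part_sum w \<phi> E))" if "\<forall>i<k. part_sum w \<phi> E i \<le> L" for \<phi>
  proof -
    have d: "part_sum v \<phi> E i < D" "i < k \<Longrightarrow> part_sum w \<phi> E i < D" for i
      using part_sum_le[OF assms(1), of v \<phi> i] assms that by fastforce+
    show "rval k D D 1 J (J * S) (enc k D D (part_sum v \<phi> E) (part_sum w \<phi> E))
        = enc k J S (part_sum v \<phi> E) (part_sum w \<phi> E)"
      by (rule rval_recode) (use d in auto)
    show "rok k D D 0 1 L (enc k D D (part_sum v \<phi> E) (part_sum w \<phi> E))"
        by (subst rok_enc) (use d that in auto)
  qed
  show ?thesis unfolding reach_def using 1 by (auto; metis)
qed

text \<open>All elements of \<open>E\<close> are congruent to \<open>l\<close> modulo \<open>b\<close>, so the sum of a part is \<open>l\<close> times its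
  cardinality plus \<open>b\<close> times the sum of the quotients.\<close>

lemma reach_residue_class:
  assumes "finite E" "card E < D" "t < D" "0 < b" and l: "\<And>e. e \<in> E \<Longrightarrow> e mod b = l"
  shows "{rval k D D l b (1 * S) y | y. y \<in> reach k D (\<lambda>_. 1) (\<lambda>e. e div b) (t div b) E
      \<and> rok k D D l b t y} =
      {enc k 1 S (part_sum (\<lambda>_. 0) \<phi> E) (part_sum id \<phi> E) | \<phi>. \<forall>i<k. part_sum id \<phi> E i \<le> t}"
proof -
  let ?c = "\<lambda>\<phi>. enc k D D (part_sum (\<lambda>_. 1) \<phi> E) (part_sum (\<lambda>e. e div b) \<phi> E)"
  have id: "part_sum id \<phi> E i = l * part_sum (\<lambda>_. 1) \<phi> E i + b * part_sum (\<lambda>e. e div b) \<phi> E i" for \<phi> i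
    unfolding part_sum_linear[symmetric]
  proof (rule part_sum_cong_weight)
    fix e assume "e \<in> E"
    then show "id e = l * 1 + b * (e div b)" using l[of e] mod_mult_div_eq[of e b] by simp
  qed
  have z: "part_sum (\<lambda>_. 0) \<phi> E i = 0" for \<phi> i by (simp add: part_sum_def)
  have div: "\<forall>i<k. part_sum (\<lambda>e. e div b) \<phi> E i \<le> t div b" if "\<forall>i<k. part_sum id \<phi> E i \<le> t" for \<phi>
  proof (intro allI impI)
    fix i assume "i < k"
    then have "b * part_sum (\<lambda>e. e div b) \<phi> E i \<le> t" using that id[of \<phi> i] by fastforce
    then show "part_sum (\<lambda>e. e div b) \<phi> E i \<le> t div b"
      using assms(4) by (simp add: less_eq_div_iff_mult_less_eq mult.commute)
  qed
  have 1: "rval k D D l b (1 * S) (?c \<phi>) = enc k 1 S (part_sum (\<lambda>_. 0) \<phi> E) (part_sum id \<phi> E)"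
    "rok k D D l b t (?c \<phi>) \<longleftrightarrow> (\<forall>i<k. part_sum id \<phi> E i \<le> t)"
    if "\<forall>i<k. part_sum (\<lambda>e. e div b) \<phi> E i \<le> t div b" for \<phi>
  proof -
    have d: "part_sum (\<lambda>_. 1) \<phi> E i < D" "i < k \<Longrightarrow> part_sum (\<lambda>e. e div b) \<phi> E i < D" for i
    proof -
      show "part_sum (\<lambda>_. 1) \<phi> E i < D"
        using part_sum_le[OF assms(1), of "\<lambda>_. 1" \<phi> i] assms(2) by simp
      assume "i < k"
      then have "part_sum (\<lambda>e. e div b) \<phi> E i \<le> t div b" using that by blast
      then show "part_sum (\<lambda>e. e div b) \<phi> E i < D" using assms(3) div_le_dividend[of t b] by linarith
    qed
    show "rval k D D l b (1 * S) (?c \<phi>) = enc k 1 S (part_sum (\<lambda>_. 0) \<phi> E) (part_sum id \<phi> E)"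
      by (subst rval_enc) (use d in \<open>auto simp: enc_def id z\<close>)
    show "rok k D D l b t (?c \<phi>) \<longleftrightarrow> (\<forall>i<k. part_sum id \<phi> E i \<le> t)"
      by (subst rok_enc) (use d in \<open>auto simp: id\<close>)
  qed
  show ?thesis (is "?A = ?B")
  proof (intro set_eqI iffI)
    fix x assume "x \<in> ?A"
    then obtain \<phi> where f: "x = rval k D D l b (1 * S) (?c \<phi>)"
        "\<forall>i<k. part_sum (\<lambda>e. e div b) \<phi> E i \<le> t div b"
      "rok k D D l b t (?c \<phi>)" unfolding reach_def by blast
    then show "x \<in> ?B" unfolding 1[OF f(2)] by blast
  next
    fix x assume "x \<in> ?B"
    then obtain \<phi> where f: "x = enc k 1 S (part_sum (\<lambda>_. 0) \<phi> E) (part_sum id \<phi> E)"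
        "\<forall>i<k. part_sum id \<phi> E i \<le> t"
      by blast
    note d = div[OF f(2)]
    have "?c \<phi> \<in> reach k D (\<lambda>_. 1) (\<lambda>e. e div b) (t div b) E" unfolding reach_def using d by blast
    then show "x \<in> ?A" unfolding f(1) 1(1)[OF d, symmetric] using 1(2)[OF d] f(2) by blast
  qed
qed

lemma reach_empty: "reach k D v w L {} = {0}"
  by (auto simp: reach_def part_sum_def enc_def)

lemma reach_singleton:
  assumes "w e \<le> L"
  shows "reach k D (\<lambda>_. 1) w L {e} = insert 0 ((\<lambda>i. (D * D) ^ i * (1 + D * w e)) ` {..<k})"
proof -
  have p: "part_sum u \<phi> {e} i = (if \<phi> e = i then u e else 0)" for u :: "'a \<Rightarrow> nat" and \<phi> i
    by (auto simp: part_sum_def conj_commute cong: conj_cong intro!: sum.neutral)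
  have c: "enc k D D (part_sum (\<lambda>_. 1) \<phi> {e}) (part_sum w \<phi> {e}) =
      (if \<phi> e < k then (D * D) ^ \<phi> e * (1 + D * w e) else 0)" for \<phi>
  proof -
    have "enc k D D (part_sum (\<lambda>_. 1) \<phi> {e}) (part_sum w \<phi> {e}) =
      (\<Sum>i<k. if i = \<phi> e then (D * D) ^ i * (1 + D * w e) else 0)"
      unfolding enc_def p by (intro sum.cong) auto
    also have "\<dots> = (if \<phi> e < k then (D * D) ^ \<phi> e * (1 + D * w e) else 0)" by (simp add: sum.delta)
    finally show ?thesis .
  qed
  show ?thesis
  proof (intro set_eqI iffI)
    fix x assume "x \<in> reach k D (\<lambda>_. 1) w L {e}"
    then show "x \<in> insert 0 ((\<lambda>i. (D * D) ^ i * (1 + D * w e)) ` {..<k})"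
      unfolding reach_def c by auto
  next
    fix x assume "x \<in> insert 0 ((\<lambda>i. (D * D) ^ i * (1 + D * w e)) ` {..<k})"
    then obtain i where "x = (if i < k then (D * D) ^ i * (1 + D * w e) else 0)" by fastforce
    then have "x = enc k D D (part_sum (\<lambda>_. 1) (\<lambda>_. i) {e}) (part_sum w (\<lambda>_. i) {e})" by (simp only: c)
    moreover have "\<forall>j<k. part_sum w (\<lambda>_. i) {e} j \<le> L" using assms by (simp add: p)
    ultimately show "x \<in> reach k D (\<lambda>_. 1) w L {e}" unfolding reach_def by blast
  qed
qed

lemma k_subset_sum_iff_reach:
  assumes "finite Z" "length ts = k" "ts \<noteq> []" "Max (set ts) < D"
  shows "k_subset_sum Z ts \<longleftrightarrow>
    enc k D D (\<lambda>_. 0) (\<lambda>i. ts ! i) \<in> reach k D (\<lambda>_. 0) id (Max (set ts)) {z \<in> Z. z \<le> Max (set ts)}"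
proof -
  let ?t = "Max (set ts)" and ?X = "{z \<in> Z. z \<le> Max (set ts)}"
  have t: "ts ! i \<le> ?t" if "i < k" for i using that assms by (intro Max_ge) auto
  have D: "0 < D" using assms(4) by linarith
  have z: "part_sum (\<lambda>_. 0) \<phi> ?X = (\<lambda>_. 0)" for \<phi> by (rule ext) (simp add: part_sum_def)
  have r: "enc k D D (\<lambda>_. 0) (\<lambda>i. ts ! i) \<in> reach k D (\<lambda>_. 0) id ?t ?X \<longleftrightarrow>
     (\<exists>\<phi>. \<forall>i<k. part_sum id \<phi> ?X i = ts ! i)" (is "?L \<longleftrightarrow> ?R")
  proof
    assume ?L
    then obtain \<phi> where f: "enc k D D (\<lambda>_. 0) (\<lambda>i. ts ! i) = enc k D D (\<lambda>_. 0) (part_sum id \<phi> ?X)"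
      "\<forall>i<k. part_sum id \<phi> ?X i \<le> ?t" unfolding reach_def z by blast
    have "part_sum id \<phi> ?X i = ts ! i" if "i < k" for i
    proof -
      have "dig2 D D (enc k D D (\<lambda>_. 0) (\<lambda>i. ts ! i)) i = ts ! i"
        by (rule dig2_enc) (use D t le_less_trans[OF t assms(4)] that in auto)
      moreover have "dig2 D D (enc k D D (\<lambda>_. 0) (part_sum id \<phi> ?X)) i = part_sum id \<phi> ?X i"
        by (rule dig2_enc) (use D le_less_trans[OF f(2)[rule_format] assms(4)] that in auto)
      ultimately show ?thesis using f(1) by simp
    qed
    then show ?R by blast
  next
    assume ?R
    then obtain \<phi> where f: "\<forall>i<k. part_sum id \<phi> ?X i = ts ! i" by blast
    then have "enc k D D (\<lambda>_. 0) (\<lambda>i. ts ! i) = enc k D D (part_sum (\<lambda>_. 0) \<phi> ?X) (part_sum id \<phi> ?X)"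
      unfolding z by (intro enc_cong) auto
    moreover have "\<forall>i<k. part_sum id \<phi> ?X i \<le> ?t" using f t by simp
    ultimately show ?L unfolding reach_def by blast
  qed
  have "k_subset_sum Z ts \<longleftrightarrow> ?R"
  proof
    assume "k_subset_sum Z ts"
    then obtain P where P: "disjoint_family_on P {..<k}" "\<And>i. i < k \<Longrightarrow> P i \<subseteq> Z" "\<And>i. i < k \<Longrightarrow> \<Sum>(P i) = ts ! i"
      unfolding k_subset_sum_def assms(2) by blast
    define \<phi> where "\<phi> e = (if \<exists>i<k. e \<in> P i then THE i. i < k \<and> e \<in> P i else k)" for e
    have f: "\<phi> e = i" if "i < k" "e \<in> P i" for e i
    proof -
      have "(THE i. i < k \<and> e \<in> P i) = i"
        by (rule the_equality) (use that P(1) in \<open>auto simp: disjoint_family_on_def\<close>)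
      then show ?thesis using that by (auto simp: \<phi>_def)
    qed
    have f': "e \<in> P i" if "\<phi> e = i" "i < k" for e i
    proof (cases "\<exists>i<k. e \<in> P i")
      case True
      then show ?thesis using f that by blast
    next
      case False
      then have "\<phi> e = k" unfolding \<phi>_def by (rule if_not_P)
      then show ?thesis using that by simp
    qed
    have "part_sum id \<phi> ?X i = ts ! i" if "i < k" for i
    proof -
      have "finite (P i)" using P(2)[OF that] assms(1) finite_subset by blast
      then have "e \<le> ts ! i" if "e \<in> P i" for e
        using member_le_sum[of e "P i" id] that P(3)[OF \<open>i < k\<close>] by simp
      then have le: "e \<le> ?t" if "e \<in> P i" for e using that t[OF \<open>i < k\<close>] le_trans by blast
      have "{e \<in> ?X. \<phi> e = i} = P i"
      proof (intro set_eqI iffI)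
        fix e assume "e \<in> {e \<in> ?X. \<phi> e = i}"
        then show "e \<in> P i" using f'[OF _ that] by blast
      next
        fix e assume "e \<in> P i"
        then show "e \<in> {e \<in> ?X. \<phi> e = i}" using f[OF that] P(2)[OF that] le by blast
      qed
      then show ?thesis using P(3)[OF that] by (simp add: part_sum_def)
    qed
    then show ?R by blast
  next
    assume ?R
    then obtain \<phi> where f: "\<forall>i<k. part_sum id \<phi> ?X i = ts ! i" by blast
    then show "k_subset_sum Z ts"
      unfolding k_subset_sum_def assms(2)
      by (intro exI[of _ "\<lambda>i. {e \<in> ?X. \<phi> e = i}"]) (auto simp: disjoint_family_on_def part_sum_def)
  qed
  then show ?thesis using r by blast
qed

text \<open>The divide and conquer tree over a list of length \<open>q\<close> is numbered like a binary heap: the leaves are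
  \<open>q, \<dots>, 2q - 1\<close> and the children of \<open>v < q\<close> are \<open>2v\<close> and \<open>2v + 1\<close>.\<close>

function items :: "'a list \<Rightarrow> nat \<Rightarrow> 'a set" where
  "items xs v = (if v = 0 \<or> length xs
      \<le> v then {xs ! (v - length xs)} else items xs (2 * v) \<union> items xs (2 * v + 1))"
  by auto
termination by (relation "measure (\<lambda>(xs, v). length xs - v)") auto

declare items.simps [simp del]

lemma items_leaf: "length xs \<le> v \<Longrightarrow> items xs v = {xs ! (v - length xs)}"
  by (subst items.simps) simp

lemma items_node: "0 < v \<Longrightarrow> v < length xs \<Longrightarrow> items xs v = items xs (2 * v) \<union> items xs (2 * v + 1)"
  by (subst items.simps) simp

lemma finite_items [simp]: "finite (items xs v)"
  by (induction xs v rule: items.induct) (subst items.simps, simp)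

lemma items_level:
  assumes "distinct xs" "1 \<le> a" "a \<le> length xs"
  shows "(\<Union>v\<in>{a..<2 * a}. items xs v) = set xs \<and> disjoint_family_on (items xs) {a..<2 * a}"
  using assms(3,2)
proof (induction a rule: inc_induct)
  case base
  let ?q = "length xs"
  have l: "items xs v = {xs ! (v - ?q)}" if "v \<in> {?q..<2 * ?q}" for v using that by (simp add: items_leaf)
  have "(\<Union>v\<in>{?q..<2 * ?q}. items xs v) = (\<Union>v\<in>{?q..<2 * ?q}. {xs ! (v - ?q)})" using l by simp
  also have "\<dots> = (!) xs ` ((\<lambda>v. v - ?q) ` {?q..<2 * ?q})" by auto
  also have "(\<lambda>v. v - ?q) ` {?q..<2 * ?q} = {..<?q}"
    by (auto simp: image_iff intro!: bexI[of _ "_ + ?q"])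
  also have "(!) xs ` {..<?q} = set xs" by (auto simp: set_conv_nth)
  finally show ?case using assms(1) l by (auto simp: disjoint_family_on_def nth_eq_iff_index_eq)
next
  case (step a)
  let ?E = "items xs"
  from step.IH have IH: "(\<Union>v\<in>{Suc a..<2 * Suc a}. ?E v) = set xs"
      "disjoint_family_on ?E {Suc a..<2 * Suc a}" by simp_all
  have n: "?E a = ?E (2 * a) \<union> ?E (2 * a + 1)" using step by (intro items_node) auto
  have s: "{a..<2 * a} = insert a {Suc a..<2 * a}"
      "{Suc a..<2 * Suc a} = {Suc a..<2 * a} \<union> {2 * a, 2 * a + 1}"
    using step by auto
  have "(\<Union>v\<in>{a..<2 * a}. ?E v) = (\<Union>v\<in>{Suc a..<2 * Suc a}. ?E v)" unfolding s by (simp add: n Un_ac)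
  moreover have "disjoint_family_on ?E {a..<2 * a}"
  proof -
    have "?E v \<inter> ?E w = {}" if "v \<in> {Suc a..<2 * Suc a}" "w \<in> {Suc a..<2 * Suc a}" "v \<noteq> w" for v w
      using IH(2) that by (simp add: disjoint_family_on_def)
    then have "?E v \<inter> ?E a = {}" if "v \<in> {Suc a..<2 * a}" for v
      using that unfolding n by (simp add: Int_Un_distrib)
    moreover have "disjoint_family_on ?E {Suc a..<2 * a}"
      using IH(2) by (rule disjoint_family_on_mono[rotated]) auto
    ultimately show ?thesis unfolding s by (auto simp: disjoint_family_on_def Int_commute)
  qed
  ultimately show ?case using IH by simp
qed

lemma items_root: "distinct xs \<Longrightarrow> xs \<noteq> [] \<Longrightarrow> items xs 1 = set xs"
  using items_level[of xs 1] by (simp add: Suc_leI numeral_2_eq_2)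

lemma items_disjoint:
  assumes "distinct xs" "0 < v" "v < length xs"
  shows "items xs (2 * v) \<inter> items xs (2 * v + 1) = {}"
proof -
  have "disjoint_family_on (items xs) {v + 1..<2 * (v + 1)}"
    using items_level[of xs "v + 1"] assms by simp
  then show ?thesis using assms by (auto simp: disjoint_family_on_def)
qed

lemma card_items:
  "0 < v \<Longrightarrow> v < 2 * length xs \<Longrightarrow> card (items xs v) * v \<le> 2 * length xs"
proof (induction xs v rule: items.induct)
  case (1 xs v)
  show ?case
  proof (cases "length xs \<le> v")
    case True
    then show ?thesis using 1 by (simp add: items_leaf)
  next
    case False
    have "card (items xs v) * v \<le> (card (items xs (2 * v)) + card (items xs (2 * v + 1))) * v"
      using False 1 by (intro mult_le_mono1) (simp add: items_node card_Un_le)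
    also have "\<dots> \<le> 2 * length xs" using 1 False by (simp add: algebra_simps)
    finally show ?thesis .
  qed
qed

lemma card_items_le: "0 < v \<Longrightarrow> v < 2 * length xs \<Longrightarrow> card (items xs v) \<le> 2 * length xs div v"
  using card_items[of v xs] by (simp add: less_eq_div_iff_mult_less_eq)

section \<open>Divide and conquer within a residue class\<close>

lemma bounds_from_radix:
  assumes M: "4 * (k + 1) * D ^ (2 * k + 3) \<le> M" and D: "1 \<le> D"
  shows "4 * (k + 1) * (D * (D * D) * (D * D) ^ k) \<le> M"
    and "D * D \<le> M" "(D * D) ^ k \<le> M" "k \<le> M" "1 \<le> M" "4 \<le> M" "D * (2 * (D * D) ^ k) \<le> M" "4 * D \<le> M"
    and "J \<le> D \<Longrightarrow> S \<le> D \<Longrightarrow> (J * S) ^ k \<le> (D * D) ^ k \<and> 4 * (J * S) ^ k \<le> M \<and> J * S \<le> M"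
    and "1 \<le> x1 \<Longrightarrow> 1 \<le> x2 \<Longrightarrow> 1 \<le> y3 \<Longrightarrow> x1 \<le> D \<Longrightarrow> x2 \<le> D \<Longrightarrow> y1 \<le> D \<Longrightarrow> y2 \<le> D \<Longrightarrow> y3 \<le> D * D \<Longrightarrow>
      rval k x1 x2 y1 y2 y3 u \<le> M"
proof -
  have e: "D ^ (2 * k + 3) = D * (D * D) * (D * D) ^ k"
    by (simp add: power_add power_mult power2_eq_square numeral_3_eq_3)
  show M': "4 * (k + 1) * (D * (D * D) * (D * D) ^ k) \<le> M" using M unfolding e .
  have P: "1 \<le> (D * D) ^ k" "1 \<le> D * D" using D by simp_all
  have M1: "a * (b * c) \<le> M" if "a \<le> 4 * (k + 1)" "b \<le> D * (D * D)" "c \<le> (D * D) ^ k" for a b c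
    by (rule le_trans[OF _ M']) (intro mult_mono that; simp)
  have DD: "D * D \<le> D * (D * D)" "D \<le> D * (D * D)" "1 \<le> D * (D * D)" using D by (simp_all add: mult_le_mono)
  show "D * D \<le> M" using M1[of 1 "D * D" 1] DD P by simp
  show *: "(D * D) ^ k \<le> M" using M1[of 1 1 "(D * D) ^ k"] DD P by simp
  show "k \<le> M" "1 \<le> M" "4 \<le> M" using M1[of k 1 1] M1[of 4 1 1] DD P by simp_all
  show "D * (2 * (D * D) ^ k) \<le> M" using M1[of 2 D "(D * D) ^ k"] DD P by simp
  show "4 * D \<le> M" using M1[of 4 D 1] DD P by simp
  show "(J * S) ^ k \<le> (D * D) ^ k \<and> 4 * (J * S) ^ k \<le> M \<and> J * S \<le> M" if "J \<le> D" "S \<le> D"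
  proof -
    have JS: "J * S \<le> D * D" "(J * S) ^ k \<le> (D * D) ^ k" using that by (auto intro: power_mono mult_mono)
    then show ?thesis using M1[of 4 1 "(J * S) ^ k"] M1[of 1 "J * S" 1] DD P by simp
  qed
  show "rval k x1 x2 y1 y2 y3 u \<le> M" if "1 \<le> x1" "1 \<le> x2" "1 \<le> y3" "x1 \<le> D" "x2 \<le> D" "y1 \<le> D" "y2 \<le> D"
      "y3 \<le> D * D"
  proof -
    have "rval k x1 x2 y1 y2 y3 u \<le> k * (y3 ^ k * (y1 * x1 + y2 * x2))" using that by (intro rval_le)
    also have "\<dots> \<le> k * ((D * D) ^ k * (D * D + D * D))" using that
        by (intro mult_mono add_mono power_mono) auto
    also have "\<dots> = 2 * k * (D * D * (D * D) ^ k)" by (simp add: algebra_simps)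
    also have "\<dots> \<le> M" by (rule M1) (use DD in auto)
    finally show ?thesis .
  qed
qed

definition leaf :: "nat \<Rightarrow> com" where
  "leaf k = (Put ''L'' (V ''p'') (Const 0) ;; ''p'' ::= Add (V ''p'') (Const 1) ;; ''i'' ::= Const 0
      ;; ''a'' ::= Const 1) ;;
    While (Sub (Const k) (V ''i''))
      (Put ''L'' (V ''p'') (Mul (V ''a'') (Add (Const 1) (Mul (V ''D'') (Elem ''y'' (Sub (V ''v'') (V
          ''q'')))))) ;;
       ''p'' ::= Add (V ''p'') (Const 1) ;; ''a'' ::= Mul (V ''a'') (Mul (V ''D'') (V ''D''))
           ;; ''i'' ::= Add (V ''i'') (Const 1))"

lemma writes_leaf [simp]: "writes (leaf k) = {''L'', ''p'', ''i'', ''a''}"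
  by (auto simp: leaf_def)

lemma runs_leaf:
  assumes bd: "bounded M s" and M: "4 * (k + 1) * D ^ (2 * k + 3) \<le> M" "1 \<le> D"
    and par: "s ''D'' 0 = D" "s ''y'' (s ''v'' 0 - s ''q'' 0) = y" "y < D" "s ''p'' 0 = p" "p + k + 1 \<le> M"
    and tau: "200 * (k + 1) * bits M \<le> \<tau>"
  shows "runs (leaf k) s \<tau> (\<lambda>s'. bounded M s' \<and> s' ''p'' 0 = p + (k + 1) \<and>
    s' ''L'' ` {p..<p + (k + 1)} = insert 0 ((\<lambda>i. (D * D) ^ i * (1 + D * y)) ` {..<k}) \<and>
    (\<forall>i<p. s' ''L'' i = s ''L'' i))"
proof -
  note lb = bounds_from_radix[OF M]
  let ?I = "\<lambda>j s'. bounded M s' \<and> s' ''p'' 0 = p + (j + 1) \<and> s' ''i'' 0 = j \<and> s' ''a'' 0 = (D * D) ^ j \<and>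
    s' ''L'' ` {p..<p + (j + 1)} = insert 0 ((\<lambda>i. (D * D) ^ i * (1 + D * y)) ` {..<j}) \<and>
    (\<forall>i<p. s' ''L'' i = s ''L'' i)"
  let ?i = "Put ''L'' (V ''p'') (Const 0) ;; ''p'' ::= Add (V ''p'') (Const 1) ;; ''i'' ::= Const 0
      ;; ''a'' ::= Const 1"
  let ?c = "Put ''L'' (V ''p'') (Mul (V ''a'') (Add (Const 1) (Mul (V ''D'') (Elem ''y'' (Sub (V ''v'') (V
      ''q'')))))) ;;
       ''p'' ::= Add (V ''p'') (Const 1) ;; ''a'' ::= Mul (V ''a'') (Mul (V ''D'') (V ''D''))
           ;; ''i'' ::= Add (V ''i'') (Const 1)"
  show ?thesis
    unfolding leaf_def
  proof (rule runs_Seq)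
    show "runs ?i s (50 * bits M) (?I 0)"
      by (rule runs_chk[where \<beta> = "bits M", OF bd]) (use par lb in \<open>auto simp: big_def\<close>)
  next
    fix s1 assume I0: "?I 0 s1" and fr: "\<And>a. a \<notin> writes ?i \<Longrightarrow> s1 a = s a"
    show "runs (While (Sub (Const k) (V ''i'')) ?c) s1 (120 * (k + 1) * bits M)
       (\<lambda>s'. bounded M s' \<and> s' ''p'' 0 = p + (k + 1) \<and>
        s' ''L'' ` {p..<p + (k + 1)} = insert 0 ((\<lambda>i. (D * D) ^ i * (1 + D * y)) ` {..<k}) \<and>
        (\<forall>i<p. s' ''L'' i = s ''L'' i))"
    proof (rule runs_loop[where I = ?I and n = k and M = M and \<beta> = "bits M" and \<tau> = "\<lambda>_. 100 * bits M"])
      show "?I 0 s1" by (rule I0)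
      fix j s' assume j: "j < k" and I: "?I j s'" and fr': "\<And>a. a \<notin> writes ?c \<Longrightarrow> s' a = s1 a"
      have v: "s' ''D'' 0 = D" "s' ''y'' (s' ''v'' 0 - s' ''q'' 0) = y" using fr fr' par by simp_all
      have "1 + D * y \<le> D * D" using mult_le_mono2[of "Suc y" D D] par(3) M by simp
      then have "(D * D) ^ j * (1 + D * y) \<le> (D * D) ^ j * (D * D)" by (rule mult_le_mono2)
      also have Dk: "\<dots> = (D * D) ^ Suc j" by simp
      also have Dk': "\<dots> \<le> (D * D) ^ k" using j M by (intro power_increasing) auto
      also have "\<dots> \<le> M" by (rule lb)
      finally have 1: "(D * D) ^ j * (1 + D * y) \<le> M" .
      have 2: "(D * D) ^ j * (D * D) \<le> M" using Dk Dk' lb(3) by linarith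
      have 3: "Suc (Suc (p + j)) \<le> M" "Suc j \<le> M"
          "bits k \<le> bits M" using j par lb(4) by (simp_all add: bits_mono)
      have "runs ?c s' (100 * bits M) (?I (Suc j))"
      proof (rule runs_chk[where M = M and \<beta> = "bits M"])
        show "chkc M (bits M) ?c s'" using I v 1 2 3 by (simp add: big_def)
        assume b: "bounded M (fin ?c s')"
        have f: "fin ?c s' ''p'' 0 = p + (Suc j + 1)" "fin ?c s' ''i'' 0 = Suc j"
            "fin ?c s' ''a'' 0 = (D * D) ^ Suc j"
          "fin ?c s' ''L'' = (s' ''L'')(p + (j + 1) := (D * D) ^ j * (1 + D * y))"
          using I v by (simp_all add: mult.commute)
        have "(s' ''L'')(p + (j + 1) := (D * D) ^ j * (1 + D * y)) ` {p..<p + (j + 1)} = s' ''L'' ` {p..<p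
            + (j + 1)}"
          by (intro image_cong) auto
        also have "\<dots> = insert 0 ((\<lambda>i. (D * D) ^ i * (1 + D * y)) ` {..<j})" using I by (elim conjE)
        finally have A: "(s' ''L'')(p + (j + 1) := (D * D) ^ j * (1 + D * y)) ` {p..<p + (j + 1)} =
          insert 0 ((\<lambda>i. (D * D) ^ i * (1 + D * y)) ` {..<j})" .
        have iv: "{p..<p + (Suc j + 1)} = insert (p + (j + 1)) {p..<p + (j + 1)}" by auto
        have im: "fin ?c s' ''L'' ` {p..<p + (Suc j + 1)} = insert 0 ((\<lambda>i. (D * D) ^ i * (1
            + D * y)) ` {..<Suc j})"
          unfolding f(4) iv image_insert fun_upd_same A lessThan_Suc by (rule insert_commute)
        have lt: "\<forall>i<p. fin ?c s' ''L'' i = s ''L'' i" unfolding f(4) using I by simp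
        show "?I (Suc j) (fin ?c s')" by (intro conjI b f(1-3) im lt)
      qed (use I in simp_all)
      then show "ev (Sub (Const k) (V ''i'')) s' \<noteq> 0 \<and> chk (bits M) (Sub (Const k) (V ''i'')) s' \<and>
        runs ?c s' (100 * bits M) (?I (Suc j))" using I j 3 by (auto simp: big_def)
    next
      show "ev (Sub (Const k) (V ''i'')) s' = 0
          \<and> chk (bits M) (Sub (Const k) (V ''i'')) s'" if "?I k s'" for s'
        using that lb(4) by (simp add: bits_mono big_def)
    qed (simp_all add: algebra_simps)
  next
    have "50 * bits M + 120 * (k + 1) * bits M \<le> 200 * (k + 1) * bits M" by (simp add: algebra_simps)
    then show "50 * bits M + 120 * (k + 1) * bits M \<le> \<tau>" using tau by linarith
  qed
qed

definition merge :: "nat \<Rightarrow> com" where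
  "merge k = (''l1'' ::= Elem ''st'' (Mul (Const 2) (V ''v''))
      ;; ''h1'' ::= Elem ''en'' (Mul (Const 2) (V ''v'')) ;;
     ''l2'' ::= Elem ''st'' (Add (Mul (Const 2) (V ''v'')) (Const 1))
         ;; ''h2'' ::= Elem ''en'' (Add (Mul (Const 2) (V ''v'')) (Const 1)) ;;
     ''J'' ::= Add (Quot (Mul (Const 2) (V ''q'')) (V ''v'')) (Const 1)
         ;; ''lim'' ::= Quot (V ''tm'') (V ''b'') ;;
     ''S'' ::= Add (Mul (Const 2) (V ''lim'')) (Const 1) ;;
     ''U1'' ::= Const 0 ;; ''U2'' ::= Const 1 ;; ''Y1'' ::= Const 1 ;; ''Y2'' ::= V ''J'') ;;
   convolve k ''L'' ''L'' ''L''"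

definition node :: "nat \<Rightarrow> com" where
  "node k = Put ''st'' (V ''v'') (V ''p'') ;;
    Ite (Sub (V ''v'') (Sub (V ''q'') (Const 1))) (leaf k) (merge k) ;;
    Put ''en'' (V ''v'') (V ''p'') ;; ''v'' ::= Sub (V ''v'') (Const 1)"

definition block :: "nat \<Rightarrow> com" where
  "block k = (''p'' ::= Const 0 ;; ''v'' ::= Sub (Mul (Const 2) (V ''q'')) (Const 1))
      ;; While (V ''v'') (node k)"

definition scratch :: "string set" where
  "scratch = {''L'', ''N0'', ''N'', ''h'', ''g'', ''e'', ''j'', ''p'', ''r'', ''w'', ''ok'', ''c'', ''d'',
      ''u'', ''f'',
     ''x1'', ''x2'', ''u1'', ''u2'', ''y1'', ''y2'', ''y3'', ''lo'', ''hi'', ''P'', ''Q'', ''U'', ''W'',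
     ''l1'', ''h1'', ''l2'', ''h2'', ''J'', ''lim'', ''S'', ''U1'', ''U2'', ''Y1'', ''Y2'', ''i'', ''a'',
         ''st'', ''en'', ''v''}"

lemma writes_merge: "writes (merge k) = scratch - {''i'', ''a'', ''st'', ''en'', ''v''}"
  by (auto simp: merge_def scratch_def)

lemma writes_block [simp]: "writes (block k) = scratch"
  by (auto simp: block_def node_def writes_merge scratch_def)

definition node_size :: "nat \<Rightarrow> nat \<Rightarrow> nat \<Rightarrow> nat \<Rightarrow> nat" where
  "node_size k q L v = ((2 * q div v + 1) * (2 * L + 1)) ^ k"

lemma node_size_mono: "0 < u \<Longrightarrow> u \<le> v \<Longrightarrow> node_size k q L v \<le> node_size k q L u"
  unfolding node_size_def by (intro power_mono mult_mono add_mono div_le_mono2) auto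

lemma node_size_ge_1: "1 \<le> node_size k q L v"
  by (simp add: node_size_def)

lemma node_size_ge: "0 < v \<Longrightarrow> v < 2 * q \<Longrightarrow> k + 1 \<le> 2 * node_size k q L v"
proof -
  assume v: "0 < v" "v < 2 * q"
  have "1 \<le> 2 * q div v" using v by (simp add: less_eq_div_iff_mult_less_eq)
  then have "2 * 1 \<le> (2 * q div v + 1) * (2 * L + 1)" by (intro mult_mono) auto
  then have "2 ^ k \<le> node_size k q L v" unfolding node_size_def by (intro power_mono) auto
  then show ?thesis using less_exp[of k] by linarith
qed

text \<open>The block of node \<open>u\<close> is the list of codes stored in \<open>L[st[u]..<en[u]]\<close>.\<close>

definition block_ok :: "nat \<Rightarrow> nat \<Rightarrow> nat \<Rightarrow> nat \<Rightarrow> nat list \<Rightarrow> store \<Rightarrow> nat \<Rightarrow> bool" where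
  "block_ok k D b t ys s u \<longleftrightarrow> s ''st'' u \<le> s ''en'' u \<and> s ''en'' u \<le> s ''p'' 0 \<and>
     s ''en'' u \<le> s ''st'' u + 2 * node_size k (length ys) (t div b) u \<and>
     s ''L'' ` {s ''st'' u..<s ''en'' u} = reach k D (\<lambda>_. 1) (\<lambda>e. e div b) (t div b) (items ys u)"

lemma block_ok_extend:
  assumes "block_ok k D b t ys s u" "s' ''st'' u = s ''st'' u" "s' ''en'' u = s ''en'' u"
      "s ''p'' 0 \<le> s' ''p'' 0"
    "\<forall>i<s ''p'' 0. s' ''L'' i = s ''L'' i"
  shows "block_ok k D b t ys s' u"
proof -
  have "s' ''L'' ` {s ''st'' u..<s ''en'' u} = s ''L'' ` {s ''st'' u..<s ''en'' u}"
    using assms unfolding block_ok_def by (intro image_cong) auto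
  then show ?thesis using assms unfolding block_ok_def by simp
qed

lemma runs_merge:
  assumes bd: "bounded M s" and M: "4 * (k + 1) * D ^ (2 * k + 3) \<le> M"
    and D: "2 * length ys + 2 * t + 1 \<le> D" and ys: "distinct ys" and b: "1 \<le> b"
    and par: "s ''D'' 0 = D" "s ''q'' 0 = length ys" "s ''tm'' 0 = t" "s ''b'' 0 = b" "s ''v'' 0 = v"
        "s ''p'' 0 = p"
    and v: "0 < v" "v < length ys" and p: "p + 2 * node_size k (length ys) (t div b) v \<le> M"
    and ch: "block_ok k D b t ys s (2 * v)" "block_ok k D b t ys s (2 * v + 1)"
    and tau: "110000 * ((k + 1)^2 * node_size k (length ys) (t div b) v * bits M ^ 2) \<le> \<tau>"
  shows "runs (merge k) s \<tau> (\<lambda>s'. bounded M s' \<and> p \<le> s' ''p'' 0 \<and>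
    s' ''p'' 0 \<le> p + 2 * node_size k (length ys) (t div b) v \<and>
    s' ''L'' ` {p..<s' ''p'' 0} = reach k D (\<lambda>_. 1) (\<lambda>e. e div b) (t div b) (items ys v) \<and>
    (\<forall>i<p. s' ''L'' i = s ''L'' i))"
proof -
  let ?q = "length ys" and ?b = "bits M"
  define J L S where "J = 2 * ?q div v + 1" and "L = t div b" and "S = 2 * L + 1"
  have L: "L \<le> t" by (simp add: L_def)
  have J: "J \<le> 2 * ?q + 1" unfolding J_def by simp
  have le: "J \<le> D" "S \<le> D" "1 \<le> D" "1 \<le> J" "1 \<le> S" "2 * ?q \<le> D" "2 * L < D"
    using D J L by (linarith, simp_all add: S_def J_def)
  note lb = bounds_from_radix[OF M le(3)]
  have ns: "node_size k ?q (t div b) v = (J * S) ^ k" by (simp add: node_size_def J_def S_def L_def)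
  let ?i = "''l1'' ::= Elem ''st'' (Mul (Const 2) (V ''v''))
      ;; ''h1'' ::= Elem ''en'' (Mul (Const 2) (V ''v'')) ;;
     ''l2'' ::= Elem ''st'' (Add (Mul (Const 2) (V ''v'')) (Const 1))
         ;; ''h2'' ::= Elem ''en'' (Add (Mul (Const 2) (V ''v'')) (Const 1)) ;;
     ''J'' ::= Add (Quot (Mul (Const 2) (V ''q'')) (V ''v'')) (Const 1)
         ;; ''lim'' ::= Quot (V ''tm'') (V ''b'') ;;
     ''S'' ::= Add (Mul (Const 2) (V ''lim'')) (Const 1) ;;
     ''U1'' ::= Const 0 ;; ''U2'' ::= Const 1 ;; ''Y1'' ::= Const 1 ;; ''Y2'' ::= V ''J''"
  let ?l1 = "s ''st'' (2 * v)" and ?h1 = "s ''en'' (2 * v)" and ?l2 = "s ''st'' (2 * v + 1)"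
      and ?h2 = "s ''en'' (2 * v + 1)"
  have bM: "2 \<le> ?b" using bits_mono[of 2 M] lb(6) by simp
  have DM: "D \<le> M" using lb(8) by simp
  have vM: "J \<le> M" "S \<le> M" "L \<le> M" using le DM by linarith+
  have "runs ?i s (200 * ?b) (\<lambda>s'. bounded M s' \<and> s' ''l1'' 0 = ?l1 \<and> s' ''h1'' 0 = ?h1 \<and> s' ''l2'' 0 = ?l2
      \<and> s' ''h2'' 0 = ?h2 \<and>
     s' ''J'' 0 = J \<and> s' ''lim'' 0 = L \<and> s' ''S'' 0 = S \<and> s' ''U1'' 0 = 0 \<and> s' ''U2'' 0 = 1
         \<and> s' ''Y1'' 0 = 1 \<and> s' ''Y2'' 0 = J)"
    by (rule runs_chk[where M = M and \<beta> = ?b])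
      (use bd par bM boundedD[OF bd, of "''st''"] boundedD[OF bd, of "''en''"] vM lb(5)
        in \<open>simp_all add: big_def J_def[symmetric, simplified] L_def[symmetric] S_def[symmetric,
            simplified]\<close>)
  then obtain T1 s1 where 1: "exec ?i s T1 s1" "T1 \<le> 200 * ?b" "bounded M s1"
     "s1 ''l1'' 0 = ?l1" "s1 ''h1'' 0 = ?h1" "s1 ''l2'' 0 = ?l2" "s1 ''h2'' 0 = ?h2"
     "s1 ''J'' 0 = J" "s1 ''lim'' 0 = L" "s1 ''S'' 0 = S" "s1 ''U1'' 0 = 0" "s1 ''U2'' 0 = 1"
         "s1 ''Y1'' 0 = 1" "s1 ''Y2'' 0 = J"
     and fr1: "\<And>a. a \<notin> writes ?i \<Longrightarrow> s1 a = s a"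
    by (rule runsE) blast
  have p1: "s1 ''D'' 0 = D" "s1 ''p'' 0 = p" "s1 ''L'' = s ''L''" using fr1 par by simp_all
  let ?E1 = "items ys (2 * v)" and ?E2 = "items ys (2 * v + 1)"
  let ?R = "reach k D (\<lambda>_. 1) (\<lambda>e. e div b) L"
  have ch': "?l1 \<le> ?h1" "?l2 \<le> ?h2" "s ''L'' ` {?l1..<?h1} = ?R ?E1" "s ''L'' ` {?l2..<?h2} = ?R ?E2"
    using ch unfolding block_ok_def L_def by blast+
  have E: "items ys v = ?E1 \<union> ?E2" using v by (rule items_node)
  have card: "(\<Sum>e\<in>?E1 \<union> ?E2. 1) < J" "(\<Sum>e\<in>?E2. 1) < J"
  proof -
    have "card (items ys v) \<le> 2 * ?q div v" by (rule card_items_le) (use v in auto)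
    then show "(\<Sum>e\<in>?E1 \<union> ?E2. 1) < J" unfolding E J_def by simp
    moreover have "(\<Sum>e\<in>?E2. 1) \<le> (\<Sum>e\<in>?E1 \<union> ?E2. 1 :: nat)" by (intro sum_mono2) auto
    ultimately show "(\<Sum>e\<in>?E2. 1) < J" by linarith
  qed
  have S2: "2 * L < S" "L < S" by (simp_all add: S_def)
  note Y = recode_image_reach[where k = k, OF finite_items card(2) le(1) S2(2) le(2)]
  note disj = items_disjoint[OF ys v]
  have lens: "?h1 - ?l1 \<le> 2 * (J * S) ^ k" "?h2 - ?l2 \<le> 2 * (J * S) ^ k"
  proof -
    have "?h1 - ?l1 \<le> 2 * node_size k ?q (t div b) (2 * v)"
        "?h2 - ?l2 \<le> 2 * node_size k ?q (t div b) (2 * v + 1)"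
      using ch unfolding block_ok_def by linarith+
    then show "?h1 - ?l1 \<le> 2 * (J * S) ^ k" "?h2 - ?l2 \<le> 2 * (J * S) ^ k"
      using node_size_mono[of v "2 * v" k ?q "t div b"] node_size_mono[of v "2 * v + 1" k ?q "t div b"] v
      unfolding ns by linarith+
  qed
  obtain T2 s2 where 2: "exec (convolve k ''L'' ''L'' ''L'') s1 T2 s2"
    "T2 \<le> 20000 * ((k + 1)^2 * ((J * S) ^ k + (?h1 - ?l1) + (?h2 - ?l2)) * ?b ^ 2)"
    "bounded M s2" "p \<le> s2 ''p'' 0" "s2 ''p'' 0 \<le> p + 2 * (J * S) ^ k"
    "s2 ''L'' ` {p..<s2 ''p'' 0} = rval k J S 1 D (D * D) ` {z. rok k J S 0 1 L z \<and>
      (\<exists>x\<in>s1 ''L'' ` {?l1..<?h1}. \<exists>y\<in>s1 ''L'' ` {?l2..<?h2}. rok k D D 0 1 L x \<and> rok k D D 0 1 L y \<and>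
        z = rval k D D 1 J (J * S) x + rval k D D 1 J (J * S) y)}"
    "\<forall>i<p. s2 ''L'' i = s1 ''L'' i"
  proof (rule runsE[OF runs_convolve[of "''L''" "''L''"
      "''L''", OF _ _ _ 1(3) lb(4,5) p1(1) 1(8,10,9,11-14,4-7) p1(2) le(3-5) ch'(1,2)
        _ _ lb(2,3) _ _ _ _ _ order_refl]])
    show "rval k D D 1 J (J * S) x + rval k D D 1 J (J * S) y < (J * S) ^ k"
      if "x \<in> s1 ''L'' ` {?l1..<?h1}" "y \<in> s1 ''L'' ` {?l2..<?h2}" "rok k D D 0 1 L x"
          "rok k D D 0 1 L y" for x y
      by (rule reach_sums_less[OF finite_items finite_items disj card(1) le(1) S2(1) le(2) Y
          that(1)[unfolded p1 ch'] that(2)[unfolded p1 ch'] that(4)])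
    show "4 * (J * S) ^ k \<le> M" "J * S \<le> M" using lb(9)[OF le(1,2)] by simp_all
    show "p + 2 * (J * S) ^ k \<le> M" using p unfolding ns .
    have JS1: "1 \<le> J * S" "J * S \<le> D * D" using le by (simp, intro mult_mono, auto)
    show "rval k D D 1 J (J * S) x \<le> M" "rval k D D 1 J (J * S) x \<le> M" for x
      by (intro lb(10); use le JS1 in simp)+
    show "rval k J S 1 D (D * D) x \<le> M" for x
      by (intro lb(10); use le in simp)
  qed (simp, simp, simp, elim conjE, blast)
  have r: "s2 ''L'' ` {p..<s2 ''p'' 0} = ?R (items ys v)"
    unfolding 2(6) p1 ch' E
    by (rule reach_convolve[OF finite_items finite_items disj card(1) le(1) S2(1) le(2) Y])
  show ?thesis
    unfolding merge_def ns
  proof (rule runsI[OF exec.Seq[OF 1(1) 2(1)]])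
    have "T2 \<le> 20000 * ((k + 1)^2 * (5 * (J * S) ^ k) * ?b ^ 2)"
      by (rule le_trans[OF 2(2)], intro mult_le_mono2 mult_le_mono1) (use lens in linarith)
    moreover have "1 * 1 * (?b * 1) \<le> (k + 1)^2 * (J * S) ^ k * ?b ^ 2"
      unfolding power2_eq_square[of ?b] by (intro mult_mono) (use le in \<open>simp_all add: one_le_power\<close>)
    ultimately have "T1 + T2 \<le> 110000 * ((k + 1)^2 * (J * S) ^ k * ?b ^ 2)" using 1(2)
        by (simp add: algebra_simps)
    then show "T1 + T2 \<le> \<tau>" using tau unfolding ns by linarith
    show "bounded M s2 \<and> p \<le> s2 ''p'' 0 \<and> s2 ''p'' 0 \<le> p + 2 * (J * S) ^ k \<and>
      s2 ''L'' ` {p..<s2 ''p'' 0} = reach k D (\<lambda>_. 1) (\<lambda>e. e div b) (t div b) (items ys v) \<and>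
      (\<forall>i<p. s2 ''L'' i = s ''L'' i)"
      using 2(3-5,7) r p1(3) unfolding L_def by simp
  qed
qed

lemma runs_block:
  assumes bd: "bounded M s" and M: "4 * (k + 1) * D ^ (2 * k + 3) \<le> M"
    and D: "2 * length ys + 2 * t + 1 \<le> D" and ys: "distinct ys" "ys \<noteq> []" "\<And>e. e \<in> set ys
        \<Longrightarrow> e \<le> t" and b: "1 \<le> b"
    and par: "s ''D'' 0 = D" "s ''q'' 0 = length ys" "s ''tm'' 0 = t" "s ''b'' 0 = b"
      "\<And>i. i < length ys \<Longrightarrow> s ''y'' i = ys ! i div b"
    and tau: "120000 * ((k + 1)^2 * bits M ^ 2 * (\<Sum>i<2 * length ys - 1. node_size k (length ys) (t div b)
        (Suc i))) \<le> \<tau>"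
  shows "runs (block k) s \<tau> (\<lambda>s'. bounded M s' \<and> s' ''st'' 1 \<le> s' ''en'' 1 \<and>
    s' ''en'' 1 \<le> s' ''st'' 1 + 2 * node_size k (length ys) (t div b) 1 \<and>
    s' ''L'' ` {s' ''st'' 1..<s' ''en'' 1} = reach k D (\<lambda>_. 1) (\<lambda>e. e div b) (t div b) (set ys))"
proof -
  let ?q = "length ys" and ?b = "bits M"
  let ?n = "node_size k ?q (t div b)"
  let ?X = "(k + 1)^2 * ?b ^ 2"
  have q: "1 \<le> ?q" using ys by (cases ys) auto
  have D1: "1 \<le> D" using D by linarith
  note lb = bounds_from_radix[OF M D1]
  have n1: "?n 1 \<le> (D * D) ^ k"
  proof -
    have "t div b \<le> t" by simp
    then show ?thesis unfolding node_size_def using D by (intro power_mono mult_mono) (simp, linarith, auto)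
  qed
  have nv: "?n v \<le> ?n 1" if "0 < v" for v using node_size_mono[of 1 v] that by simp
  have nM: "j * (2 * ?n 1) \<le> M" if "j \<le> D" for j
  proof -
    have "j * (2 * ?n 1) \<le> D * (2 * (D * D) ^ k)" using that n1 by (intro mult_mono) auto
    then show ?thesis using lb(7) by linarith
  qed
  let ?I = "\<lambda>j s'. bounded M s' \<and> s' ''v'' 0 = 2 * ?q - 1 - j \<and>
    (\<forall>u. 2 * ?q - 1 - j < u \<and> u < 2 * ?q \<longrightarrow> block_ok k D b t ys s' u) \<and> s' ''p'' 0 \<le> j * (2 * ?n 1)"
  let ?i = "''p'' ::= Const 0 ;; ''v'' ::= Sub (Mul (Const 2) (V ''q'')) (Const 1)"
  have qM: "2 * ?q \<le> M" using D lb(8) by linarith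
  have bM: "2 \<le> ?b" using bits_mono[of 2 M] lb(6) by simp
  have X1: "?b \<le> ?X"
    using mult_mono[of 1 "(k + 1)^2" "?b * 1" "?b * ?b"] bM by (simp add: power2_eq_square)
  have w: "writes (node k) = scratch" by (auto simp: node_def writes_merge scratch_def)
  show ?thesis
    unfolding block_def
  proof (rule runs_Seq)
    show "runs ?i s (30 * ?b) (?I 0)"
      by (rule runs_chk[where \<beta> = "bits M", OF bd]) (use par qM bM in \<open>auto simp: big_def\<close>)
  next
    fix s1 assume I0: "?I 0 s1" and fr: "\<And>a. a \<notin> writes ?i \<Longrightarrow> s1 a = s a"
    show "runs (While (V ''v'') (node k)) s1 (119000 * (?X * (\<Sum>i<2 * ?q - 1. ?n (Suc i))))
      (\<lambda>s'. bounded M s' \<and> s' ''st'' 1 \<le> s' ''en'' 1 \<and> s' ''en'' 1 \<le> s' ''st'' 1 + 2 * ?n 1 \<and>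
        s' ''L'' ` {s' ''st'' 1..<s' ''en'' 1} = reach k D (\<lambda>_. 1) (\<lambda>e. e div b) (t div b) (set ys))"
    proof (rule runs_loop[where I = ?I and n = "2 * ?q - 1" and M = M and \<beta> = "bits M"
          and \<tau> = "\<lambda>j. 110200 * (?X * ?n (2 * ?q - 1 - j))"])
      show "?I 0 s1" by (rule I0)
    next
      fix j s2 assume j: "j < 2 * ?q - 1" and I: "?I j s2" and fr2: "\<And>a. a \<notin> writes (node k) \<Longrightarrow> s2 a = s1 a"
      define v where "v = 2 * ?q - 1 - j"
      have v: "0 < v" "v < 2 * ?q" "v + j = 2 * ?q - 1"
          "2 * ?q - 1 - Suc j = v - 1" using j by (auto simp: v_def)
      have I': "bounded M s2" "s2 ''v'' 0 = v" "s2 ''p'' 0 \<le> j * (2 * ?n 1)"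
        "\<And>u. v < u \<Longrightarrow> u < 2 * ?q \<Longrightarrow> block_ok k D b t ys s2 u"
        using I unfolding v_def by blast+
      have fr2': "s2 a = s a" if "a \<notin> scratch" for a
      proof -
        have "a \<notin> writes ?i" using that by (auto simp: scratch_def)
        then show ?thesis using fr fr2 w that by simp
      qed
      have p2: "s2 ''D'' 0 = D" "s2 ''q'' 0 = ?q" "s2 ''tm'' 0 = t" "s2 ''b'' 0 = b"
        "\<And>i. i < ?q \<Longrightarrow> s2 ''y'' i = ys ! i div b"
        using par fr2' by (simp_all add: scratch_def)
      define p where "p = s2 ''p'' 0"
      have pv: "p + 2 * ?n v \<le> Suc j * (2 * ?n 1)" using I'(3) nv[OF v(1)] unfolding p_def by simp
      have "Suc j \<le> D" using j D by linarith
      then have pM: "p + 2 * ?n v \<le> M" using nM[of "Suc j"] pv by linarith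
      let ?c1 = "Put ''st'' (V ''v'') (V ''p'')"
      have "runs ?c1 s2 (20 * ?b) (\<lambda>s3. bounded M s3 \<and> s3 = s2(''st'' := (s2 ''st'')(v := p)))"
        by (rule runs_chk[where M = M and \<beta> = ?b]) (use I'(1,2) p_def pM in \<open>auto simp: big_def\<close>)
      then obtain T1 s3 where 1: "exec ?c1 s2 T1 s3" "T1 \<le> 20 * ?b" "bounded M s3"
          "s3 = s2(''st'' := (s2 ''st'')(v := p))"
        by (rule runsE) blast
      have p3: "s3 ''D'' 0 = D" "s3 ''q'' 0 = ?q" "s3 ''tm'' 0 = t" "s3 ''b'' 0 = b" "s3 ''v'' 0 = v"
          "s3 ''p'' 0 = p"
        "s3 ''L'' = s2 ''L''" "s3 ''st'' v = p"
        using p2 I'(2) by (simp_all add: 1(4) p_def)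
      have ok3: "block_ok k D b t ys s3 u" if "v < u" "u < 2 * ?q" for u
        by (rule block_ok_extend[OF I'(4)[OF that]]) (use that in \<open>simp_all add: 1(4)\<close>)
      let ?R = "\<lambda>s4. bounded M s4 \<and> p \<le> s4 ''p'' 0 \<and> s4 ''p'' 0 \<le> p + 2 * ?n v \<and>
        s4 ''L'' ` {p..<s4 ''p'' 0} = reach k D (\<lambda>_. 1) (\<lambda>e. e div b) (t div b) (items ys v) \<and>
        (\<forall>i<p. s4 ''L'' i = s3 ''L'' i)"
      let ?c2 = "Ite (Sub (V ''v'') (Sub (V ''q'') (Const 1))) (leaf k) (merge k)"
      have "runs ?c2 s3 (110050 * (?X * ?n v)) ?R"
      proof (rule runs_Ite[where \<beta> = ?b and \<tau> = "110000 * (?X * ?n v)"])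
        show "okx ?b (Sub (V ''v'') (Sub (V ''q'') (Const 1))) s3"
          by (rule chk_okx[OF 1(3)]) (use bM in \<open>auto simp: big_def\<close>)
      next
        assume "ev (Sub (V ''v'') (Sub (V ''q'') (Const 1))) s3 \<noteq> 0"
        then have vq: "?q \<le> v" using p3 q by simp
        define e where "e = ys ! (v - ?q)"
        have e: "e \<in> set ys" "s3 ''y'' (s3 ''v'' 0 - s3 ''q'' 0) = e div b" "items ys v = {e}"
          using vq v(2) p3 p2(5)[of "v - ?q"] items_leaf[OF vq] by (simp_all add: 1(4) e_def)
        have et: "e \<le> t" by (rule ys(3)[OF e(1)])
        then have eL: "e div b \<le> t div b" by (rule div_le_mono)
        have eD: "e div b < D" using et D div_le_dividend[of e b] by linarith
        have kn: "k + 1 \<le> 2 * ?n v" by (rule node_size_ge[OF v(1,2)])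
        have "p + k + 1 \<le> M" using kn pM by linarith
        show "runs (leaf k) s3 (110000 * (?X * ?n v)) ?R"
        proof (rule runs_weaken[OF runs_leaf[OF 1(3) M D1 p3(1) e(2) eD p3(6) \<open>p + k + 1 \<le> M\<close> order_refl]])
          have "200 * (k + 1) * ?b = 200 * ((k + 1) * (1 * ?b) * 1)" by (simp add: algebra_simps)
          also have "\<dots> \<le> 200 * ((k + 1) * ((k + 1) * ?b ^ 2) * ?n v)"
            by (intro mult_le_mono order_refl) (auto simp: power2_eq_square node_size_ge_1[simplified])
          also have "\<dots> = 200 * (?X * ?n v)" by (simp only: power2_eq_square[of "k + 1"] mult.assoc)
          finally show "200 * (k + 1) * ?b \<le> 110000 * (?X * ?n v)" by linarith
        next
          fix s4 assume *: "bounded M s4 \<and> s4 ''p'' 0 = p + (k + 1) \<and>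
            s4 ''L'' ` {p..<p + (k + 1)} = insert 0 ((\<lambda>i. (D * D) ^ i * (1 + D * (e div b))) ` {..<k}) \<and>
            (\<forall>i<p. s4 ''L'' i = s3 ''L'' i)"
          have "reach k D (\<lambda>_. 1) (\<lambda>e. e div b) (t div b) (items ys v) =
            insert 0 ((\<lambda>i. (D * D) ^ i * (1 + D * (e div b))) ` {..<k})"
            unfolding e(3) by (rule reach_singleton) (rule eL)
          then show "?R s4" using * kn by simp
        qed
      next
        assume "ev (Sub (V ''v'') (Sub (V ''q'') (Const 1))) s3 = 0"
        then have vq: "v < ?q" using p3 q by simp
        have ch: "block_ok k D b t ys s3 (2 * v)" "block_ok k D b t ys s3 (2 * v + 1)"
          using vq v by (auto intro!: ok3)
        show "runs (merge k) s3 (110000 * (?X * ?n v)) ?R"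
          by (rule runs_merge[OF 1(3) M D ys(1) b p3(1-6) v(1) vq pM ch]) (simp add: mult.assoc
              mult.left_commute mult.commute)
      next
        have c: "ecost (Sub (V ''v'') (Sub (V ''q'') (Const 1)))
            + wt (Sub (V ''v'') (Sub (V ''q'') (Const 1))) = 12" by simp
        have "20 * ?b * 1 \<le> 20 * ?X * ?n v" using X1 node_size_ge_1 by (intro mult_mono) auto
        then show "(ecost (Sub (V ''v'') (Sub (V ''q'') (Const 1)))
            + wt (Sub (V ''v'') (Sub (V ''q'') (Const 1)))) * ?b +
          110000 * (?X * ?n v) \<le> 110050 * (?X * ?n v)"
          unfolding c by linarith
      qed
      then obtain T2 s4 where 2: "exec ?c2 s3 T2 s4" "T2 \<le> 110050 * (?X * ?n v)" "?R s4"
        and fr4: "\<And>a. a \<notin> writes ?c2 \<Longrightarrow> s4 a = s3 a"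
        by (rule runsE) (rule that)
      have fr4': "s4 ''v'' = s3 ''v''" "s4 ''st'' = s3 ''st''" "s4 ''en'' = s3 ''en''"
        using fr4 by (simp_all add: writes_merge)
      have R: "bounded M s4" "p \<le> s4 ''p'' 0" "s4 ''p'' 0 \<le> p + 2 * ?n v"
        "s4 ''L'' ` {p..<s4 ''p'' 0} = reach k D (\<lambda>_. 1) (\<lambda>e. e div b) (t div b) (items ys v)"
        "\<forall>i<p. s4 ''L'' i = s3 ''L'' i" using 2(3) by blast+
      let ?c3 = "Put ''en'' (V ''v'') (V ''p'') ;; ''v'' ::= Sub (V ''v'') (Const 1)"
      have p4: "s4 ''v'' 0 = v" using fr4' p3 by simp
      have vM: "s4 ''p'' 0 \<le> M" "v \<le> M" using pM R qM v by linarith+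
      have "runs ?c3 s4 (50 * ?b) (\<lambda>s5. bounded M s5 \<and> s5 ''v'' 0 = v - 1
          \<and> s5 ''en'' = (s4 ''en'')(v := s4 ''p'' 0))"
        by (rule runs_chk[where M = M and \<beta> = ?b]) (use R(1) p4 vM in \<open>auto simp: big_def\<close>)
      then obtain T3 s5 where 3: "exec ?c3 s4 T3 s5" "T3 \<le> 50 * ?b" "bounded M s5" "s5 ''v'' 0 = v - 1"
        "s5 ''en'' = (s4 ''en'')(v := s4 ''p'' 0)" and fr5: "\<And>a. a \<notin> writes ?c3 \<Longrightarrow> s5 a = s4 a"
        by (rule runsE) blast
      have s5: "s5 ''st'' = s3 ''st''" "s5 ''L'' = s4 ''L''"
          "s5 ''p'' = s4 ''p''" using fr5 fr4' by simp_all
      have okv: "block_ok k D b t ys s5 v"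
        unfolding block_ok_def s5 3(5) p3(8) fun_upd_same using R(2-4) by simp
      have ok5: "block_ok k D b t ys s5 u" if "v - 1 < u" "u < 2 * ?q" for u
      proof (cases "u = v")
        case False
        then have "v < u" using that by linarith
        show ?thesis
          by (rule block_ok_extend[OF ok3[OF \<open>v < u\<close> that(2)]])
              (use R \<open>v < u\<close> p3 in \<open>simp_all add: s5 3(5) fr4'\<close>)
      qed (use okv in simp)
      have "s5 ''p'' 0 \<le> Suc j * (2 * ?n 1)" using R(3) pv unfolding s5 by linarith
      then have I5: "?I (Suc j) s5" using 3(3,4) ok5 unfolding v(4) by blast
      have "runs (node k) s2 (110200 * (?X * ?n (2 * ?q - 1 - j))) (?I (Suc j))"
        unfolding node_def v_def[symmetric]
      proof (rule runsI[OF exec.Seq[OF 1(1) exec.Seq[OF 2(1) 3(1)]]])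
        have "70 * ?b * 1 \<le> 70 * ?X * ?n v" using X1 node_size_ge_1 by (intro mult_mono) auto
        then show "T1 + (T2 + T3) \<le> 110200 * (?X * ?n v)" using 1(2) 2(2) 3(2) by linarith
        show "?I (Suc j) s5" by (rule I5)
      qed
      then show "ev (V ''v'') s2 \<noteq> 0 \<and> chk ?b (V ''v'') s2 \<and>
        runs (node k) s2 (110200 * (?X * ?n (2 * ?q - 1 - j))) (?I (Suc j))"
        using I'(2) v(1) by (simp add: big_def)
    next
      show "ev (V ''v'') s' = 0 \<and> chk ?b (V ''v'') s'" if "?I (2 * ?q - 1) s'" for s' using that
          by (simp add: big_def)
    next
      let ?N = "2 * ?q - 1"
      have "(\<Sum>j<?N. 110200 * (?X * ?n (?N - j)) + 4 * ?b) + 4 * ?b \<le> (\<Sum>j<?N. 110200 * (?X * ?n (?N - j))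
          + 4 * (?X * ?n (?N - j))) + 4 * (?X * (\<Sum>j<?N. ?n (?N - j)))"
      proof (intro add_mono sum_mono)
        have c: "?b * 1 \<le> ?X * n" if "1 \<le> n" for n using X1 that by (intro mult_mono) auto
        show "4 * ?b \<le> 4 * (?X * ?n (?N - j))" for j using c[of "?n (?N - j)"] node_size_ge_1 by simp
        have "1 \<le> (\<Sum>j<?N. ?n (?N - j))"
          using member_le_sum[of 0 "{..<?N}" "\<lambda>j. ?n (?N - j)"] q node_size_ge_1[of k ?q "t div b" ?N]
              by simp
        then show "4 * ?b \<le> 4 * (?X * (\<Sum>j<?N. ?n (?N - j)))" using c by simp
      qed simp
      also have "\<dots> = 110208 * (?X * (\<Sum>j<?N. ?n (?N - j)))"
          by (simp add: sum_distrib_left[symmetric] sum.distrib)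
      also have "(\<Sum>j<?N. ?n (?N - j)) = (\<Sum>j<?N. ?n (Suc (?N - Suc j)))"
        by (intro sum.cong refl) (simp only: lessThan_iff Suc_diff_Suc)
      also have "\<dots> = (\<Sum>i<?N. ?n (Suc i))" by (rule sum.nat_diff_reindex)
      finally show "(\<Sum>j<?N. 110200 * (?X * ?n (?N - j)) + (ecost (V ''v'') + wt (V ''v'')) * ?b)
          + (ecost (V ''v'') + wt (V ''v'')) * ?b
        \<le> 119000 * (?X * (\<Sum>i<?N. ?n (Suc i)))" unfolding cost_V by linarith
    next
      fix s' assume I: "?I (2 * ?q - 1) s'"
      then have "block_ok k D b t ys s' 1" using q by simp
      then show "bounded M s' \<and> s' ''st'' 1 \<le> s' ''en'' 1 \<and> s' ''en'' 1 \<le> s' ''st'' 1 + 2 * ?n 1 \<and>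
        s' ''L'' ` {s' ''st'' 1..<s' ''en'' 1} = reach k D (\<lambda>_. 1) (\<lambda>e. e div b) (t div b) (set ys)"
        using I unfolding block_ok_def items_root[OF ys(1,2)] by blast
    qed (simp_all add: big_def)
  next
    have "1 \<le> (\<Sum>i<2 * ?q - 1. ?n (Suc i))"
      using member_le_sum[of 0 "{..<2 * ?q - 1}"
          "\<lambda>i. ?n (Suc i)"] q node_size_ge_1[of k ?q "t div b" 1] by simp
    then have "30 * ?b * 1 \<le> 30 * ?X * (\<Sum>i<2 * ?q - 1. ?n (Suc i))" using X1 by (intro mult_mono) auto
    then show "30 * ?b + 119000 * (?X * (\<Sum>i<2 * ?q - 1. ?n (Suc i))) \<le> \<tau>" using tau by linarith
  qed
qed

section \<open>Combining the residue classes\<close>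

abbreviation Neq :: "expr \<Rightarrow> expr \<Rightarrow> expr" where
  "Neq e f \<equiv> Add (Sub e f) (Sub f e)"

lemma nat_neq_iff_diff: "(a::nat) - b + (b - a) = 0 \<longleftrightarrow> a = b"
  by linarith

definition select :: com where
  "select = (''q'' ::= Const 0 ;; ''i'' ::= Const 0) ;;
    While (Sub (V ''m'') (V ''i''))
      (Ite (Neq (Mod (Elem ''x'' (V ''i'')) (V ''b'')) (V ''l'')) Skip
        (Put ''y'' (V ''q'') (Quot (Elem ''x'' (V ''i'')) (V ''b''))
            ;; ''q'' ::= Add (V ''q'') (Const 1)) ;;
       ''i'' ::= Add (V ''i'') (Const 1))"

lemma writes_select [simp]: "writes select = {''q'', ''i'', ''y''}"
  by (auto simp: select_def)

lemma runs_select: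
  assumes bd: "bounded M s" and par: "s ''m'' 0 = length xs" "\<And>i. i < length xs \<Longrightarrow> s ''x'' i = xs ! i"
      "s ''b'' 0 = b" "s ''l'' 0 = l" and M: "length xs \<le> M"
    and tau: "200 * (length xs + 1) * bits M \<le> \<tau>"
  shows "runs select s \<tau> (\<lambda>s'. bounded M s' \<and> s' ''q'' 0 = length (filter (\<lambda>x. x mod b = l) xs) \<and>
    (\<forall>i<length (filter (\<lambda>x. x mod b = l) xs). s' ''y'' i = filter (\<lambda>x. x mod b = l) xs ! i div b))"
proof -
  let ?P = "\<lambda>x. x mod b = l"
  let ?f = "\<lambda>j. filter ?P (take j xs)"
  let ?I = "\<lambda>j s'. bounded M s' \<and> s' ''i'' 0 = j \<and> s' ''q'' 0 = length (?f j)
      \<and> (\<forall>i<length (?f j). s' ''y'' i = ?f j ! i div b)"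
  let ?i = "''q'' ::= Const 0 ;; ''i'' ::= Const 0"
  let ?c = "Ite (Neq (Mod (Elem ''x'' (V ''i'')) (V ''b'')) (V ''l'')) Skip
        (Put ''y'' (V ''q'') (Quot (Elem ''x'' (V ''i'')) (V ''b''))
            ;; ''q'' ::= Add (V ''q'') (Const 1)) ;;
       ''i'' ::= Add (V ''i'') (Const 1)"
  show ?thesis
    unfolding select_def
  proof (rule runs_Seq)
    show "runs ?i s (10 * bits M) (?I 0)"
      by (rule runs_chk[where \<beta> = "bits M", OF bd]) auto
  next
    fix s1 assume I0: "?I 0 s1" and fr: "\<And>a. a \<notin> writes ?i \<Longrightarrow> s1 a = s a"
    show "runs (While (Sub (V ''m'') (V ''i'')) ?c) s1 (180 * (length xs + 1) * bits M)
       (\<lambda>s'. bounded M s' \<and> s' ''q'' 0 = length (filter ?P xs)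
           \<and> (\<forall>i<length (filter ?P xs). s' ''y'' i = filter ?P xs ! i div b))"
    proof (rule runs_loop[where I = ?I and n = "length xs" and M = M and \<beta> = "bits M"
        and \<tau> = "\<lambda>_. 150 * bits M"])
      show "?I 0 s1" by (rule I0)
    next
      fix j s' assume j: "j < length xs" and I: "?I j s'" and fr': "\<And>a. a \<notin> writes ?c \<Longrightarrow> s' a = s1 a"
      have v: "s' ''m'' 0 = length xs" "s' ''x'' j = xs ! j" "s' ''b'' 0 = b"
          "s' ''l'' 0 = l" using fr fr' par j by simp_all
      have xM: "xs ! j \<le> M" using boundedD[OF bd, of "''x''" j] par(2)[OF j] by (simp add: big_def)
      then have xM': "xs ! j div b \<le> M" using div_le_dividend le_trans by blast
      have lf: "length (?f j) \<le> j" using length_filter_le[of ?P "take j xs"] by simp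
      have fS: "?f (Suc j) = (if ?P (xs ! j) then ?f j @ [xs ! j] else ?f j)"
        using j by (simp add: take_Suc_conv_app_nth)
      have "runs ?c s' (150 * bits M) (?I (Suc j))"
      proof (rule runs_chk[where M = M and \<beta> = "bits M"])
        show "chkc M (bits M) ?c s'" using I v xM' j M lf by (auto simp: big_def)
        assume b: "bounded M (fin ?c s')"
        show "?I (Suc j) (fin ?c s')"
        proof (cases "?P (xs ! j)")
          case True
          have f: "fin ?c s' ''i'' 0 = Suc j" "fin ?c s' ''q'' 0 = Suc (length (?f j))"
            "fin ?c s' ''y'' = (s' ''y'')(length (?f j) := xs ! j div b)"
            using I v True by (simp_all add: mod_div_minus)
          show ?thesis unfolding f fS using b True I by (simp add: nth_append less_Suc_eq)
        next
          case False
          have "xs ! j mod b - l + (l - xs ! j mod b) \<noteq> 0" using False by (simp add: nat_neq_iff_diff)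
          then have f: "fin ?c s' ''i'' 0 = Suc j" "fin ?c s' ''q'' 0 = length (?f j)"
              "fin ?c s' ''y'' = s' ''y''"
            using I v by (simp_all add: mod_div_minus)
          show ?thesis unfolding f fS using b False I by simp
        qed
      qed (use I in simp_all)
      then show "ev (Sub (V ''m'') (V ''i'')) s' \<noteq> 0 \<and> chk (bits M) (Sub (V ''m'') (V ''i'')) s' \<and>
        runs ?c s' (150 * bits M) (?I (Suc j))" using I j v by (auto simp: big_def)
    next
      show "(\<Sum>j<length xs. 150 * bits M + (ecost (Sub (V ''m'') (V ''i''))
          + wt (Sub (V ''m'') (V ''i''))) * bits M) +
        (ecost (Sub (V ''m'') (V ''i'')) + wt (Sub (V ''m'') (V ''i''))) * bits M \<le> 180 * (length xs
            + 1) * bits M"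
        unfolding cost_Sub_V by (simp add: algebra_simps)
    qed (use par fr in \<open>auto simp: big_def\<close>)
  next
    have "10 * bits M + 180 * (length xs + 1) * bits M \<le> 200 * (length xs + 1) * bits M"
        by (simp add: algebra_simps)
    then show "10 * bits M + 180 * (length xs + 1) * bits M \<le> \<tau>" using tau by linarith
  qed
qed

definition combine :: "nat \<Rightarrow> com" where
  "combine k = (''l1'' ::= Const 0 ;; ''h1'' ::= V ''nA'' ;; ''l2'' ::= Elem ''st'' (Const 1)
      ;; ''h2'' ::= Elem ''en'' (Const 1) ;;
     ''J'' ::= Const 1 ;; ''lim'' ::= V ''tm'' ;; ''S'' ::= Add (Mul (Const 2) (V ''tm'')) (Const 1) ;;
     ''U1'' ::= V ''l'' ;; ''U2'' ::= V ''b'' ;; ''Y1'' ::= V ''l'' ;; ''Y2'' ::= V ''b''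
         ;; ''p'' ::= Const 0) ;;
   convolve k ''A'' ''L'' ''A'' ;; ''nA'' ::= V ''p''"

lemma writes_combine: "writes (combine k)
    = scratch - {''i'', ''a'', ''st'', ''en'', ''v'', ''L''} \<union> {''A'', ''nA''}"
  by (auto simp: combine_def scratch_def)

abbreviation target_box :: "nat \<Rightarrow> nat \<Rightarrow> nat" where
  "target_box k t \<equiv> (2 * t + 1) ^ k"

lemma runs_combine:
  assumes bd: "bounded M s" and M: "4 * (k + 1) * D ^ (2 * k + 3) \<le> M"
      and D: "2 * length ys + 2 * t + 1 \<le> D"
    and ys: "distinct ys" "\<And>e. e \<in> set ys \<Longrightarrow> e mod b = l" and b: "l < b" "b \<le> D"
    and fin: "finite E" "E \<inter> set ys = {}"
    and par: "s ''D'' 0 = D" "s ''tm'' 0 = t" "s ''b'' 0 = b" "s ''l'' 0 = l" "s ''nA'' 0 = nA"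
    and A: "s ''A'' ` {0..<nA} = reach k D (\<lambda>_. 0) id t E" "nA \<le> 2 * target_box k t"
    and L: "s ''st'' 1 = l2" "s ''en'' 1 = h2" "l2 \<le> h2"
      "s ''L'' ` {l2..<h2} = reach k D (\<lambda>_. 1) (\<lambda>e. e div b) (t div b) (set ys)"
    and tau: "70000 * ((k + 1)^2 * (target_box k t + (h2 - l2)) * bits M ^ 2) \<le> \<tau>"
  shows "runs (combine k) s \<tau> (\<lambda>s'. bounded M s' \<and> s' ''nA'' 0 \<le> 2 * target_box k t \<and>
    s' ''A'' ` {0..<s' ''nA'' 0} = reach k D (\<lambda>_. 0) id t (E \<union> set ys))"
proof -
  let ?b = "bits M" and ?S = "2 * t + 1"
  have le: "1 \<le> D" "t < D" "?S \<le> D" "l \<le> D" using D b by linarith+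
  note lb = bounds_from_radix[OF M le(1)]
  have bM: "2 \<le> ?b" using bits_mono[of 2 M] lb(6) by simp
  have SM: "?S \<le> M" using le lb(8) by linarith
  have box: "1 \<le> target_box k t" by simp
  let ?i = "''l1'' ::= Const 0 ;; ''h1'' ::= V ''nA'' ;; ''l2'' ::= Elem ''st'' (Const 1)
      ;; ''h2'' ::= Elem ''en'' (Const 1) ;;
     ''J'' ::= Const 1 ;; ''lim'' ::= V ''tm'' ;; ''S'' ::= Add (Mul (Const 2) (V ''tm'')) (Const 1) ;;
     ''U1'' ::= V ''l'' ;; ''U2'' ::= V ''b'' ;; ''Y1'' ::= V ''l'' ;; ''Y2'' ::= V ''b''
         ;; ''p'' ::= Const 0"
  have rM: "nA \<le> M" "l2 \<le> M" "h2 \<le> M" "t \<le> M" "l \<le> M" "b \<le> M"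
    using boundedD[OF bd] par L by (fastforce simp: big_def)+
  have "runs ?i s (100 * ?b) (\<lambda>s'. bounded M s' \<and> s' ''l1'' 0 = 0 \<and> s' ''h1'' 0 = nA \<and> s' ''l2'' 0 = l2
      \<and> s' ''h2'' 0 = h2 \<and>
     s' ''J'' 0 = 1 \<and> s' ''lim'' 0 = t \<and> s' ''S'' 0 = ?S \<and> s' ''U1'' 0 = l \<and> s' ''U2'' 0 = b
         \<and> s' ''Y1'' 0 = l \<and> s' ''Y2'' 0 = b \<and>
     s' ''p'' 0 = 0)"
    by (rule runs_chk[where M = M and \<beta> = ?b]) (use bd par bM L rM SM lb(5) in \<open>simp_all add: big_def\<close>)
  then obtain T1 s1 where 1: "exec ?i s T1 s1" "T1 \<le> 100 * ?b" "bounded M s1"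
     "s1 ''l1'' 0 = 0" "s1 ''h1'' 0 = nA" "s1 ''l2'' 0 = l2" "s1 ''h2'' 0 = h2"
     "s1 ''J'' 0 = 1" "s1 ''lim'' 0 = t" "s1 ''S'' 0 = ?S" "s1 ''U1'' 0 = l" "s1 ''U2'' 0 = b"
         "s1 ''Y1'' 0 = l" "s1 ''Y2'' 0 = b"
     "s1 ''p'' 0 = 0"
     and fr1: "\<And>a. a \<notin> writes ?i \<Longrightarrow> s1 a = s a"
    by (rule runsE) blast
  have p1: "s1 ''D'' 0 = D" "s1 ''A'' = s ''A''" "s1 ''L'' = s ''L''" using fr1 par by simp_all
  have card: "card (set ys) < D" using card_length[of ys] D by linarith
  have J: "sum (\<lambda>_. 0) (E \<union> set ys) < (1::nat)" "1 \<le> D" using le by simp_all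
  have S2: "2 * t < ?S" by simp
  have b0: "0 < b" using b by linarith
  let ?R = "reach k D (\<lambda>_. 1) (\<lambda>e. e div b) (t div b) (set ys)"
  have Y: "{rval k D D l b (1 * ?S) y | y. y \<in> ?R \<and> rok k D D l b t y} =
    {enc k 1 ?S (part_sum (\<lambda>_. 0) \<phi> (set ys)) (part_sum id \<phi> (set ys)) | \<phi>. \<forall>i<k. part_sum id \<phi> (set ys) i
        \<le> t}"
    by (rule reach_residue_class[OF finite_set card le(2) b0]) (rule ys(2))
  obtain T2 s2 where 2: "exec (convolve k ''A'' ''L'' ''A'') s1 T2 s2"
    "T2 \<le> 20000 * ((k + 1)^2 * ((1 * ?S) ^ k + (nA - 0) + (h2 - l2)) * ?b ^ 2)"
    "bounded M s2" "0 \<le> s2 ''p'' 0" "s2 ''p'' 0 \<le> 0 + 2 * (1 * ?S) ^ k"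
    "s2 ''A'' ` {0..<s2 ''p'' 0} = rval k 1 ?S 1 D (D * D) ` {z. rok k 1 ?S 0 1 t z \<and>
      (\<exists>x\<in>s1 ''A'' ` {0..<nA}. \<exists>y\<in>s1 ''L'' ` {l2..<h2}. rok k D D 0 1 t x \<and> rok k D D l b t y \<and>
        z = rval k D D 1 1 (1 * ?S) x + rval k D D l b (1 * ?S) y)}"
    "\<forall>i<0. s2 ''A'' i = s1 ''A'' i"
  proof (rule runsE[OF runs_convolve[of "''A''" "''L''"
      "''A''", OF _ _ _ 1(3) lb(4,5) p1(1) 1(8,10,9,11-14,4-7,15) le(1) _ _ _ L(3)
        _ _ lb(2,3) _ _ _ _ _ order_refl]])
    show "rval k D D 1 1 (1 * ?S) x + rval k D D l b (1 * ?S) y < (1 * ?S) ^ k"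
      if "x \<in> s1 ''A'' ` {0..<nA}" "y \<in> s1 ''L'' ` {l2..<h2}" "rok k D D 0 1 t x"
          "rok k D D l b t y" for x y
      by (rule reach_sums_less[OF fin(1) finite_set fin(2) J S2 le(3) Y
          that(1)[unfolded p1 A] that(2)[unfolded p1 L] that(4)])
    show "4 * (1 * ?S) ^ k \<le> M" "1 * ?S \<le> M" using lb(9)[OF le(1,3)] by simp_all
    show "0 + 2 * (1 * ?S) ^ k \<le> M" using lb(9)[OF le(1,3)] by simp
    have SD: "?S \<le> D * D" using le(1,3) mult_le_mono[of 1 D ?S D] by simp
    show "rval k D D 1 1 (1 * ?S) x \<le> M" "rval k D D l b (1 * ?S) x \<le> M" for x
      by (intro lb(10); use le b SD in simp)+
    show "rval k 1 ?S 1 D (D * D) x \<le> M" for x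
      by (intro lb(10); use le in simp)
    show "(1::nat) \<le> 1" "1 \<le> ?S" "0 \<le> nA" by simp_all
  qed (simp, simp, simp, elim conjE, blast)
  have r: "s2 ''A'' ` {0..<s2 ''p'' 0} = reach k D (\<lambda>_. 0) id t (E \<union> set ys)"
    unfolding 2(6) p1 A L
    by (rule reach_convolve[OF fin(1) finite_set fin(2) J S2 le(3) Y])
  have "s2 ''p'' 0 \<le> M" using boundedD[OF 2(3)] by (simp add: big_def)
  then have "runs (''nA'' ::= V ''p'') s2 (10 * ?b) (\<lambda>s'. bounded M s' \<and> s' ''nA'' 0 \<le> 2 * target_box k t \<and>
    s' ''A'' ` {0..<s' ''nA'' 0} = reach k D (\<lambda>_. 0) id t (E \<union> set ys))"
    by (intro runs_chk[where M = M and \<beta> = ?b]) (use 2(3,5) r in \<open>simp_all add: big_def\<close>)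
  then obtain T3 s3 where 3: "exec (''nA'' ::= V ''p'') s2 T3 s3" "T3 \<le> 10 * ?b"
    "bounded M s3 \<and> s3 ''nA'' 0 \<le> 2 * target_box k t \<and>
    s3 ''A'' ` {0..<s3 ''nA'' 0} = reach k D (\<lambda>_. 0) id t (E \<union> set ys)"
    by (rule runsE)
  show ?thesis
    unfolding combine_def
  proof (rule runsI[OF exec.Seq[OF 1(1) exec.Seq[OF 2(1) 3(1)]]])
    have "T2 \<le> 20000 * ((k + 1)^2 * (3 * (target_box k t + (h2 - l2))) * ?b ^ 2)"
      by (rule le_trans[OF 2(2)], intro mult_le_mono2 mult_le_mono1) (use A in simp)
    moreover have "1 * 1 * (?b * 1) \<le> (k + 1)^2 * (target_box k t + (h2 - l2)) * ?b ^ 2"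
      unfolding power2_eq_square[of ?b] by (intro mult_mono trans_le_add1[OF box]) simp_all
    ultimately have "T1 + (T2 + T3) \<le> 70000 * ((k + 1)^2 * (target_box k t + (h2 - l2)) * ?b ^ 2)"
      using 1(2) 3(2) by (simp add: algebra_simps)
    then show "T1 + (T2 + T3) \<le> \<tau>" using tau by linarith
  qed (rule 3(3))
qed

definition process_class :: "nat \<Rightarrow> com" where
  "process_class k = select ;; Ite (V ''q'') (block k ;; combine k) Skip
      ;; ''l'' ::= Add (V ''l'') (Const 1)"

lemma writes_process_class: "writes (process_class k) = scratch \<union> {''q'', ''y'', ''A'', ''nA'', ''l''}"
  by (auto simp: process_class_def writes_combine scratch_def)

definition class_cost :: "nat \<Rightarrow> nat list \<Rightarrow> nat \<Rightarrow> nat \<Rightarrow> nat \<Rightarrow> nat" where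
  "class_cost k xs t b l = (let q = length (filter (\<lambda>x. x mod b
      = l) xs) in \<Sum>i<2 * q - 1. node_size k q (t div b) (Suc i))"

definition class_state :: "nat \<Rightarrow> nat \<Rightarrow> nat \<Rightarrow> nat list \<Rightarrow> nat \<Rightarrow> nat \<Rightarrow> nat \<Rightarrow> store \<Rightarrow> bool" where
  "class_state M k D xs t b l s \<longleftrightarrow> bounded M s \<and> s ''l'' 0 = l \<and> s ''nA'' 0 \<le> 2 * target_box k t \<and>
    s ''A'' ` {0..<s ''nA'' 0} = reach k D (\<lambda>_. 0) id t {x \<in> set xs. x mod b < l}"

lemma runs_process_class:
  assumes st: "class_state M k D xs t b l s" and M: "4 * (k + 1) * D ^ (2 * k + 3) \<le> M"
      and D: "2 * length xs + 2 * t + 1 \<le> D"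
    and xs: "distinct xs" "\<And>e. e \<in> set xs \<Longrightarrow> e \<le> t" and b: "l < b" "b \<le> D"
    and par: "s ''D'' 0 = D" "s ''tm'' 0 = t" "s ''b'' 0 = b" "s ''m'' 0 = length xs" "\<And>i. i < length xs
        \<Longrightarrow> s ''x'' i = xs ! i"
    and tau: "270000 * ((k + 1)^2 * bits M ^ 2 * (length xs + target_box k t + class_cost k xs t b l)) \<le> \<tau>"
  shows "runs (process_class k) s \<tau> (class_state M k D xs t b (Suc l))"
proof -
  define ys where "ys = filter (\<lambda>x. x mod b = l) xs"
  let ?q = "length ys" and ?b = "bits M" and ?X = "(k + 1)^2 * bits M ^ 2"
  have q: "?q \<le> length xs" unfolding ys_def by (rule length_filter_le)
  have ys: "distinct ys" "\<And>e. e \<in> set ys \<Longrightarrow> e mod b = l" "\<And>e. e \<in> set ys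
      \<Longrightarrow> e \<le> t" using xs by (auto simp: ys_def)
  have Dy: "2 * ?q + 2 * t + 1 \<le> D" using q D by linarith
  have D1: "1 \<le> D" using D by linarith
  note lb = bounds_from_radix[OF M D1]
  have box: "1 \<le> target_box k t" by simp
  have bM: "2 \<le> ?b" using bits_mono[of 2 M] lb(6) by simp
  have X1: "?b \<le> ?X"
    using mult_mono[of 1 "(k + 1)^2" "?b * 1" "?b * ?b"] bM by (simp add: power2_eq_square)
  have bd: "bounded M s" "s ''l'' 0 = l" "s ''nA'' 0 \<le> 2 * target_box k t"
    "s ''A'' ` {0..<s ''nA'' 0} = reach k D (\<lambda>_. 0) id t {x \<in> set xs. x mod b < l}"
    using st unfolding class_state_def by blast+
  have xM: "length xs \<le> M" using D lb(8) by linarith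
  obtain T1 s1 where 1: "exec select s T1 s1" "T1 \<le> 200 * (length xs + 1) * ?b" "bounded M s1"
      "s1 ''q'' 0 = ?q"
    "\<forall>i<?q. s1 ''y'' i = ys ! i div b" and fr1: "\<And>a. a \<notin> writes select \<Longrightarrow> s1 a = s a"
    by (rule runsE[OF runs_select[OF bd(1) par(4,5,3) bd(2) xM order_refl]], assumption) (unfold ys_def,
        blast)
  have p1: "s1 ''D'' 0 = D" "s1 ''tm'' 0 = t" "s1 ''b'' 0 = b" "s1 ''l'' 0 = l" "s1 ''nA'' = s ''nA''"
      "s1 ''A'' = s ''A''"
    using fr1 par bd by simp_all
  have b1: "1 \<le> b" using b by linarith
  let ?c = class_cost
  have cc: "class_cost k xs t b l = (\<Sum>i<2 * ?q - 1. node_size k ?q (t div b) (Suc i))"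
    unfolding class_cost_def ys_def Let_def ..
  have un: "{x \<in> set xs. x mod b < Suc l} = {x \<in> set xs. x mod b < l} \<union> set ys"
    by (auto simp: ys_def less_Suc_eq)
  let ?Q = "\<lambda>s2. bounded M s2 \<and> s2 ''l'' 0 = l \<and> s2 ''nA'' 0 \<le> 2 * target_box k t \<and>
    s2 ''A'' ` {0..<s2 ''nA'' 0} = reach k D (\<lambda>_. 0) id t {x \<in> set xs. x mod b < Suc l}"
  have "runs (Ite (V ''q'') (block k ;; combine k) Skip) s1 (260050 * (?X * (target_box k t
      + class_cost k xs t b l))) ?Q"
  proof (rule runs_Ite[where \<beta> = ?b and \<tau> = "260000 * (?X * (target_box k t + class_cost k xs t b l))"])
    show "okx ?b (V ''q'') s1" by (rule chk_okx[OF 1(3)]) (auto simp: big_def)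
  next
    assume "ev (V ''q'') s1 \<noteq> 0"
    then have ne: "ys \<noteq> []" using 1(4) by simp
    obtain T2 s2 where 2: "exec (block k) s1 T2 s2"
        "T2 \<le> 120000 * ((k + 1)^2 * ?b ^ 2 * class_cost k xs t b l)"
      "bounded M s2" "s2 ''st'' 1 \<le> s2 ''en'' 1"
          "s2 ''en'' 1 \<le> s2 ''st'' 1 + 2 * node_size k ?q (t div b) 1"
      "s2 ''L'' ` {s2 ''st'' 1..<s2 ''en'' 1} = reach k D (\<lambda>_. 1) (\<lambda>e. e div b) (t div b) (set ys)"
      and fr2: "\<And>a. a \<notin> writes (block k) \<Longrightarrow> s2 a = s1 a"
      by (rule runsE[OF runs_block[OF 1(3) M Dy ys(1) ne ys(3) b1 p1(1) 1(4) p1(2,3) 1(5)[rule_format]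
          order_refl]],
        assumption, assumption) (unfold cc, blast)
    have p2: "s2 ''D'' 0 = D" "s2 ''tm'' 0 = t" "s2 ''b'' 0 = b" "s2 ''l'' 0 = l" "s2 ''nA'' = s ''nA''"
        "s2 ''A'' = s ''A''"
      using fr2 p1 by (simp_all add: scratch_def)
    have fe: "finite {x \<in> set xs. x mod b < l}"
        "{x \<in> set xs. x mod b < l} \<inter> set ys = {}" by (auto simp: ys_def)
    have "s2 ''A'' ` {0..<s ''nA'' 0} = reach k D (\<lambda>_. 0) id t {x \<in> set xs. x mod b < l}" unfolding p2
        by (rule bd(4))
    note r = runs_combine[OF 2(3) M Dy ys(1,2) b fe p2(1-4) arg_cong[OF p2(5), of "\<lambda>f. f 0"] this bd(3) refl
        refl 2(4) 2(6) order_refl]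
    obtain T3 s3 where 3: "exec (combine k) s2 T3 s3"
      "T3 \<le> 70000 * ((k + 1)^2 * (target_box k t + (s2 ''en'' 1 - s2 ''st'' 1)) * ?b ^ 2)"
      "bounded M s3" "s3 ''nA'' 0 \<le> 2 * target_box k t"
      "s3 ''A'' ` {0..<s3 ''nA'' 0} = reach k D (\<lambda>_. 0) id t ({x \<in> set xs. x mod b < l} \<union> set ys)"
      and fr3: "\<And>a. a \<notin> writes (combine k) \<Longrightarrow> s3 a = s2 a"
      by (rule runsE[OF r], assumption) blast
    have p3: "s3 ''l'' 0 = l" using fr3 p2 by (simp add: writes_combine scratch_def)
    show "runs (block k ;; combine k) s1 (260000 * (?X * (target_box k t + class_cost k xs t b l))) ?Q"
    proof (rule runsI[OF exec.Seq[OF 2(1) 3(1)]])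
      have "node_size k ?q (t div b) (Suc 0) \<le> class_cost k xs t b l"
        unfolding cc by (rule member_le_sum[of 0 "{..<2 * ?q - 1}" "\<lambda>i. node_size k ?q (t div b) (Suc i)"])
          (use ne in \<open>cases ys; simp\<close>)+
      then have len: "s2 ''en'' 1 - s2 ''st'' 1 \<le> 2 * class_cost k xs t b l" using 2(5) by simp
      have "T3 \<le> 70000 * ((k + 1)^2 * (2 * (target_box k t + class_cost k xs t b l)) * ?b ^ 2)"
        by (rule le_trans[OF 3(2)], intro mult_le_mono2 mult_le_mono1) (use len in simp)
      also have "\<dots> = 140000 * (?X * (target_box k t + class_cost k xs t b l))"
          by (simp add: mult.assoc mult.commute mult.left_commute)
      finally have "T3 \<le> 140000 * (?X * (target_box k t + class_cost k xs t b l))" .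
      moreover have "120000 * (?X * class_cost k xs t b l) \<le> 120000 * (?X * (target_box k t
          + class_cost k xs t b l))" by simp
      ultimately show "T2 + T3 \<le> 260000 * (?X * (target_box k t + class_cost k xs t b l))" using 2(2)
          by linarith
      show "?Q s3" using 3(3-5) p3 unfolding un by blast
    qed
  next
    assume "ev (V ''q'') s1 = 0"
    then have "ys = []" using 1(4) by simp
    then have "{x \<in> set xs. x mod b < Suc l} = {x \<in> set xs. x mod b < l}" unfolding un by simp
    then have "?Q s1" using 1(3) p1 bd by simp
    moreover have "1 * ?b * 1 \<le> 260000 * ?X * (target_box k t + class_cost k xs t b l)"
      using X1 by (intro mult_mono trans_le_add1 box) auto
    ultimately show "runs Skip s1 (260000 * (?X * (target_box k t + class_cost k xs t b l))) ?Q"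
      by (intro runs_chk[where M = M and \<beta> = ?b]) (use 1(3) in \<open>simp_all add: mult.assoc\<close>)
  next
    have "4 * ?b * 1 \<le> 50 * ?X * (target_box k t + class_cost k xs t b l)"
      using X1 by (intro mult_mono trans_le_add1 box) auto
    then show "(ecost (V ''q'') + wt (V ''q'')) * ?b + 260000 * (?X * (target_box k t
        + class_cost k xs t b l))
      \<le> 260050 * (?X * (target_box k t + class_cost k xs t b l))" unfolding cost_V by linarith
  qed
  then obtain T2 s2 where 2: "exec (Ite (V ''q'') (block k ;; combine k) Skip) s1 T2 s2"
    "T2 \<le> 260050 * (?X * (target_box k t + class_cost k xs t b l))" "?Q s2"
    by (rule runsE)
  have lM: "Suc l \<le> M" using b lb(8) by linarith
  have "runs (''l'' ::= Add (V ''l'') (Const 1)) s2 (20 * ?b) (class_state M k D xs t b (Suc l))"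
    by (rule runs_chk[where M = M and \<beta> = ?b]) (use 2(3) lM in \<open>simp_all add: big_def class_state_def\<close>)
  then obtain T3 s3 where 3: "exec (''l'' ::= Add (V ''l'') (Const 1)) s2 T3 s3" "T3 \<le> 20 * ?b"
      "class_state M k D xs t b (Suc l) s3"
    by (rule runsE)
  show ?thesis
    unfolding process_class_def
  proof (rule runsI[OF exec.Seq[OF 1(1) exec.Seq[OF 2(1) 3(1)]]])
    have "200 * (length xs + 1) * ?b \<le> 200 * ((length xs + target_box k t) * ?X)"
      unfolding mult.assoc by (intro mult_le_mono order_refl X1[unfolded mult.assoc]) (use box in simp)
    moreover have "?b * 1 \<le> ?X * target_box k t" using X1 box by (intro mult_mono) auto
    ultimately have "T1 + (T2 + T3) \<le> 270000 * (?X * (length xs + target_box k t + class_cost k xs t b l))"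
      using 1(2) 2(2) 3(2) by (simp add: algebra_simps)
    then show "T1 + (T2 + T3) \<le> \<tau>" using tau by linarith
  qed (rule 3(3))
qed

section \<open>The complete program\<close>

definition residue_base :: "nat \<Rightarrow> nat \<Rightarrow> nat" where
  "residue_base k m = (LEAST b. m ^ k \<le> b ^ (k + 1))"

lemma residue_base:
  assumes "1 \<le> m"
  shows "m ^ k \<le> residue_base k m ^ (k + 1)" "residue_base k m \<le> m" "1 \<le> residue_base k m"
    and "b < residue_base k m \<Longrightarrow> b ^ (k + 1) < m ^ k"
proof -
  have m: "m ^ k \<le> m ^ (k + 1)" using assms by simp
  show 1: "m ^ k \<le> residue_base k m ^ (k + 1)" unfolding residue_base_def by (rule LeastI) (rule m)
  show "residue_base k m \<le> m" unfolding residue_base_def by (rule Least_le) (rule m)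
  have pos: "1 \<le> m ^ k" using assms by simp
  show "1 \<le> residue_base k m"
  proof (rule ccontr)
    assume "\<not> 1 \<le> residue_base k m"
    then have z: "residue_base k m = 0" by simp
    have "m ^ k \<le> 0" using 1 unfolding z by simp
    with pos show False by linarith
  qed
  show "b ^ (k + 1) < m ^ k" if "b < residue_base k m"
    using not_less_Least[OF that[unfolded residue_base_def]] by simp
qed

definition find_base :: "nat \<Rightarrow> com" where
  "find_base k = ''b'' ::= Const 1 ;;
    While (Sub (epow (V ''m'') k) (epow (V ''b'') (k + 1))) (''b'' ::= Add (V ''b'') (Const 1))"

lemma runs_find_base:
  assumes bd: "bounded M s" and par: "s ''m'' 0 = m" and m: "1 \<le> m" "m < M"
    and tau: "100 * (k + 2)^2 * (m + 1) * bits M \<le> \<tau>"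
  shows "runs (find_base k) s \<tau> (\<lambda>s'. bounded M s' \<and> s' ''b'' 0 = residue_base k m)"
proof -
  let ?B = "residue_base k m" and ?b = "bits M"
  note B = residue_base[where k = k, OF m(1)]
  let ?e = "Sub (epow (V ''m'') k) (epow (V ''b'') (k + 1))"
  let ?c = "''b'' ::= Add (V ''b'') (Const 1)"
  have kk: "(k + 1)^2 \<le> (k + 2)^2" "k + 2 \<le> (k + 2)^2" "1 \<le> (k + 2)^2" by (simp_all add: power2_eq_square)
  have ce: "ecost ?e + wt ?e \<le> 20 * (k + 2)^2"
  proof -
    have "ecost (epow (V ''m'') k) \<le> 6 * (k + 1)^2" using ecost_epow[of "V ''m''" k] by simp
    moreover have "ecost (epow (V ''b'') (k + 1)) \<le> 6 * (k + 2)^2" using ecost_epow[of "V ''b''"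
        "k + 1"] by simp
    moreover have "ecost ?e + wt ?e = ecost (epow (V ''m'') k) + ecost (epow (V ''b'') (k + 1)) + (k + 1)
        + (k + 2) + (k + 1)"
      by (simp only: ecost.simps wt.simps wt_epow) simp
    ultimately show ?thesis using kk by linarith
  qed
  let ?I = "\<lambda>j s'. bounded M s' \<and> s' ''b'' 0 = Suc j"
  show ?thesis
    unfolding find_base_def
  proof (rule runs_Seq)
    show "runs (''b'' ::= Const 1) s (10 * ?b) (?I 0)"
      by (rule runs_chk[where \<beta> = "?b", OF bd]) (use m in \<open>auto simp: big_def\<close>)
  next
    fix s1 assume I0: "?I 0 s1" and fr: "\<And>a. a \<notin> writes (''b'' ::= Const 1) \<Longrightarrow> s1 a = s a"
    show "runs (While ?e ?c) s1 (80 * (k + 2)^2 * (m + 1) * ?b) (\<lambda>s'. bounded M s' \<and> s' ''b'' 0 = ?B)"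
    proof (rule runs_loop[where I = ?I and n = "?B - 1" and M = M and \<beta> = ?b and \<tau> = "\<lambda>_. 20 * ?b"])
      show "?I 0 s1" by (rule I0)
    next
      fix j s' assume j: "j < ?B - 1" and I: "?I j s'" and fr': "\<And>a. a \<notin> writes ?c \<Longrightarrow> s' a = s1 a"
      have v: "s' ''m'' 0 = m" using fr fr' par by simp
      have "Suc j ^ (k + 1) < m ^ k" by (rule B(4)) (use j in simp)
      moreover have "Suc (Suc j) \<le> M" using j B(2) m(2) by linarith
      then have "runs ?c s' (20 * ?b) (?I (Suc j))"
        by (intro runs_chk[where M = M and \<beta> = ?b]) (use I in \<open>auto simp: big_def\<close>)
      ultimately show "ev ?e s' \<noteq> 0 \<and> chk ?b ?e s' \<and> runs ?c s' (20 * ?b) (?I (Suc j))"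
        using I v by (auto simp: big_def)
    next
      fix s' assume I: "?I (?B - 1) s'" and fr': "\<And>a. a \<notin> writes ?c \<Longrightarrow> s' a = s1 a"
      have v: "s' ''m'' 0 = m" using fr fr' par by simp
      have b: "s' ''b'' 0 = ?B" using I B(3) by simp
      show "ev ?e s' = 0 \<and> chk ?b ?e s'" using v b B(1) by (auto simp: big_def)
      show "bounded M s' \<and> s' ''b'' 0 = ?B" using I b by blast
    next
      have "(\<Sum>j<?B - 1. 20 * ?b + (ecost ?e + wt ?e) * ?b) + (ecost ?e + wt ?e) * ?b
        \<le> (\<Sum>j<?B - 1. 20 * ((k + 2)^2 * ?b) + 20 * (k + 2)^2 * ?b) + 20 * (k + 2)^2 * ?b"
        by (intro add_mono sum_mono mult_le_mono1 ce) (use kk in simp)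
      also have "\<dots> = (40 * (?B - 1) + 20) * ((k + 2)^2 * ?b)" by (simp add: algebra_simps)
      also have "\<dots> \<le> (80 * (m + 1)) * ((k + 2)^2 * ?b)" by (intro mult_le_mono1) (use B(2) in simp)
      also have "\<dots> = 80 * (k + 2)^2 * (m + 1) * ?b" by (simp only: mult_ac)
      finally show "(\<Sum>j<?B - 1. 20 * ?b + (ecost ?e + wt ?e) * ?b) + (ecost ?e + wt ?e) * ?b \<le> 80 * (k
          + 2)^2 * (m + 1) * ?b" .
    qed simp_all
  next
    have "10 * 1 * ?b \<le> 20 * (k + 2)^2 * (m + 1) * ?b" by (intro mult_mono) (use kk in auto)
    then show "10 * ?b + 80 * (k + 2)^2 * (m + 1) * ?b \<le> \<tau>" using tau by (simp add: algebra_simps)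
  qed
qed

definition target_code :: "nat \<Rightarrow> com" where
  "target_code k = (''r'' ::= Const 0 ;; ''w'' ::= V ''D'' ;; ''i'' ::= Const 0) ;;
    While (Sub (Const k) (V ''i''))
      (''r'' ::= Add (V ''r'') (Mul (V ''w'') (Elem ''t'' (V ''i''))) ;;
       ''w'' ::= Mul (V ''w'') (Mul (V ''D'') (V ''D'')) ;; ''i'' ::= Add (V ''i'') (Const 1))"

lemma runs_target_code:
  assumes bd: "bounded M s" and M: "4 * (k + 1) * D ^ (2 * k + 3) \<le> M"
    and par: "s ''D'' 0 = D" "\<And>i. i < k \<Longrightarrow> s ''t'' i = ts ! i" "\<And>i. i < k \<Longrightarrow> ts ! i < D" "1 \<le> D"
    and tau: "100 * (k + 1) * bits M \<le> \<tau>"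
  shows "runs (target_code k) s \<tau> (\<lambda>s'. bounded M s' \<and> s' ''r'' 0 = enc k D D (\<lambda>_. 0) (\<lambda>i. ts ! i))"
proof -
  note lb = bounds_from_radix[OF M par(4)]
  let ?E = "\<lambda>j. enc j D D (\<lambda>_. 0) (\<lambda>i. ts ! i)"
  let ?I = "\<lambda>j s'. bounded M s' \<and> s' ''i'' 0 = j \<and> s' ''r'' 0 = ?E j \<and> s' ''w'' 0 = (D * D) ^ j * D"
  let ?i = "''r'' ::= Const 0 ;; ''w'' ::= V ''D'' ;; ''i'' ::= Const 0"
  let ?c = "''r'' ::= Add (V ''r'') (Mul (V ''w'') (Elem ''t'' (V ''i''))) ;;
       ''w'' ::= Mul (V ''w'') (Mul (V ''D'') (V ''D'')) ;; ''i'' ::= Add (V ''i'') (Const 1)"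
  have DM: "D \<le> M" using lb(8) by simp
  have pw: "(D * D) ^ j \<le> (D * D) ^ k" if "j \<le> k" for j using that par(4) by (intro power_increasing) auto
  show ?thesis
    unfolding target_code_def
  proof (rule runs_Seq)
    show "runs ?i s (20 * bits M) (?I 0)"
      by (rule runs_chk[where \<beta> = "bits M", OF bd]) (use par DM in \<open>auto simp: big_def enc_def\<close>)
  next
    fix s1 assume I0: "?I 0 s1" and fr: "\<And>a. a \<notin> writes ?i \<Longrightarrow> s1 a = s a"
    show "runs (While (Sub (Const k) (V ''i'')) ?c) s1 (80 * (k + 1) * bits M)
       (\<lambda>s'. bounded M s' \<and> s' ''r'' 0 = ?E k)"
    proof (rule runs_loop[where I = ?I and n = k and M = M and \<beta> = "bits M" and \<tau> = "\<lambda>_. 60 * bits M"])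
      show "?I 0 s1" by (rule I0)
      fix j s' assume j: "j < k" and I: "?I j s'" and fr': "\<And>a. a \<notin> writes ?c \<Longrightarrow> s' a = s1 a"
      have v: "s' ''D'' 0 = D" "s' ''t'' j = ts ! j" using fr fr' par j by simp_all
      have E: "?E j + (D * D) ^ j * D * (ts ! j) = ?E (Suc j)" by (simp add: enc_def algebra_simps)
      have w: "(D * D) ^ j * D * (D * D) = (D * D) ^ Suc j * D" by simp
      have "?E (Suc j) < (D * D) ^ Suc j" by (rule enc_less) (use par j in auto)
      then have 1: "?E (Suc j) \<le> M" using pw[of "Suc j"] j lb(3) by simp
      have "(D * D) ^ Suc j * D \<le> (D * D) ^ k * D" using pw[of "Suc j"] j by (intro mult_le_mono1) simp
      also have "\<dots> \<le> D * (2 * (D * D) ^ k)" by simp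
      finally have 2: "(D * D) ^ Suc j * D \<le> M" using lb(7) by linarith
      have 3: "Suc j \<le> M" "bits k \<le> bits M" using j lb(4) by (simp_all add: bits_mono)
      have "runs ?c s' (60 * bits M) (?I (Suc j))"
        by (rule runs_chk[where M = M and \<beta> = "bits M"])
            (use I v 1 2 3 in \<open>simp_all add: big_def E w del: power_Suc\<close>)
      then show "ev (Sub (Const k) (V ''i'')) s' \<noteq> 0 \<and> chk (bits M) (Sub (Const k) (V ''i'')) s' \<and>
        runs ?c s' (60 * bits M) (?I (Suc j))" using I j 3 by (auto simp: big_def)
    next
      show "ev (Sub (Const k) (V ''i'')) s' = 0
          \<and> chk (bits M) (Sub (Const k) (V ''i'')) s'" if "?I k s'" for s'
        using that lb(4) by (simp add: bits_mono big_def)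
    qed (simp_all add: algebra_simps)
  next
    have "20 * bits M + 80 * (k + 1) * bits M \<le> 100 * (k + 1) * bits M" by (simp add: algebra_simps)
    then show "20 * bits M + 80 * (k + 1) * bits M \<le> \<tau>" using tau by linarith
  qed
qed

definition search :: com where
  "search = ''i'' ::= Const 0 ;; While (Sub (V ''nA'') (V ''i''))
    (Ite (Neq (Elem ''A'' (V ''i'')) (V ''r'')) Skip (''out'' ::= Const 1)
        ;; ''i'' ::= Add (V ''i'') (Const 1))"

lemma runs_search:
  assumes bd: "bounded M s" and M: "1 \<le> M" and out: "s ''out'' 0 = 0"
    and tau: "100 * (s ''nA'' 0 + 1) * bits M \<le> \<tau>"
  shows "runs search s \<tau> (\<lambda>s'. bounded M s'
      \<and> s' ''out'' 0 = of_bool (s ''r'' 0 \<in> s ''A'' ` {0..<s ''nA'' 0}))"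
proof -
  define n where "n = s ''nA'' 0"
  have nM: "n \<le> M" using boundedD[OF bd] by (simp add: n_def big_def)
  let ?c = "Ite (Neq (Elem ''A'' (V ''i'')) (V ''r'')) Skip (''out'' ::= Const 1)
      ;; ''i'' ::= Add (V ''i'') (Const 1)"
  let ?I = "\<lambda>j s'. bounded M s' \<and> s' ''i'' 0 = j \<and> s' ''out'' 0 = of_bool (s ''r'' 0 \<in> s ''A'' ` {0..<j})"
  show ?thesis
    unfolding search_def
  proof (rule runs_Seq)
    show "runs (''i'' ::= Const 0) s (10 * bits M) (?I 0)"
      by (rule runs_chk[where \<beta> = "bits M", OF bd]) (use out in auto)
  next
    fix s1 assume I0: "?I 0 s1" and fr: "\<And>a. a \<notin> writes (''i'' ::= Const 0) \<Longrightarrow> s1 a = s a"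
    show "runs (While (Sub (V ''nA'') (V ''i'')) ?c) s1 (80 * (n + 1) * bits M)
       (\<lambda>s'. bounded M s' \<and> s' ''out'' 0 = of_bool (s ''r'' 0 \<in> s ''A'' ` {0..<s ''nA'' 0}))"
    proof (rule runs_loop[where I = ?I and n = n and M = M and \<beta> = "bits M" and \<tau> = "\<lambda>_. 60 * bits M"])
      show "?I 0 s1" by (rule I0)
      fix j s' assume j: "j < n" and I: "?I j s'" and fr': "\<And>a. a \<notin> writes ?c \<Longrightarrow> s' a = s1 a"
      have v: "s' ''nA'' 0 = n" "s' ''A'' = s ''A''"
          "s' ''r'' 0 = s ''r'' 0" using fr fr' by (simp_all add: n_def)
      have iv: "s ''r'' 0 \<in> s ''A'' ` {0..<Suc j} \<longleftrightarrow> s ''A'' j = s ''r'' 0 \<or> s ''r'' 0 \<in> s ''A'' ` {0..<j}"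
        by (simp only: atLeast0_lessThan_Suc image_insert insert_iff) auto
      have jM: "Suc j \<le> M" using j nM by linarith
      have "runs ?c s' (60 * bits M) (?I (Suc j))"
      proof (rule runs_chk[where M = M and \<beta> = "bits M"])
        show "chkc M (bits M) ?c s'" using I jM M by (simp add: big_def)
        assume b: "bounded M (fin ?c s')"
        have "fin ?c s' ''i'' 0 = Suc j" using I by simp
        moreover have "fin ?c s' ''out'' 0 = (if s ''A'' j = s ''r'' 0 then 1 else s' ''out'' 0)"
          using I v nat_neq_iff_diff[of "s ''A'' j" "s ''r'' 0"] by simp
        ultimately show "?I (Suc j) (fin ?c s')" unfolding iv using b I by simp
      qed (use I in simp_all)
      then show "ev (Sub (V ''nA'') (V ''i'')) s' \<noteq> 0 \<and> chk (bits M) (Sub (V ''nA'') (V ''i'')) s' \<and>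
        runs ?c s' (60 * bits M) (?I (Suc j))" using I j v by (auto simp: big_def)
    qed (use fr in \<open>auto simp: big_def algebra_simps n_def\<close>)
  next
    have "10 * bits M + 80 * (n + 1) * bits M \<le> 100 * (n + 1) * bits M" by (simp add: algebra_simps)
    then show "10 * bits M + 80 * (n + 1) * bits M \<le> \<tau>" using tau unfolding n_def by linarith
  qed
qed

definition core :: "nat \<Rightarrow> com" where
  "core k = find_base k ;;
    (''D'' ::= Add (Mul (Const 2) (Add (V ''m'') (V ''tm''))) (Const 1) ;; Put ''A'' (Const 0) (Const 0) ;;
     ''nA'' ::= Const 1 ;; ''l'' ::= Const 0) ;;
    While (Sub (V ''b'') (V ''l'')) (process_class k) ;;
    target_code k ;; search"

definition core_size :: "nat \<Rightarrow> nat list \<Rightarrow> nat \<Rightarrow> nat" where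
  "core_size k xs t = (let b = residue_base k (length xs) in
     b * (length xs + target_box k t) + (\<Sum>l<b. class_cost k xs t b l))"

lemma sum_affine: "(\<Sum>l<b. u * (x * f l) + v) = u * (x * (\<Sum>l<b. f l)) + v * (b :: nat)" for u x v :: nat
  by (simp add: sum.distrib sum_distrib_left)

lemma runs_core:
  assumes bd: "bounded M s" and D: "D = 2 * (length xs + t) + 1" and M: "4 * (k + 1) * D ^ (2 * k + 3) \<le> M"
    and xs: "distinct xs" "\<And>e. e \<in> set xs \<Longrightarrow> e \<le> t" "xs \<noteq> []"
    and par: "s ''tm'' 0 = t" "s ''m'' 0 = length xs" "\<And>i. i < length xs \<Longrightarrow> s ''x'' i = xs ! i"
      "\<And>i. i < k \<Longrightarrow> s ''t'' i = ts ! i" "\<And>i. i < k \<Longrightarrow> ts ! i \<le> t" "s ''out'' 0 = 0"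
    and tau: "300000 * ((k + 2)^2 * bits M ^ 2 * core_size k xs t) \<le> \<tau>"
  shows "runs (core k) s \<tau> (\<lambda>s'. s' ''out'' 0
      = of_bool (enc k D D (\<lambda>_. 0) (\<lambda>i. ts ! i) \<in> reach k D (\<lambda>_. 0) id t (set xs)))"
proof -
  define m where "m = length xs"
  define b where "b = residue_base k m"
  let ?b = "bits M" and ?X = "(k + 1)^2 * bits M ^ 2" and ?Y = "(k + 2)^2 * bits M ^ 2"
  have m1: "1 \<le> m" using xs(3) by (cases xs) (auto simp: m_def)
  note B = residue_base[where k = k, OF m1, folded b_def]
  have D1: "1 \<le> D" using D by simp
  note lb = bounds_from_radix[OF M D1]
  have bM: "2 \<le> ?b" using bits_mono[of 2 M] lb(6) by simp
  have mM: "m < M" "D \<le> M" using D lb(8) D1 by (simp_all add: m_def)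
  obtain T1 s1 where 1: "exec (find_base k) s T1 s1" "T1 \<le> 100 * (k + 2)^2 * (m + 1) * ?b"
    "bounded M s1" "s1 ''b'' 0 = b" and fr1: "\<And>a. a \<notin> writes (find_base k) \<Longrightarrow> s1 a = s a"
    by (rule runsE[OF runs_find_base[OF bd par(2)[folded m_def] m1 mM(1) order_refl]]) (unfold b_def, blast)
  have w1: "writes (find_base k) = {''b''}" by (auto simp: find_base_def)
  let ?i = "''D'' ::= Add (Mul (Const 2) (Add (V ''m'') (V ''tm''))) (Const 1)
      ;; Put ''A'' (Const 0) (Const 0) ;;
     ''nA'' ::= Const 1 ;; ''l'' ::= Const 0"
  have p1: "s1 ''m'' 0 = m" "s1 ''tm'' 0 = t" using fr1 par by (simp_all add: w1 m_def)
  have D': "2 * (m + t) + 1 = D" by (simp add: D m_def)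
  have "runs ?i s1 (40 * ?b) (\<lambda>s'. s' ''D'' 0 = D \<and> class_state M k D xs t b 0 s')"
    by (rule runs_chk[where M = M and \<beta> = ?b])
      (use 1(3) p1 bM mM lb(5) D' in \<open>simp_all add: big_def class_state_def reach_empty\<close>)
  then obtain T2 s2 where 2: "exec ?i s1 T2 s2" "T2 \<le> 40 * ?b" "s2 ''D'' 0 = D"
      "class_state M k D xs t b 0 s2"
    and fr2: "\<And>a. a \<notin> writes ?i \<Longrightarrow> s2 a = s1 a"
    by (rule runsE) blast
  have p2: "s2 ''tm'' 0 = t" "s2 ''m'' 0 = m" "\<And>i. i < m \<Longrightarrow> s2 ''x'' i = xs ! i" "s2 ''b'' 0 = b"
    "\<And>i. i < k \<Longrightarrow> s2 ''t'' i = ts ! i" "s2 ''out'' 0 = 0"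
    using fr1 fr2 par 1(4) by (simp_all add: w1 m_def)
  let ?S = "\<Sum>l<b. m + target_box k t + class_cost k xs t b l"
  have cs: "core_size k xs t = ?S"
    by (simp add: core_size_def b_def m_def Let_def sum.distrib)
  have bD: "b \<le> D" using B(2) D by (simp add: m_def)
  have X1: "?b \<le> ?X"
    using mult_mono[of 1 "(k + 1)^2" "?b * 1" "?b * ?b"] bM by (simp add: power2_eq_square)
  have box: "1 \<le> target_box k t" by simp
  have S1: "m + target_box k t \<le> ?S"
    using member_le_sum[of 0 "{..<b}" "\<lambda>l. m + target_box k t + class_cost k xs t b l"] B(3) by simp
  have bS: "b \<le> ?S"
  proof -
    have "b = (\<Sum>l<b. 1)" by simp
    also have "\<dots> \<le> ?S" using box by (intro sum_mono) linarith
    finally show ?thesis .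
  qed
  let ?c = "process_class k"
  have "runs (While (Sub (V ''b'') (V ''l'')) ?c) s2 (270020 * (?X * ?S)) (class_state M k D xs t b b)"
  proof (rule runs_loop[where I = "class_state M k D xs t b" and n = b and M = M and \<beta> = ?b
        and \<tau> = "\<lambda>l. 270000 * (?X * (m + target_box k t + class_cost k xs t b l))"])
    show "class_state M k D xs t b 0 s2" by (rule 2(4))
  next
    fix l s' assume l: "l < b" and I: "class_state M k D xs t b l s'" and fr: "\<And>a. a \<notin> writes ?c
        \<Longrightarrow> s' a = s2 a"
    have p: "s' ''D'' 0 = D" "s' ''tm'' 0 = t" "s' ''b'' 0 = b" "s' ''m'' 0 = length xs" "\<And>i. i < length xs
        \<Longrightarrow> s' ''x'' i = xs ! i"
      using fr p2 2(3) by (simp_all add: writes_process_class scratch_def m_def)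
    have DD: "2 * length xs + 2 * t + 1 \<le> D" using D by simp
    have "runs ?c s' (270000 * (?X * (m + target_box k t
        + class_cost k xs t b l))) (class_state M k D xs t b (Suc l))"
      by (rule runs_process_class[OF I M DD xs(1,2) l bD p]) (simp_all add: m_def)
    then show "ev (Sub (V ''b'') (V ''l'')) s' \<noteq> 0 \<and> chk ?b (Sub (V ''b'') (V ''l'')) s' \<and>
      runs ?c s' (270000 * (?X * (m + target_box k t
          + class_cost k xs t b l))) (class_state M k D xs t b (Suc l))"
      using I l p by (auto simp: class_state_def big_def)
  next
    fix s' assume I: "class_state M k D xs t b b s'" and fr: "\<And>a. a \<notin> writes ?c \<Longrightarrow> s' a = s2 a"
    have "s' ''b'' 0 = b" using fr p2 by (simp add: writes_process_class scratch_def)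
    then show "ev (Sub (V ''b'') (V ''l'')) s' = 0 \<and> chk ?b (Sub (V ''b'') (V ''l'')) s'"
      using I by (auto simp: class_state_def big_def)
  next
    have "(\<Sum>l<b. 270000 * (?X * (m + target_box k t + class_cost k xs t b l)) + 9 * ?b) + 9 * ?b
      = 270000 * (?X * ?S) + 9 * (?b * b) + 9 * (?b * 1)"
      using sum_affine[of 270000 ?X "\<lambda>l. m + target_box k t + class_cost k xs t b l"
          "9 * ?b" b] by (simp only: mult_ac mult_1)
    also have "\<dots> \<le> 270000 * (?X * ?S) + 9 * (?X * ?S) + 9 * (?X * ?S)"
      by (intro add_mono order_refl mult_le_mono X1 bS) (use S1 box in linarith)
    finally show "(\<Sum>l<b. 270000 * (?X * (m + target_box k t + class_cost k xs t b l)) +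
      (ecost (Sub (V ''b'') (V ''l'')) + wt (Sub (V ''b'') (V ''l''))) * ?b) +
      (ecost (Sub (V ''b'') (V ''l'')) + wt (Sub (V ''b'') (V ''l''))) * ?b \<le> 270020 * (?X * ?S)"
      unfolding cost_Sub_V by linarith
  qed (simp_all add: class_state_def)
  then obtain T3 s3 where 3: "exec (While (Sub (V ''b'') (V ''l'')) ?c) s2 T3 s3" "T3 \<le> 270020 * (?X * ?S)"
    "class_state M k D xs t b b s3" and fr3: "\<And>a. a \<notin> writes ?c \<Longrightarrow> s3 a = s2 a"
    by (rule runsE) simp
  have p3: "s3 ''D'' 0 = D" "s3 ''out'' 0 = 0" "\<And>i. i < k \<Longrightarrow> s3 ''t'' i = ts ! i"
    using fr3 p2 2(3) by (simp_all add: writes_process_class scratch_def)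
  have all: "{x \<in> set xs. x mod b < b} = set xs" using B(3) by auto
  have I3: "bounded M s3" "s3 ''nA'' 0 \<le> 2 * target_box k t"
    "s3 ''A'' ` {0..<s3 ''nA'' 0} = reach k D (\<lambda>_. 0) id t (set xs)"
    using 3(3) unfolding class_state_def all by blast+
  have tD: "ts ! i < D" if "i < k" for i using par(5)[OF that] D by simp
  obtain T4 s4 where 4: "exec (target_code k) s3 T4 s4" "T4 \<le> 100 * (k + 1) * ?b" "bounded M s4"
    "s4 ''r'' 0 = enc k D D (\<lambda>_. 0) (\<lambda>i. ts ! i)" and fr4: "\<And>a. a \<notin> writes (target_code k) \<Longrightarrow> s4 a = s3 a"
    by (rule runsE[OF runs_target_code[OF I3(1) M p3(1,3) tD D1 order_refl]], assumption, assumption) blast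
  have p4: "s4 ''out'' 0 = 0" "s4 ''A'' = s3 ''A''"
      "s4 ''nA'' = s3 ''nA''" using fr4 p3 by (simp_all add: target_code_def)
  obtain T5 s5 where 5: "exec search s4 T5 s5" "T5 \<le> 100 * (s3 ''nA'' 0 + 1) * ?b"
    "s5 ''out'' 0 = of_bool (enc k D D (\<lambda>_. 0) (\<lambda>i. ts ! i) \<in> reach k D (\<lambda>_. 0) id t (set xs))"
    by (rule runsE[OF runs_search[OF 4(3) lb(5) p4(1) order_refl]]) (unfold p4 I3(3) 4(4), blast)
  show ?thesis
    unfolding core_def
  proof (rule runsI[OF exec.Seq[OF 1(1) exec.Seq[OF 2(1) exec.Seq[OF 3(1) exec.Seq[OF 4(1) 5(1)]]]]])
    have kk: "(k + 1)^2 \<le> (k + 2)^2" "k + 1 \<le> (k + 2)^2" "1 \<le> (k + 2)^2" by (simp_all add: power2_eq_square)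
    have b2: "?b \<le> ?b ^ 2" by (simp add: power2_eq_square)
    have c: "x * y * z \<le> ?Y * ?S" if "x \<le> (k + 2)^2" "y \<le> ?b ^ 2" "z \<le> ?S" for x y z
      by (intro mult_mono that) auto
    have S2: "m + 1 \<le> ?S" "1 \<le> ?S" "target_box k t \<le> ?S" using S1 box by linarith+
    have t1: "T1 \<le> 100 * (?Y * ?S)"
    proof -
      have "T1 \<le> 100 * ((k + 2)^2 * ?b * (m + 1))" using 1(2) by (simp only: mult_ac)
      then show ?thesis using c[OF order_refl b2 S2(1)] by linarith
    qed
    have t2: "T2 \<le> 40 * (?Y * ?S)" using 2(2) c[OF kk(3) b2 S2(2)] by simp
    have t3: "T3 \<le> 270020 * (?Y * ?S)"
      using 3(2) c[OF kk(1) order_refl order_refl] by linarith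
    have t4: "T4 \<le> 100 * (?Y * ?S)"
    proof -
      have "T4 \<le> 100 * ((k + 1) * ?b * 1)" using 4(2) by (simp only: mult.assoc mult_1_right)
      then show ?thesis using c[OF kk(2) b2 S2(2)] by linarith
    qed
    have t5: "T5 \<le> 300 * (?Y * ?S)"
    proof -
      have "T5 \<le> 100 * (3 * target_box k t) * ?b"
        by (rule le_trans[OF 5(2)], intro mult_le_mono order_refl) (use I3(2) box in linarith)
      also have "\<dots> = 300 * (1 * ?b * target_box k t)" by simp
      also have "\<dots> \<le> 300 * (?Y * ?S)" by (intro mult_le_mono2 c kk b2 S2)
      finally show ?thesis .
    qed
    show "T1 + (T2 + (T3 + (T4 + T5))) \<le> \<tau>" using t1 t2 t3 t4 t5 tau unfolding cs by linarith
  qed (rule 5(3))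
qed

definition max_target :: "nat \<Rightarrow> com" where
  "max_target k = (''tm'' ::= Const 0 ;; ''i'' ::= Const 0) ;; While (Sub (Const k) (V ''i''))
    (Ite (Sub (Elem ''t'' (V ''i'')) (V ''tm'')) (''tm'' ::= Elem ''t'' (V ''i'')) Skip
        ;; ''i'' ::= Add (V ''i'') (Const 1))"

lemma runs_max_target:
  assumes bd: "bounded M s" and par: "\<And>i. i < k \<Longrightarrow> s ''t'' i = ts ! i" "length ts = k" and k: "k \<le> M" "1 \<le> M"
    and tau: "100 * (k + 1) * bits M \<le> \<tau>"
  shows "runs (max_target k) s \<tau> (\<lambda>s'. bounded M s' \<and> s' ''tm'' 0 = Max (insert 0 (set ts)))"
proof -
  let ?f = "\<lambda>j. Max (insert 0 (set (take j ts)))"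
  let ?I = "\<lambda>j s'. bounded M s' \<and> s' ''i'' 0 = j \<and> s' ''tm'' 0 = ?f j"
  let ?i = "''tm'' ::= Const 0 ;; ''i'' ::= Const 0"
  let ?c = "Ite (Sub (Elem ''t'' (V ''i'')) (V ''tm'')) (''tm'' ::= Elem ''t'' (V ''i'')) Skip
      ;; ''i'' ::= Add (V ''i'') (Const 1)"
  show ?thesis
    unfolding max_target_def
  proof (rule runs_Seq)
    show "runs ?i s (10 * bits M) (?I 0)"
      by (rule runs_chk[where \<beta> = "bits M", OF bd]) auto
  next
    fix s1 assume I0: "?I 0 s1" and fr: "\<And>a. a \<notin> writes ?i \<Longrightarrow> s1 a = s a"
    show "runs (While (Sub (Const k) (V ''i'')) ?c) s1 (80 * (k + 1) * bits M)
       (\<lambda>s'. bounded M s' \<and> s' ''tm'' 0 = Max (insert 0 (set ts)))"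
    proof (rule runs_loop[where I = ?I and n = k and M = M and \<beta> = "bits M" and \<tau> = "\<lambda>_. 60 * bits M"])
      show "?I 0 s1" by (rule I0)
      fix j s' assume j: "j < k" and I: "?I j s'" and fr': "\<And>a. a \<notin> writes ?c \<Longrightarrow> s' a = s1 a"
      have v: "s' ''t'' j = ts ! j" using fr fr' par j by simp
      have tM: "ts ! j \<le> M" using boundedD[of M s' "''t''" j] I v by (simp add: big_def)
      have "set (take (Suc j) ts) = insert (ts ! j) (set (take j ts))"
        using j par(2) by (simp add: take_Suc_conv_app_nth)
      then have "?f (Suc j) = Max (insert (ts ! j) (insert 0 (set (take j ts))))"
          by (simp only: insert_commute)
      also have f: "\<dots> = max (ts ! j) (?f j)" by (rule Max_insert) simp_all
      finally have f: "?f (Suc j) = max (ts ! j) (?f j)" .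
      have "runs ?c s' (60 * bits M) (?I (Suc j))"
      proof (rule runs_chk[where M = M and \<beta> = "bits M"])
        show "chkc M (bits M) ?c s'" using I v tM j k by (simp add: big_def)
        assume b: "bounded M (fin ?c s')"
        have "fin ?c s' ''i'' 0 = Suc j" "fin ?c s' ''tm'' 0 = max (ts ! j) (?f j)"
          using I v by (auto simp: max_def)
        then show "?I (Suc j) (fin ?c s')" unfolding f using b by blast
      qed (use I in simp_all)
      then show "ev (Sub (Const k) (V ''i'')) s' \<noteq> 0 \<and> chk (bits M) (Sub (Const k) (V ''i'')) s' \<and>
        runs ?c s' (60 * bits M) (?I (Suc j))" using I j k by (auto simp: big_def bits_mono)
    next
      show "ev (Sub (Const k) (V ''i'')) s' = 0
          \<and> chk (bits M) (Sub (Const k) (V ''i'')) s'" if "?I k s'" for s'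
        using that k by (simp add: bits_mono big_def)
      show "bounded M s' \<and> s' ''tm'' 0 = Max (insert 0 (set ts))" if "?I k s'" for s'
        using that par(2) by simp
    qed (simp_all add: algebra_simps)
  next
    have "10 * bits M + 80 * (k + 1) * bits M \<le> 100 * (k + 1) * bits M" by (simp add: algebra_simps)
    then show "10 * bits M + 80 * (k + 1) * bits M \<le> \<tau>" using tau by linarith
  qed
qed

definition drop_large :: com where
  "drop_large = (''m'' ::= Const 0 ;; ''i'' ::= Const 0) ;; While (Sub (V ''n'') (V ''i''))
    (Ite (Sub (Elem ''z'' (V ''i'')) (V ''tm'')) Skip
      (Put ''x'' (V ''m'') (Elem ''z'' (V ''i'')) ;; ''m'' ::= Add (V ''m'') (Const 1)) ;;
     ''i'' ::= Add (V ''i'') (Const 1))"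

lemma runs_drop_large:
  assumes bd: "bounded M s" and par: "s ''n'' 0 = length zs" "\<And>i. i < length zs
      \<Longrightarrow> s ''z'' i = zs ! i" "s ''tm'' 0 = t"
    and M: "length zs \<le> M" "1 \<le> M"
    and tau: "200 * (1 + input_bits zs) * bits M \<le> \<tau>"
  shows "runs drop_large s \<tau> (\<lambda>s'. bounded M s' \<and> s' ''m'' 0 = length (filter (\<lambda>z. z \<le> t) zs) \<and>
    (\<forall>i<length (filter (\<lambda>z. z \<le> t) zs). s' ''x'' i = filter (\<lambda>z. z \<le> t) zs ! i))"
proof -
  let ?P = "\<lambda>z. z \<le> t" and ?b = "bits M"
  let ?f = "\<lambda>j. filter ?P (take j zs)"
  let ?I = "\<lambda>j s'. bounded M s' \<and> s' ''i'' 0 = j \<and> s' ''m'' 0 = length (?f j)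
      \<and> (\<forall>i<length (?f j). s' ''x'' i = ?f j ! i)"
  let ?i = "''m'' ::= Const 0 ;; ''i'' ::= Const 0"
  let ?c = "Ite (Sub (Elem ''z'' (V ''i'')) (V ''tm'')) Skip
      (Put ''x'' (V ''m'') (Elem ''z'' (V ''i'')) ;; ''m'' ::= Add (V ''m'') (Const 1)) ;;
     ''i'' ::= Add (V ''i'') (Const 1)"
  have tM: "t \<le> M" using boundedD[OF bd, of "''tm''" 0] par by (simp add: big_def)
  show ?thesis
    unfolding drop_large_def
  proof (rule runs_Seq)
    show "runs ?i s (10 * ?b) (?I 0)"
      by (rule runs_chk[where \<beta> = "?b", OF bd]) auto
  next
    fix s1 assume I0: "?I 0 s1" and fr: "\<And>a. a \<notin> writes ?i \<Longrightarrow> s1 a = s a"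
    show "runs (While (Sub (V ''n'') (V ''i'')) ?c) s1 (150 * (1 + input_bits zs) * ?b)
       (\<lambda>s'. bounded M s' \<and> s' ''m'' 0 = length (filter ?P zs)
           \<and> (\<forall>i<length (filter ?P zs). s' ''x'' i = filter ?P zs ! i))"
    proof (rule runs_loop[where I = ?I and n = "length zs" and M = M and \<beta> = ?b
        and \<tau> = "\<lambda>j. 60 * (?b + bits (zs ! j))"])
      show "?I 0 s1" by (rule I0)
    next
      fix j s' assume j: "j < length zs" and I: "?I j s'" and fr': "\<And>a. a \<notin> writes ?c \<Longrightarrow> s' a = s1 a"
      have v: "s' ''n'' 0 = length zs" "s' ''z'' j = zs ! j"
          "s' ''tm'' 0 = t" using fr fr' par j by simp_all
      have lf: "length (?f j) \<le> j" using length_filter_le[of ?P "take j zs"] by simp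
      have fS: "?f (Suc j) = (if ?P (zs ! j) then ?f j @ [zs ! j] else ?f j)"
        using j by (simp add: take_Suc_conv_app_nth)
      have "runs ?c s' (60 * (?b + bits (zs ! j))) (?I (Suc j))"
      proof (rule runs_chk[where M = M and \<beta> = "?b + bits (zs ! j)"])
        show "chkc M (?b + bits (zs ! j)) ?c s'" using I v tM j M lf by (auto simp: big_def trans_le_add1)
        assume b: "bounded M (fin ?c s')"
        show "?I (Suc j) (fin ?c s')"
        proof (cases "?P (zs ! j)")
          case True
          have f: "fin ?c s' ''i'' 0 = Suc j" "fin ?c s' ''m'' 0 = Suc (length (?f j))"
            "fin ?c s' ''x'' = (s' ''x'')(length (?f j) := zs ! j)"
            using I v True by simp_all
          show ?thesis unfolding f fS using b True I by (simp add: nth_append less_Suc_eq)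
        next
          case False
          then have f: "fin ?c s' ''i'' 0 = Suc j" "fin ?c s' ''m'' 0 = length (?f j)"
              "fin ?c s' ''x'' = s' ''x''"
            using I v by simp_all
          show ?thesis unfolding f fS using b False I by simp
        qed
      qed (use I in simp_all)
      then show "ev (Sub (V ''n'') (V ''i'')) s' \<noteq> 0 \<and> chk ?b (Sub (V ''n'') (V ''i'')) s' \<and>
        runs ?c s' (60 * (?b + bits (zs ! j))) (?I (Suc j))" using I j v M by (auto simp: big_def bits_mono)
    next
      show "ev (Sub (V ''n'') (V ''i'')) s' = 0 \<and> chk ?b (Sub (V ''n'') (V ''i'')) s'"
        if "?I (length zs) s'" "\<And>a. a \<notin> writes ?c \<Longrightarrow> s' a = s1 a" for s'
        using that fr par M by (simp add: big_def bits_mono)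
    next
      have z: "?b + bits (zs ! j) \<le> 2 * (?b * bits (zs ! j))" for j
      proof -
        have "?b * 1 \<le> ?b * bits (zs ! j)" "1 * bits (zs ! j) \<le> ?b * bits (zs ! j)"
          by (intro mult_le_mono order_refl bits_pos)+
        then show ?thesis by linarith
      qed
      have z1: "?b \<le> ?b * bits (zs ! j)" for j by simp
      have "(\<Sum>j<length zs. 60 * (?b + bits (zs ! j)) + 9 * ?b) + 9 * ?b
        \<le> (\<Sum>j<length zs. 60 * (2 * (?b * bits (zs ! j))) + 9 * (?b * bits (zs ! j))) + 9 * ?b"
        by (intro add_mono sum_mono mult_le_mono2 z z1 order_refl)
      also have "\<dots> = 129 * (?b * (\<Sum>j<length zs. bits (zs ! j))) + 9 * ?b"
        by (simp add: sum.distrib sum_distrib_left)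
      also have "(\<Sum>j<length zs. bits (zs ! j)) = input_bits zs"
        by (simp add: input_bits_def sum_list_sum_nth lessThan_atLeast0)
      also have "129 * (?b * input_bits zs) + 9 * ?b \<le> 150 * (1 + input_bits zs) * ?b"
          by (simp add: algebra_simps)
      finally show "(\<Sum>j<length zs. 60 * (?b + bits (zs ! j)) + (ecost (Sub (V ''n'') (V ''i''))
          + wt (Sub (V ''n'') (V ''i''))) * ?b) +
        (ecost (Sub (V ''n'') (V ''i'')) + wt (Sub (V ''n'') (V ''i''))) * ?b \<le> 150 * (1
            + input_bits zs) * ?b"
        unfolding cost_Sub_V .
    qed simp_all
  next
    have "10 * ?b + 150 * (1 + input_bits zs) * ?b \<le> 200 * (1 + input_bits zs) * ?b"
        by (simp add: algebra_simps)
    then show "10 * ?b + 150 * (1 + input_bits zs) * ?b \<le> \<tau>" using tau by linarith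
  qed
qed

definition k_subset_sum_program :: "nat \<Rightarrow> com" where
  "k_subset_sum_program k = max_target k ;; drop_large ;;
    Ite (V ''m'') (core k) (Ite (V ''tm'') Skip (''out'' ::= Const 1))"

lemma runs_k_subset_sum_program:
  fixes k :: nat and zs ts :: "nat list"
  defines "t \<equiv> Max (set ts)"
  defines "xs \<equiv> filter (\<lambda>z. z \<le> t) zs"
  defines "M \<equiv> 4 * (k + 1) * (2 * (length zs + t) + 1) ^ (2 * k + 3)"
  assumes k: "1 \<le> k" "length ts = k" and zs: "distinct zs" "\<forall>z\<in>set zs. 0 < z"
  shows "runs (k_subset_sum_program k) (input_store zs ts)
    (300200 * ((k + 2)^2 * bits M ^ 2 * (1 + input_bits zs + (if xs = [] then 0 else core_size k xs t))))
    (\<lambda>s. answer s = of_bool (k_subset_sum (set zs) ts))"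
proof -
  let ?s = "input_store zs ts" and ?b = "bits M" and ?Y = "(k + 2)^2 * bits M ^ 2"
  have ts: "ts \<noteq> []" using k by auto
  have tt: "ts ! i \<le> t" if "i < k" for i unfolding t_def using that k by (intro Max_ge) auto
  have E1: "1 \<le> 2 * (length zs + t) + 1" by simp
  note lb = bounds_from_radix[OF order_refl E1, of k, folded M_def]
  have nM: "length zs \<le> M" "t \<le> M" using lb(8) by auto
  have bd: "bounded M ?s"
    using tt k nM by (auto simp: bounded_def input_store_def cells_def big_def intro: order_trans)
  have s0: "\<And>i. i < k \<Longrightarrow> ?s ''t'' i = ts ! i" "?s ''n'' 0 = length zs" "\<And>i. i < length zs
      \<Longrightarrow> ?s ''z'' i = zs ! i"
    "?s ''out'' 0 = 0"
    using k by (simp_all add: input_store_def cells_def)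
  have tm: "Max (insert 0 (set ts)) = t" using ts by (simp add: t_def)
  obtain T1 s1 where 1: "exec (max_target k) ?s T1 s1" "T1 \<le> 100 * (k + 1) * ?b" "bounded M s1"
      "s1 ''tm'' 0 = t"
    and fr1: "\<And>a. a \<notin> writes (max_target k) \<Longrightarrow> s1 a = ?s a"
    by (rule runsE[OF runs_max_target[OF bd s0(1) k(2) lb(4,5) order_refl]], assumption) (unfold tm, blast)
  have w1: "writes (max_target k) = {''tm'', ''i''}" by (auto simp: max_target_def)
  have p1: "s1 ''n'' 0 = length zs" "\<And>i. i < length zs
      \<Longrightarrow> s1 ''z'' i = zs ! i" using fr1 s0 by (simp_all add: w1)
  obtain T2 s2 where 2: "exec drop_large s1 T2 s2" "T2 \<le> 200 * (1 + input_bits zs) * ?b" "bounded M s2"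
    "s2 ''m'' 0 = length xs" "\<forall>i<length xs. s2 ''x'' i = xs ! i" and fr2: "\<And>a. a \<notin> writes drop_large
        \<Longrightarrow> s2 a = s1 a"
    by (rule runsE[OF runs_drop_large[OF 1(3) p1 1(4) nM(1) lb(5) order_refl]], assumption) (unfold xs_def,
        blast)
  have w2: "writes drop_large = {''m'', ''i'', ''x''}" by (auto simp: drop_large_def)
  have p2: "s2 ''tm'' 0 = t" "\<And>i. i < k \<Longrightarrow> s2 ''t'' i = ts ! i" "s2 ''out'' 0 = 0"
    using fr1 fr2 s0 1(4) by (simp_all add: w1 w2)
  have set_xs: "set xs = {z \<in> set zs. z \<le> t}" by (auto simp: xs_def)
  let ?D = "2 * (length xs + t) + 1"
  have iff: "k_subset_sum (set zs) ts \<longleftrightarrow> enc k ?D ?D (\<lambda>_. 0) (\<lambda>i. ts ! i) \<in> reach k ?D (\<lambda>_. 0) id t (set xs)"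
    unfolding set_xs unfolding t_def by (rule k_subset_sum_iff_reach[OF finite_set k(2) ts]) simp
  let ?C = "if xs = [] then 0 else core_size k xs t"
  let ?c = "Ite (V ''m'') (core k) (Ite (V ''tm'') Skip (''out'' ::= Const 1))"
  have "runs ?c s2 (4 * ?b + (300000 * (?Y * ?C) + 10 * ?b)) (\<lambda>s. answer s
      = of_bool (k_subset_sum (set zs) ts))"
  proof (rule runs_Ite[where \<beta> = ?b and \<tau> = "300000 * (?Y * ?C) + 10 * ?b"])
    show "okx ?b (V ''m'') s2" by (rule chk_okx[OF 2(3)]) (auto simp: big_def)
  next
    assume "ev (V ''m'') s2 \<noteq> 0"
    then have ne: "xs \<noteq> []" using 2(4) by simp
    have M': "4 * (k + 1) * ?D ^ (2 * k + 3) \<le> M"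
      unfolding M_def xs_def by (intro mult_le_mono2 power_mono) auto
    have xs: "distinct xs" "\<And>e. e \<in> set xs \<Longrightarrow> e \<le> t" using zs by (auto simp: xs_def)
    have "runs (core k) s2 (300000 * (?Y * core_size k xs t))
      (\<lambda>s'. s' ''out'' 0 = of_bool (enc k ?D ?D (\<lambda>_. 0) (\<lambda>i. ts ! i) \<in> reach k ?D (\<lambda>_. 0) id t (set xs)))"
      by (rule runs_core[OF 2(3) refl M' xs ne p2(1) 2(4) _ p2(2) tt p2(3) order_refl])
          (use 2(5) in simp_all)
    then show "runs (core k) s2 (300000 * (?Y * ?C) + 10 * ?b) (\<lambda>s. answer s
        = of_bool (k_subset_sum (set zs) ts))"
      by (rule runs_weaken) (use ne iff in \<open>simp_all add: answer_def\<close>)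
  next
    assume "ev (V ''m'') s2 = 0"
    then have e: "xs = []" using 2(4) by simp
    have "enc k ?D ?D (\<lambda>_. 0) (\<lambda>i. ts ! i) = 0 \<longleftrightarrow> (\<forall>i<k. ts ! i = 0)"
      by (auto simp: enc_def)
    also have "\<dots> \<longleftrightarrow> t = 0"
      using tt k ts unfolding t_def by (auto simp: Max_eq_iff in_set_conv_nth intro: nth_mem)
    finally have iff0: "k_subset_sum (set zs) ts
        \<longleftrightarrow> t = 0" unfolding iff unfolding e by (simp add: reach_empty)
    show "runs (Ite (V ''tm'') Skip (''out'' ::= Const 1)) s2 (300000 * (?Y * ?C) + 10 * ?b) (\<lambda>s. answer s
        = of_bool (k_subset_sum (set zs) ts))"
      by (rule runs_chk[OF 2(3), where \<beta> = ?b]) (use p2 lb(5) in \<open>auto simp: big_def answer_def iff0\<close>)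
  next
    show "(ecost (V ''m'') + wt (V ''m'')) * ?b + (300000 * (?Y * ?C) + 10 * ?b) \<le> 4 * ?b
        + (300000 * (?Y * ?C) + 10 * ?b)"
      unfolding cost_V ..
  qed
  then obtain T3 s3 where 3: "exec ?c s2 T3 s3" "T3 \<le> 4 * ?b + (300000 * (?Y * ?C) + 10 * ?b)"
    "answer s3 = of_bool (k_subset_sum (set zs) ts)" by (rule runsE)
  show ?thesis
    unfolding k_subset_sum_program_def
  proof (rule runsI[OF exec.Seq[OF 1(1) exec.Seq[OF 2(1) 3(1)]]])
    show "answer s3 = of_bool (k_subset_sum (set zs) ts)" by (rule 3(3))
    have kk: "k + 1 \<le> (k + 2)^2" "1 \<le> (k + 2)^2" by (simp_all add: power2_eq_square)
    have b2: "?b \<le> ?b ^ 2" by (simp add: power2_eq_square)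
    have Y: "x * ?b \<le> ?Y" if "x \<le> (k + 2)^2" for x using that b2 by (intro mult_mono) auto
    have t1: "T1 \<le> 100 * ?Y" using 1(2) Y[OF kk(1)] unfolding mult.assoc by linarith
    have "200 * (1 + input_bits zs) * ?b = 200 * (1 * ?b * (1 + input_bits zs))"
        by (simp only: mult_ac mult_1)
    also have "\<dots> \<le> 200 * (?Y * (1 + input_bits zs))" by (intro mult_le_mono2 mult_le_mono1 Y kk)
    finally have t2: "T2 \<le> 200 * (?Y * (1 + input_bits zs))" using 2(2) by linarith
    have t3: "T3 \<le> 14 * ?Y + 300000 * (?Y * ?C)" using 3(2) Y[OF kk(2)] by linarith
    have "T1 + (T2 + T3) \<le> 300200 * (?Y * (1 + input_bits zs)) + 300200 * (?Y * ?C)"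
      using t1 t2 t3 by (simp add: algebra_simps)
    also have "\<dots> = 300200 * (?Y * (1 + input_bits zs + ?C))" by (simp add: algebra_simps)
    finally show "T1 + (T2 + T3) \<le> 300200 * (?Y * (1 + input_bits zs + ?C))" .
  qed
qed

section \<open>Asymptotics\<close>

lemma ln_2_ge_half: "1 / 2 \<le> ln (2 :: real)"
  using ln_le_minus_one[of "1 / 2"] by (simp add: ln_div)

lemma bits_le_ln: "1 \<le> x \<Longrightarrow> real (bits x) \<le> 1 + 2 * ln (real x)"
proof -
  assume x: "1 \<le> x"
  then have "1 \<le> floorlog 2 x" using floorlog_mono[of 1 x 2] by (simp add: floorlog_def)
  then have b: "bits x = floorlog 2 x" by (simp add: bits_def)
  have "2 ^ (bits x - 1) \<le> x" using floorlog_bounds[of x 2] x by (simp add: b)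
  then have "real (2 ^ (bits x - 1)) \<le> real x" by (rule of_nat_mono)
  then have "ln (2 ^ (bits x - 1)) \<le> ln (real x)" using x by (subst ln_le_cancel_iff) simp_all
  then have l: "real (bits x - 1) * ln 2 \<le> ln (real x)" by (simp add: ln_realpow)
  have "real (bits x - 1) * (1 / 2) \<le> real (bits x - 1) * ln 2"
    using ln_2_ge_half by (intro mult_left_mono) auto
  then show ?thesis using l by (simp add: of_nat_diff)
qed

lemma harmonic_le_ln: "1 \<le> N \<Longrightarrow> (\<Sum>i<N. 1 / real (Suc i)) \<le> 1 + ln (real N)"
proof (induction N rule: nat_induct_at_least)
  case (Suc N)
  have "ln (real N / real (Suc N)) \<le> real N / real (Suc N) - 1"
    by (rule ln_le_minus_one) (use Suc in simp)
  then have "1 / real (Suc N) \<le> ln (real (Suc N)) - ln (real N)"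
    using Suc.hyps by (simp add: ln_div field_simps)
  then show ?case using Suc.IH by simp
qed simp

lemma sum_length_residue_classes:
  fixes b :: nat
  assumes "0 < b"
  shows "(\<Sum>l<b. length (filter (\<lambda>x. x mod b = l) xs)) = length xs"
proof (induction xs)
  case (Cons a xs)
  have "(\<Sum>l<b. length (filter (\<lambda>x. x mod b = l) (a # xs))) =
    (\<Sum>l<b. (if l = a mod b then 1 else 0) + length (filter (\<lambda>x. x mod b = l) xs))"
    by (intro sum.cong) auto
  also have "\<dots> = (\<Sum>l<b. if l = a mod b then 1 else 0) + length xs" using Cons by (simp only: sum.distrib)
  also have "(\<Sum>l<b. if l = a mod b then 1 else 0) = (1 :: nat)"
    using assms by (subst sum.delta) simp_all
  finally show ?case by simp
qed simp

lemma sum_power_le: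
  fixes f :: "nat \<Rightarrow> real"
  assumes "1 \<le> k" "\<And>l. l < b \<Longrightarrow> 0 \<le> f l"
  shows "(\<Sum>l<b. f l ^ k) \<le> (\<Sum>l<b. f l) ^ k"
proof -
  obtain j where j: "k = Suc j" using assms by (cases k) auto
  have "f l ^ k \<le> f l * (\<Sum>l<b. f l) ^ j" if "l < b" for l
    unfolding j power_Suc using that assms(2)
    by (intro mult_left_mono power_mono member_le_sum) auto
  then have "(\<Sum>l<b. f l ^ k) \<le> (\<Sum>l<b. f l * (\<Sum>l<b. f l) ^ j)" by (intro sum_mono) simp
  then show ?thesis by (simp add: j sum_distrib_right)
qed

lemma residue_base_le_powr:
  assumes "1 \<le> m"
  shows "real (residue_base k m) \<le> 2 * real m powr (real k / real (k + 1))"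
proof -
  let ?b = "residue_base k m" and ?p = "real m powr (real k / real (k + 1))"
  have p1: "1 \<le> ?p" using assms by (simp add: ge_one_powr_ge_zero)
  have "real (?b - 1) \<le> ?p"
  proof -
    have "(?b - 1) ^ (k + 1) < m ^ k" by (rule residue_base(4))
        (use assms residue_base(3)[OF assms, of k] in auto)
    then have "real ((?b - 1) ^ (k + 1)) \<le> real (m ^ k)" by (intro of_nat_mono) simp
    also have "\<dots> = ?p ^ (k + 1)"
      using assms by (simp add: powr_realpow[symmetric] powr_powr del: power_Suc)
    finally have "real (?b - 1) ^ (k + 1) \<le> ?p ^ (k + 1)" by simp
    then have "real (?b - 1) ^ Suc k \<le> ?p ^ Suc k" by simp
    then show ?thesis by (rule power_le_imp_le_base) simp
  qed
  then show ?thesis using p1 residue_base(3)[OF assms, of k] by (simp add: of_nat_diff)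
qed

lemma node_size_le:
  assumes "0 < v" "v \<le> 2 * q" "1 \<le> b" "b \<le> t" "1 \<le> k"
  shows "real (node_size k q (t div b) v) \<le> (12 * real q * real t / real b) ^ k / real v"
proof -
  have "real (2 * q div v) \<le> real (2 * q) / real v" by (rule of_nat_div_le_of_nat)
  moreover have "1 \<le> real (2 * q) / real v" using assms by (simp add: field_simps)
  moreover have "real (2 * q div v + 1) = real (2 * q div v) + 1"
      "4 * real q / real v = 2 * (real (2 * q) / real v)"
    by simp_all
  ultimately have 1: "real (2 * q div v + 1) \<le> 4 * real q / real v" by linarith
  have "real (t div b) \<le> real t / real b" by (rule of_nat_div_le_of_nat)
  moreover have "1 \<le> real t / real b" using assms by (simp add: field_simps)
  moreover have "real (2 * (t div b) + 1) = 2 * real (t div b) + 1"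
      "3 * real t / real b = 3 * (real t / real b)"
    by simp_all
  ultimately have 2: "real (2 * (t div b) + 1) \<le> 3 * real t / real b" by linarith
  have "real (node_size k q (t div b) v) = (real (2 * q div v + 1) * real (2 * (t div b) + 1)) ^ k"
    unfolding node_size_def of_nat_power of_nat_mult ..
  also have "\<dots> \<le> (4 * real q / real v * (3 * real t / real b)) ^ k"
    by (intro power_mono mult_mono 1 2) auto
  also have "\<dots> = (12 * real q * real t / real b) ^ k / real v ^ k"
    by (simp add: power_divide[symmetric] mult_ac)
  also have "\<dots> \<le> (12 * real q * real t / real b) ^ k / real v"
  proof (rule divide_left_mono)
    show "real v \<le> real v ^ k" using assms by (intro self_le_power) auto
  qed (use assms in auto)
  finally show ?thesis .
qed

lemma class_cost_le:
  assumes "1 \<le> b" "b \<le> t" "1 \<le> k" and q: "q = length (filter (\<lambda>x. x mod b = l) xs)"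
    and L: "1 \<le> L" "q \<ge> 1 \<Longrightarrow> ln (real (2 * q)) \<le> L"
  shows "real (class_cost k xs t b l) \<le> (12 * real t / real b) ^ k * (2 * L) * real q ^ k"
proof (cases "q = 0")
  case True
  then show ?thesis using q L by (simp add: class_cost_def)
next
  case False
  let ?A = "(12 * real q * real t / real b) ^ k"
  have "real (class_cost k xs t b l) = (\<Sum>i<2 * q - 1. real (node_size k q (t div b) (Suc i)))"
    by (simp add: class_cost_def q Let_def)
  also have "\<dots> \<le> (\<Sum>i<2 * q - 1. ?A / real (Suc i))"
    by (intro sum_mono node_size_le) (use assms in auto)
  also have "\<dots> \<le> (\<Sum>i<2 * q. ?A / real (Suc i))" by (intro sum_mono2) auto
  also have "\<dots> = ?A * (\<Sum>i<2 * q. 1 / real (Suc i))" by (simp add: sum_distrib_left)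
  also have "\<dots> \<le> ?A * (2 * L)"
    using harmonic_le_ln[of "2 * q"] L False by (intro mult_left_mono) auto
  also have "\<dots> = (12 * real t / real b) ^ k * (2 * L) * real q ^ k"
    by (simp add: power_mult_distrib power_divide)
  finally show ?thesis .
qed

lemma core_size_le:
  assumes m: "m = length xs" "1 \<le> m" "m \<le> t" and k: "1 \<le> k" and L: "1 \<le> L" "ln (real (2 * m)) \<le> L"
  shows "real (core_size k xs t) \<le> (2 + 2 * 3 ^ k + 4 * 12 ^ k) * L * (real m powr (real k / real (k
      + 1)) * real t ^ k)"
proof -
  define b where "b = residue_base k m"
  note B = residue_base[where k = k, OF m(2), folded b_def]
  let ?p = "real m powr (real k / real (k + 1))"
  have bp: "real b \<le> 2 * ?p" unfolding b_def by (rule residue_base_le_powr[OF m(2)])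
  have bt: "b \<le> t" using B m by linarith
  have tk: "real t \<le> real t ^ k" using m k by (intro self_le_power) auto
  have box: "real (target_box k t) \<le> (3 * real t) ^ k"
    unfolding of_nat_power by (intro power_mono) (use m in auto)
  have 1: "real m + real (target_box k t) \<le> (1 + 3 ^ k) * real t ^ k"
  proof -
    note box
    moreover have "real m \<le> real t ^ k" using m tk by linarith
    moreover have "(3 * real t) ^ k = 3 ^ k * real t ^ k" by (rule power_mult_distrib)
    moreover have "(1 + 3 ^ k) * real t ^ k = real t ^ k + 3 ^ k * real t ^ k"
        by (simp only: distrib_right mult_1)
    ultimately show ?thesis by linarith
  qed
  let ?q = "\<lambda>l. length (filter (\<lambda>x. x mod b = l) xs)"
  have "(\<Sum>l<b. real (class_cost k xs t b l))
      \<le> (\<Sum>l<b. (12 * real t / real b) ^ k * (2 * L) * real (?q l) ^ k)"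
  proof (intro sum_mono class_cost_le B bt k refl L)
    fix l assume "1 \<le> ?q l"
    moreover have "?q l \<le> m" unfolding m by (rule length_filter_le)
    ultimately have "ln (real (2 * ?q l)) \<le> ln (real (2 * m))" by (subst ln_le_cancel_iff) auto
    then show "ln (real (2 * ?q l)) \<le> L" using L by linarith
  qed
  also have "\<dots> = (12 * real t / real b) ^ k * (2 * L) * (\<Sum>l<b. real (?q l) ^ k)"
      by (simp add: sum_distrib_left)
  also have "\<dots> \<le> (12 * real t / real b) ^ k * (2 * L) * real m ^ k"
  proof (rule mult_left_mono)
    have "(\<Sum>l<b. real (?q l)) = real m"
      unfolding m of_nat_sum[symmetric] by (subst sum_length_residue_classes) (use B in auto)
    then show "(\<Sum>l<b. real (?q l) ^ k) \<le> real m ^ k" using sum_power_le[OF k, of b "\<lambda>l. real (?q l)"]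
        by simp
  qed (use L in auto)
  also have "\<dots> = 2 * 12 ^ k * L * real t ^ k * (real (m ^ k) / real b ^ k)"
    by (simp add: power_mult_distrib power_divide)
  also have "\<dots> \<le> 2 * 12 ^ k * L * real t ^ k * real b"
  proof (rule mult_left_mono)
    have "real (m ^ k) \<le> real (b ^ (k + 1))" by (rule of_nat_mono) (rule B)
    then show "real (m ^ k) / real b ^ k \<le> real b" using B by (simp add: field_simps)
  qed (use L in auto)
  finally have 2: "(\<Sum>l<b. real (class_cost k xs t b l)) \<le> 2 * 12 ^ k * L * real t ^ k * real b" .
  have "real (core_size k xs t) = real b * (real m + real (target_box k t))
      + (\<Sum>l<b. real (class_cost k xs t b l))"
    by (simp add: core_size_def b_def m(1) Let_def)
  also have "\<dots> \<le> real b * ((1 + 3 ^ k) * real t ^ k) + 2 * 12 ^ k * L * real t ^ k * real b"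
    by (intro add_mono mult_left_mono 1 2) simp
  also have "\<dots> \<le> real b * ((1 + 3 ^ k) * L * real t ^ k) + 2 * 12 ^ k * L * real t ^ k * real b"
    using L mult_left_mono[of 1 L "(1 + 3 ^ k) * real t ^ k"]
        by (intro add_mono mult_left_mono) (auto simp: mult_ac)
  also have "\<dots> = real b * ((1 + 3 ^ k + 2 * 12 ^ k) * L * real t ^ k)" by (simp add: algebra_simps)
  also have "\<dots> \<le> (2 * ?p) * ((1 + 3 ^ k + 2 * 12 ^ k) * L * real t ^ k)"
    by (intro mult_right_mono bp) (use L in auto)
  also have "\<dots> = (2 + 2 * 3 ^ k + 4 * 12 ^ k) * L * (?p * real t ^ k)" by (simp add: algebra_simps)
  finally show ?thesis .
qed

theorem theorem3:
  fixes k :: nat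
  assumes "k \<ge> 1"
  shows "\<exists>(c :: com) (C :: real) (d :: nat).
    \<forall>(zs :: nat list) (ts :: nat list).
      distinct zs \<and> (\<forall>z\<in>set zs. z > 0) \<and> length ts = k \<longrightarrow>
      (\<exists>T s. exec c (input_store zs ts) T s \<and>
         answer s = of_bool (k_subset_sum (set zs) ts) \<and>
         (let n = card (set zs);
              t = Max (set ts);
              bound = real n powr (real k / real (k + 1)) * real t ^ k;
              polylog = ln (real (n + t + 2)) ^ d
          in (zs \<noteq> [] \<and> set zs \<subseteq> {1..t} \<longrightarrow> real T \<le> C * bound * polylog) \<and>
             real T \<le> C * (1 + real (input_bits zs) + bound) * polylog))"
proof -
  define K1 :: real where "K1 = real (2 * bits (4 * (k + 1)) + (2 * k + 3) * 8)"
  define K2 :: real where "K2 = 2 * (2 + 2 * 3 ^ k + 4 * 12 ^ k)"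
  define C :: real where "C = 300200 * real ((k + 2)^2) * K1 ^ 2 * (2 + K2)"
  have pos: "0 \<le> K1" "0 \<le> K2" "0 \<le> C" by (simp_all add: K1_def K2_def C_def)
  have main: "\<exists>T s. exec (k_subset_sum_program k) (input_store zs ts) T s \<and>
         answer s = of_bool (k_subset_sum (set zs) ts) \<and>
         (let n = card (set zs);
              t = Max (set ts);
              bound = real n powr (real k / real (k + 1)) * real t ^ k;
              polylog = ln (real (n + t + 2)) ^ 4
          in (zs \<noteq> [] \<and> set zs \<subseteq> {1..t} \<longrightarrow> real T \<le> (8 * C) * bound * polylog) \<and>
             real T \<le> (8 * C) * (1 + real (input_bits zs) + bound) * polylog)"
    if zs: "distinct zs" "\<forall>z\<in>set zs. z > 0" and ts: "length ts = k" for zs ts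
  proof -
    define n t where "n = length zs" and "t = Max (set ts)"
    define xs where "xs = filter (\<lambda>z. z \<le> t) zs"
    define M where "M = 4 * (k + 1) * (2 * (length zs + t) + 1) ^ (2 * k + 3)"
    define cs where "cs = (if xs = [] then 0 else core_size k xs t)"
    define bound where "bound = real n powr (real k / real (k + 1)) * real t ^ k"
    define L where "L = ln (real (n + t + 2))"
    have card: "card (set zs) = n" using zs by (simp add: distinct_card n_def)
    have bound0: "0 \<le> bound" by (simp add: bound_def)
    have "ln 2 \<le> L" unfolding L_def by (subst ln_le_cancel_iff) auto
    then have L: "1 / 2 \<le> L" using ln_2_ge_half by linarith
    have bL: "real (bits (n + t + 2)) \<le> 4 * L"
      using bits_le_ln[of "n + t + 2"] L unfolding L_def by simp
    have bM: "real (bits M) \<le> K1 * L"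
    proof -
      have "bits M \<le> bits (4 * (k + 1)) + bits ((2 * (length zs + t) + 1) ^ (2 * k + 3))"
        unfolding M_def by (rule bits_mult)
      also have "bits ((2 * (length zs + t) + 1) ^ (2 * k + 3)) \<le> (2 * k + 3) * bits (2 * (length zs + t)
          + 1)"
        by (rule bits_power) simp
      also have "bits (2 * (length zs + t) + 1) \<le> bits (2 * (n + t + 2))"
          by (rule bits_mono) (simp add: n_def)
      also have "\<dots> \<le> bits 2 + bits (n + t + 2)" by (rule bits_mult)
      finally have "bits M \<le> bits (4 * (k + 1)) + (2 * k + 3) * (2 + bits (n + t + 2))" by simp
      then have "real (bits M) \<le> real (bits (4 * (k + 1)) + (2 * k + 3) * (2 + bits (n + t + 2)))"
          by (rule of_nat_mono)
      also have "\<dots> = real (bits (4 * (k + 1))) * 1 + real (2 * k + 3) * (2 + real (bits (n + t + 2)))"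
          by (simp add: algebra_simps)
      also have "\<dots> \<le> real (bits (4 * (k + 1))) * (2 * L) + real (2 * k + 3) * (4 * L + 4 * L)"
        using L bL by (intro add_mono mult_left_mono) auto
      also have "\<dots> = K1 * L" by (simp add: K1_def algebra_simps)
      finally show ?thesis .
    qed
    have cs: "real cs \<le> K2 * L * bound"
    proof (cases "xs = []")
      case True
      then show ?thesis using pos L bound0 by (simp add: cs_def)
    next
      case False
      define m where "m = length xs"
      have m1: "1 \<le> m" using False by (cases xs) (auto simp: m_def)
      have mn: "m \<le> n" unfolding m_def n_def xs_def by (rule length_filter_le)
      have "m = card (set xs)"
        unfolding m_def by (rule distinct_card[symmetric]) (use zs in \<open>simp add: xs_def\<close>)
      also have "\<dots> \<le> card {1..t}" by (rule card_mono) (use zs in \<open>auto simp: xs_def Suc_le_eq\<close>)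
      finally have mt: "m \<le> t" by simp
      have l2: "ln (real (2 * m)) \<le> L" unfolding L_def by (subst ln_le_cancel_iff) (use m1 mn mt in auto)
      have "real cs \<le> (2 + 2 * 3 ^ k + 4 * 12 ^ k) * (2 * L) * (real m powr (real k / real (k
          + 1)) * real t ^ k)"
        unfolding cs_def using False core_size_le[OF m_def m1 mt assms, of "2 * L"] L l2 by simp
      also have "\<dots> \<le> (2 + 2 * 3 ^ k + 4 * 12 ^ k) * (2 * L) * bound"
        unfolding bound_def using mn L by (intro mult_left_mono mult_right_mono powr_mono2) auto
      also have "\<dots> = K2 * L * bound" by (simp add: K2_def)
      finally show ?thesis .
    qed
    obtain T s where T: "exec (k_subset_sum_program k) (input_store zs ts) T s"
      "T \<le> 300200 * ((k + 2)^2 * bits M ^ 2 * (1 + input_bits zs + cs))"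
      "answer s = of_bool (k_subset_sum (set zs) ts)"
      using runs_k_subset_sum_program[OF assms ts zs, folded t_def, folded xs_def M_def cs_def]
          unfolding runs_def by blast
    have two: "real T \<le> C * (1 + real (input_bits zs) + bound) * L ^ 3"
    proof -
      let ?i = "1 + real (input_bits zs)"
      have "real T \<le> real (300200 * ((k + 2)^2 * bits M ^ 2 * (1 + input_bits zs + cs)))" using T(2)
          by (rule of_nat_mono)
      also have "\<dots> = 300200 * real ((k + 2)^2) * (real (bits M) ^ 2 * (?i + real cs))"
        by (simp add: distrib_left mult.assoc)
      also have "\<dots> \<le> 300200 * real ((k + 2)^2) * ((K1 * L) ^ 2 * ((2 + K2) * L * (?i + bound)))"
      proof (intro mult_left_mono mult_mono power_mono bM)
        have "?i * 1 \<le> ?i * (2 * L)" using L by (intro mult_left_mono) auto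
        moreover have "0 \<le> K2 * L * ?i" "0 \<le> 2 * L * bound" using pos L bound0 by simp_all
        ultimately show "?i + real cs \<le> (2 + K2) * L * (?i + bound)" using cs by (simp add: algebra_simps)
      qed auto
      also have "\<dots> = C * (?i + bound) * L ^ 3" by (simp add: C_def power2_eq_square power3_eq_cube)
      finally show ?thesis .
    qed
    have i0: "0 \<le> 1 + real (input_bits zs) + bound" using bound0 by simp
    have L34: "L ^ 3 \<le> 8 * L ^ 4"
      using mult_right_mono[of 1 "8 * L" "L ^ 3"] L by (simp add: power_numeral_reduce)
    have second: "real T \<le> (8 * C) * (1 + real (input_bits zs) + bound) * L ^ 4"
    proof -
      note two
      also have "C * (1 + real (input_bits zs) + bound) * L ^ 3 \<le> C * (1 + real (input_bits zs)
          + bound) * (8 * L ^ 4)"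
        using pos i0 L34 by (intro mult_left_mono) auto
      finally show ?thesis by (simp only: mult_ac)
    qed
    have first: "real T \<le> (8 * C) * bound * L ^ 4" if "zs \<noteq> []" "set zs \<subseteq> {1..t}"
    proof -
      have n1: "1 \<le> n" using that(1) by (cases zs) (auto simp: n_def)
      have "n \<le> card {1..t}" unfolding card[symmetric] using that(2) by (intro card_mono) auto
      then have nt: "n \<le> t" by simp
      have bt: "real (bits z) \<le> 4 * L" if "z \<in> set zs" for z
      proof -
        have "z \<le> t" using that \<open>set zs \<subseteq> {1..t}\<close> by auto
        then have "bits z \<le> bits (n + t + 2)" by (intro bits_mono) simp
        then show ?thesis using bL by linarith
      qed
      have "real (input_bits zs) = (\<Sum>z\<in>set zs. real (bits z))"
        using zs(1) by (simp add: input_bits_def sum_list_distinct_conv_sum_set)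
      also have "\<dots> \<le> (\<Sum>z\<in>set zs. 4 * L)" by (intro sum_mono bt)
      also have "\<dots> = real n * (4 * L)" by (simp add: card)
      finally have ib: "1 + real (input_bits zs) \<le> real n * (6 * L)"
        using mult_mono[of 1 "real n" 1 "2 * L"] n1 L by (simp add: algebra_simps)
      have "real n = 1 * real n" by simp
      also have "\<dots> \<le> real n powr (real k / real (k + 1)) * real t ^ k"
      proof (rule mult_mono)
        show "1 \<le> real n powr (real k / real (k + 1))" using n1 by (simp add: ge_one_powr_ge_zero)
        have "real t \<le> real t ^ k" using n1 nt assms by (intro self_le_power) auto
        then show "real n \<le> real t ^ k" using nt by linarith
      qed auto
      finally have nb: "real n \<le> bound" by (simp add: bound_def)
      have "1 + real (input_bits zs) + bound \<le> bound * (6 * L) + bound * (2 * L)"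
      proof -
        have "real n * (6 * L) \<le> bound * (6 * L)" by (rule mult_right_mono[OF nb]) (use L in simp)
        moreover have "bound * 1 \<le> bound * (2 * L)" by (rule mult_left_mono) (use L bound0 in auto)
        ultimately show ?thesis using ib by linarith
      qed
      then have "C * (1 + real (input_bits zs) + bound) * L ^ 3 \<le> C * (8 * L * bound) * L ^ 3"
        using pos L by (intro mult_right_mono mult_left_mono) (auto simp: algebra_simps)
      also have "\<dots> = (8 * C) * bound * L ^ 4" by (simp add: power_numeral_reduce)
      finally show ?thesis using two by linarith
    qed
    show ?thesis
      unfolding Let_def card t_def[symmetric] bound_def[symmetric] L_def[symmetric]
      using T(1,3) first second by blast
  qed
  show ?thesis
    by (rule exI[of _ "k_subset_sum_program k"], rule exI[of _ "8 * C"], rule exI[of _ 4], intro allI impI,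
        elim conjE, rule main)
qed

end
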